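(* Let $(\theta,\eta)=((T_\infty,\ell),\eta)$ have law $\mu\otimes\mathcal B(1/2)$ and let $Q_\infty=\Phi(\theta,\eta)$. Almost surely, there exists an infinite sequence of distinct vertices $p_1,p_2,\dots\in V(Q_\infty)$ such that every proper geodesic ray emanating from $\varnothing$ passes through all of $p_1,p_2,\dots$.
   Context: **The law $\mu$.** $\rho_l$ is the law of a Galton–Watson plane tree with offspring law $P(k)=2^{-k-1}$, root label $l$, and each non-root vertex labeled by its parent's label plus an independent uniform element of $\{-1,0,1\}$. $\mu$ is the law of $(T_\infty,\ell)$, which has a spine $\varnothing=S(0),S(1),\dots$ whose labels $X_n=\ell(S(n))$ form a random walk from 0 with i.i.d. uniform steps in $\{-1,0,1\}$. Conditionally on $(X_n)$, independent trees $L_n$ (to the left of $S(n)$) and $R_n$ (to the right), with law $\rho_{X_n}$, are grafted at each spine vertex. **The Schaeffer map $\Phi$.** Corners of $T_\infty$ are indexed by $\mathbb Z$: $c_0,c_1,\dots$ are the left-side corners in clockwise contour order from the root corner $c_0$ of $\varnothing$, and $c_{-1},c_{-2},\dots$ are the right-side corners in counterclockwise order. The successor of $c_i$ is the first $c_j$ with $j>i$ and $\ell(c_j)=\ell(c_i)-1$. $\Phi(\theta,\eta)$ is the infinite quadrangulation with vertex set $V(T_\infty)$ whose edges are the arcs joining each corner to its successor. It is rooted at the arc from $c_0$ to its successor, with orientation reversed iff $\eta=1$. $\mathcal B(1/2)$ is the uniform law on $\{0,1\}$. **Proper geodesic rays.** A proper geodesic ray emanating from $\varnothing$ is an infinite path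 $(u_0,u_1,\dots)$ in $Q_\infty$ with $u_0=\varnothing$ and $\ell(u_i)=-i$ for all $i$. Such a path is automatically a geodesic ray. *)

theory Defs
  imports "HOL-Probability.Probability"
begin

text \<open>Index set of the independent random variables.
  Step n          : label increment along the spine edge S(n) -- S(n+1), uniform on {-1,0,1}
  Kids n s u      : number of children of vertex u (Ulam-Harris word) of the tree grafted
                    at S(n) on side s (True = left tree L_n, False = right tree R_n);
                    law P(k) = 2^(-k-1)
  Incr n s u      : label increment of the non-root vertex u of that tree w.r.t. its parent,
                    uniform on {-1,0,1}
  Eta             : the rooting bit, uniform on {0,1}.\<close>

datatype idx = Step nat | Kids nat bool "nat list" | Incr nat bool "nat list" | Eta

definition input_pmf :: "idx \<Rightarrow> int pmf" where
  "input_pmf i = (case i of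
      Step n \<Rightarrow> pmf_of_set {-1, 0, 1}
    | Kids n s u \<Rightarrow> map_pmf int (geometric_pmf (1/2))
    | Incr n s u \<Rightarrow> pmf_of_set {-1, 0, 1}
    | Eta \<Rightarrow> pmf_of_set {0, 1})"

definition input_space :: "(idx \<Rightarrow> int) measure" where
  "input_space = PiM UNIV (\<lambda>i. measure_pmf (input_pmf i))"

definition kids :: "(idx \<Rightarrow> int) \<Rightarrow> nat \<Rightarrow> bool \<Rightarrow> nat list \<Rightarrow> nat" where
  "kids \<omega> n s u = nat (\<omega> (Kids n s u))"

definition in_tree :: "(idx \<Rightarrow> int) \<Rightarrow> nat \<Rightarrow> bool \<Rightarrow> nat list \<Rightarrow> bool" where
  "in_tree \<omega> n s u \<longleftrightarrow> (\<forall>j < length u. u ! j < kids \<omega> n s (take j u))"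

text \<open>Vertices of T_infinity: spine vertices S(n), and non-root vertices of L_n / R_n
  (the root of L_n and of R_n is identified with S(n)).\<close>
datatype vtx = Spine nat | Node nat bool "nat list"

definition vert :: "nat \<Rightarrow> bool \<Rightarrow> nat list \<Rightarrow> vtx" where
  "vert n s u = (if u = [] then Spine n else Node n s u)"

definition vertices :: "(idx \<Rightarrow> int) \<Rightarrow> vtx set" where
  "vertices \<omega> = {vert n s u | n s u. in_tree \<omega> n s u}"

definition spine_label :: "(idx \<Rightarrow> int) \<Rightarrow> nat \<Rightarrow> int" where
  "spine_label \<omega> n = (\<Sum>i<n. \<omega> (Step i))"

fun vlabel :: "(idx \<Rightarrow> int) \<Rightarrow> vtx \<Rightarrow> int" where
  "vlabel \<omega> (Spine n) = spine_label \<omega> n"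
| "vlabel \<omega> (Node n s u) = spine_label \<omega> n + (\<Sum>j\<in>{1..length u}. \<omega> (Incr n s (take j u)))"

text \<open>Corner s n u j: the j-th corner (0 \<le> j \<le> number of children) of vertex u of the tree
  grafted at S(n) on side s, i.e. the corner between the subtrees of children j-1 and j.
  In the contour of a plane tree these corners are ordered lexicographically by the word u@[j].
  Left corners are c_0, c_1, ... (clockwise from the root corner c_0 = Corner True 0 [] 0),
  right corners are c_(-1), c_(-2), ... (counterclockwise); the first corner of R_0 at the root
  coincides with c_0 and is therefore excluded.\<close>
datatype corner = Corner bool nat "nat list" nat

fun valid_corner :: "(idx \<Rightarrow> int) \<Rightarrow> corner \<Rightarrow> bool" where
  "valid_corner \<omega> (Corner s n u j) \<longleftrightarrow>
     in_tree \<omega> n s u \<and> j \<le> kids \<omega> n s u \<and> \<not> (\<not> s \<and> n = 0 \<and> u = [] \<and> j = 0)"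

text \<open>The order of corners corresponding to their index in the integers.\<close>
fun corner_less :: "corner \<Rightarrow> corner \<Rightarrow> bool" where
  "corner_less (Corner s n u j) (Corner s' n' u' j') \<longleftrightarrow>
     (\<not> s \<and> s')
   \<or> (s \<and> s' \<and> (n < n' \<or> (n = n' \<and> (u @ [j], u' @ [j']) \<in> lexord less_than)))
   \<or> (\<not> s \<and> \<not> s' \<and> (n' < n \<or> (n = n' \<and> (u' @ [j'], u @ [j]) \<in> lexord less_than)))"

fun corner_vertex :: "corner \<Rightarrow> vtx" where
  "corner_vertex (Corner s n u j) = vert n s u"

definition corner_label :: "(idx \<Rightarrow> int) \<Rightarrow> corner \<Rightarrow> int" where
  "corner_label \<omega> c = vlabel \<omega> (corner_vertex c)"

definition is_successor :: "(idx \<Rightarrow> int) \<Rightarrow> corner \<Rightarrow> corner \<Rightarrow> bool" where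
  "is_successor \<omega> c c' \<longleftrightarrow>
     valid_corner \<omega> c \<and> valid_corner \<omega> c' \<and> corner_less c c'
     \<and> corner_label \<omega> c' = corner_label \<omega> c - 1
     \<and> (\<forall>c''. valid_corner \<omega> c'' \<and> corner_less c c'' \<and> corner_less c'' c'
              \<longrightarrow> corner_label \<omega> c'' \<noteq> corner_label \<omega> c - 1)"

definition Q_adj :: "(idx \<Rightarrow> int) \<Rightarrow> vtx \<Rightarrow> vtx \<Rightarrow> bool" where
  "Q_adj \<omega> v w \<longleftrightarrow>
     (\<exists>c c'. is_successor \<omega> c c' \<and> {corner_vertex c, corner_vertex c'} = {v, w})"

definition Q_root :: "(idx \<Rightarrow> int) \<Rightarrow> vtx \<times> vtx" where
  "Q_root \<omega> = (let c0 = Corner True 0 [] 0;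
                   c1 = (THE c'. is_successor \<omega> c0 c')
               in if \<omega> Eta = 1 then (corner_vertex c1, corner_vertex c0)
                  else (corner_vertex c0, corner_vertex c1))"

definition proper_geodesic_ray :: "(idx \<Rightarrow> int) \<Rightarrow> (nat \<Rightarrow> vtx) \<Rightarrow> bool" where
  "proper_geodesic_ray \<omega> p \<longleftrightarrow>
     p 0 = Spine 0 \<and> (\<forall>i. Q_adj \<omega> (p i) (p (Suc i))) \<and> (\<forall>i. vlabel \<omega> (p i) = - int i)"

end

theory Submission
  imports Defs
begin

text \<open>
  Only arcs from a corner to its successor lower the label by one, so a proper ray follows such arcs.
  Among the positions on the left side, the ray that always leaves from the last left corner is the
  farthest: a ray that passes to the right-hand side comes back below the spine vertex it left. The
  nearest possible position at level \<open>k\<close> is the first left corner with label \<open>-k\<close>. Once the farthest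
  ray is found before that corner, every proper ray must pass through it, provided that no right
  tree grafted below the spine vertex carrying that corner contains the label \<open>-k\<close>.

  Let \<open>y_k\<close> be the depth, below its starting label, of the part of the tree that the farthest ray
  leaves behind at level \<open>k\<close>. The two extremal rays coincide after level \<open>k\<close> if
  \<open>y_j \<le> k - j\<close> for all \<open>j \<le> k\<close>. By memorylessness of the geometric law, \<open>y_k\<close> is conditionally
  distributed as the depth of a fresh tree, and \<open>P(y \<ge> x) = 2 / ((x + 1) (x + 2))\<close>. Hence the levels
  of a long block contribute no obstruction to coincidence at its end with conditional probability at
  least \<open>1/3\<close>, and earlier levels rarely do. Finally, on every scale
  \<open>K\<close> it has probability bounded below that, among about \<open>K\<^sup>2\<close> consecutive spine vertices, some left
  tree is much deeper than \<open>K\<close> while the right trees have depth less than \<open>K\<close>; on disjoint stretches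
  of the spine these events are independent, so infinitely many of them occur.
\<close>

section \<open>Independence in countable-valued product spaces\<close>

text \<open>The farthest ray is built from all the left trees, so its merging is not independent of
  the stretch of spine that is to supply a cut. Two uniformities remove this obstacle. The length
  \<open>s i\<close> of a window that contains a merged level, up to probability
  \<open>(1/2) ^ i\<close>, does not depend on where the window starts. And a good stretch of scale
  \<open>\<kappa>\<close> serves all levels from \<open>12 * \<kappa> - 1\<close> to
  \<open>32 * \<kappa> - 1\<close> at once; as soon as \<open>\<kappa>\<close> exceeds
  \<open>s i\<close>, a merged level in the window starting at \<open>12 * \<kappa>\<close> lies in
  this range, wherever it falls. Hence failures of merging need only be summable, and independence
  is asked of the stretches alone. Conditioning at an arrival meets a random corner whose vertex has
  a partly known number of children. Splitting according to the corner \<open>(n, u, j)\<close>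
  settles both: the past says about that number only that it is at least \<open>j\<close>. Merging
  has a chance at all because the depth tail is summable.\<close>

definition depends_on :: "(('i \<Rightarrow> 'a) \<Rightarrow> 'b) \<Rightarrow> 'i set \<Rightarrow> bool" where
  "depends_on f K \<longleftrightarrow> (\<forall>x y. (\<forall>i\<in>K. x i = y i) \<longrightarrow> f x = f y)"

lemma depends_onI: "(\<And>x y. (\<And>i. i \<in> K \<Longrightarrow> x i = y i) \<Longrightarrow> f x = f y) \<Longrightarrow> depends_on f K"
  unfolding depends_on_def by blast

lemma depends_onD: "depends_on f K \<Longrightarrow> (\<And>i. i \<in> K \<Longrightarrow> x i = y i) \<Longrightarrow> f x = f y"
  unfolding depends_on_def by blast

abbreviation prodM :: "('i \<Rightarrow> int pmf) \<Rightarrow> ('i \<Rightarrow> int) measure" where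
  "prodM p \<equiv> PiM UNIV (\<lambda>i. measure_pmf (p i))"

lemma space_prodM [simp]: "space (prodM p) = UNIV"
  by (simp add: space_PiM PiE_UNIV_domain)

lemma prob_space_prodM: "prob_space (prodM p)"
  by (intro prob_space_PiM measure_pmf.prob_space_axioms)

lemma coord_measurable [measurable]: "(\<lambda>\<omega>. \<omega> i) \<in> measurable (prodM p) (count_space UNIV)"
proof -
  have "(\<lambda>\<omega>. \<omega> i) \<in> measurable (prodM p) (measure_pmf (p i))"
    by (rule measurable_component_singleton) simp
  then show ?thesis by (simp add: measurable_def)
qed

text \<open>Grouping disjoint sets of coordinates preserves independence; the pointwise notion
  \<open>depends_on\<close> takes the place of measurability with respect to the coordinates in
  \<open>K k\<close>.\<close>

lemma prodM_indep:
  fixes p :: "'i \<Rightarrow> int pmf" and E :: "'k \<Rightarrow> ('i \<Rightarrow> int) \<Rightarrow> bool"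
  assumes E: "\<And>k. k \<in> I \<Longrightarrow> Measurable.pred (prodM p) (E k)"
    and dep: "\<And>k. k \<in> I \<Longrightarrow> depends_on (E k) (K k)"
    and disj: "disjoint_family_on K I"
  shows "prob_space.indep_events (prodM p) (\<lambda>k. {\<omega>. E k \<omega>}) I"
proof -
  interpret prob_space "prodM p" by (rule prob_space_prodM)
  let ?M = "\<lambda>i. measure_pmf (p i)"
  have "indep_vars ?M (\<lambda>i \<omega>. \<omega> i) UNIV"
  proof (subst indep_vars_iff_distr_eq_PiM)
    show "random_variable (?M i) (\<lambda>\<omega>. \<omega> i)" for i
      by (rule measurable_component_singleton) simp
    have 1: "distr (prodM p) (?M i) (\<lambda>\<omega>. \<omega> i) = ?M i" for i
      by (rule distr_PiM_component) (rule measure_pmf.prob_space_axioms, simp)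
    have 2: "distr (prodM p) (prodM p) (\<lambda>x. \<lambda>i\<in>UNIV. x i) = prodM p"
      by (simp add: restrict_UNIV distr_id2)
    show "distr (prodM p) (prodM p) (\<lambda>x. \<lambda>i\<in>UNIV. x i) = Pi\<^sub>M UNIV (\<lambda>i. distr (prodM p) (?M i) (\<lambda>\<omega>. \<omega> i))"
      unfolding 1 2 by simp
  qed auto
  then have iv: "indep_vars (\<lambda>k. PiM (K k) ?M) (\<lambda>k \<omega>. restrict (\<lambda>i. \<omega> i) (K k)) I"
    by (rule indep_vars_restrict) (use disj in auto)
  \<comment> \<open>Filling the coordinates outside \<open>K k\<close> with 0 turns
    \<open>E k\<close> into a measurable predicate of the restriction to \<open>K k\<close>; by
    \<open>depends_on\<close> its value does not change.\<close>
  define Q where "Q k x = E k (\<lambda>i. if i \<in> K k then x i else 0)" for k and x :: "'i \<Rightarrow> int"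
  have Qm: "Measurable.pred (PiM (K k) ?M) (Q k)" if "k \<in> I" for k
  proof -
    have "(\<lambda>x i. if i \<in> K k then x i else 0) \<in> measurable (PiM (K k) ?M) (prodM p)"
    proof (rule measurable_PiM_single')
      fix i
      show "(\<lambda>x. if i \<in> K k then x i else 0) \<in> measurable (PiM (K k) ?M) (?M i)"
      proof (cases "i \<in> K k")
        case True
        then show ?thesis
          using measurable_component_singleton[of i "K k" ?M] by simp
      qed simp
    qed auto
    then show ?thesis unfolding Q_def
      using E[OF that] by (rule measurable_compose)
  qed
  have eq: "{\<omega>. E k \<omega>} = {\<omega> \<in> space (prodM p). Q k (restrict (\<lambda>i. \<omega> i) (K k))}" if "k \<in> I" for k
  proof -
    have "E k (\<lambda>i. if i \<in> K k then restrict (\<lambda>i. \<omega> i) (K k) i else 0) = E k \<omega>" for \<omega>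
      by (rule depends_onD[OF dep[OF that]]) simp
    then show ?thesis by (simp add: Q_def)
  qed
  have ie: "indep_events (\<lambda>k. {\<omega> \<in> space (prodM p). Q k (restrict (\<lambda>i. \<omega> i) (K k))}) I"
    by (rule indep_eventsI_indep_vars[OF iv]) (use Qm in \<open>auto simp: pred_def\<close>)
  have cong: "indep_events F I = indep_events G I" if "\<And>k. k \<in> I \<Longrightarrow> F k = G k" for F G
  proof -
    have "prob (\<Inter>j\<in>J. F j) = (\<Prod>j\<in>J. prob (F j)) \<longleftrightarrow> prob (\<Inter>j\<in>J. G j) = (\<Prod>j\<in>J. prob (G j))"
      if "J \<subseteq> I" for J
    proof -
      have "(\<Inter>j\<in>J. F j) = (\<Inter>j\<in>J. G j)" "(\<Prod>j\<in>J. prob (F j)) = (\<Prod>j\<in>J. prob (G j))"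
        using that \<open>\<And>k. k \<in> I \<Longrightarrow> F k = G k\<close> by (auto intro!: prod.cong)
      then show ?thesis by simp
    qed
    moreover have "F ` I = G ` I" using that by auto
    ultimately show ?thesis unfolding indep_events_def by (auto simp del: INT_simps)
  qed
  show ?thesis
    by (subst cong[OF eq]) (assumption, rule ie)
qed

lemma prodM_prob_All:
  fixes p :: "'i \<Rightarrow> int pmf" and E :: "'k \<Rightarrow> ('i \<Rightarrow> int) \<Rightarrow> bool"
  assumes fin: "finite I"
    and E: "\<And>k. k \<in> I \<Longrightarrow> Measurable.pred (prodM p) (E k)"
    and dep: "\<And>k. k \<in> I \<Longrightarrow> depends_on (E k) (K k)"
    and disj: "disjoint_family_on K I"
  shows "measure (prodM p) {\<omega>. \<forall>k\<in>I. E k \<omega>} = (\<Prod>k\<in>I. measure (prodM p) {\<omega>. E k \<omega>})"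
proof (cases "I = {}")
  case True
  interpret prob_space "prodM p" by (rule prob_space_prodM)
  show ?thesis using True prob_space by simp
next
  case False
  interpret prob_space "prodM p" by (rule prob_space_prodM)
  have "indep_events (\<lambda>k. {\<omega>. E k \<omega>}) I" by (rule prodM_indep[OF E dep disj])
  then have "prob (\<Inter>k\<in>I. {\<omega>. E k \<omega>}) = (\<Prod>k\<in>I. prob {\<omega>. E k \<omega>})"
    using fin False unfolding indep_events_def by auto
  moreover have "(\<Inter>k\<in>I. {\<omega>. E k \<omega>}) = {\<omega>. \<forall>k\<in>I. E k \<omega>}" by auto
  ultimately show ?thesis by simp
qed

lemma prodM_prob_conj:
  fixes p :: "'i \<Rightarrow> int pmf"
  assumes "Measurable.pred (prodM p) A" "Measurable.pred (prodM p) B"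
    and "depends_on A K" "depends_on B L" "K \<inter> L = {}"
  shows "measure (prodM p) {\<omega>. A \<omega> \<and> B \<omega>} = measure (prodM p) {\<omega>. A \<omega>} * measure (prodM p) {\<omega>. B \<omega>}"
proof -
  have "measure (prodM p) {\<omega>. \<forall>k\<in>UNIV. (if k then A else B) \<omega>}
      = (\<Prod>k\<in>UNIV. measure (prodM p) {\<omega>. (if k then A else B) \<omega>})"
    by (rule prodM_prob_All[where K="\<lambda>k. if k then K else L"])
       (use assms in \<open>auto simp: disjoint_family_on_def\<close>)
  moreover have "{\<omega>. \<forall>k\<in>UNIV. (if k then A else B) \<omega>} = {\<omega>. A \<omega> \<and> B \<omega>}"
    by (auto simp: all_bool_eq)
  ultimately show ?thesis by (simp add: UNIV_bool)
qed

lemma prodM_reindex: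
  fixes f :: "'j \<Rightarrow> 'i"
  assumes "inj f" "\<And>j. q j = p (f j)"
  shows "distr (prodM p) (prodM q) (\<lambda>\<omega> j. \<omega> (f j)) = prodM q"
proof -
  have "distr (Pi\<^sub>M UNIV (\<lambda>i. measure_pmf (p i))) (\<Pi>\<^sub>M j\<in>UNIV. measure_pmf (p (f j))) (\<lambda>\<omega>. \<lambda>j\<in>UNIV. \<omega> (f j)) = (\<Pi>\<^sub>M j\<in>UNIV. measure_pmf (p (f j)))"
    by (rule distr_PiM_reindex) (simp_all add: measure_pmf.prob_space_axioms assms)
  then show ?thesis by (simp add: assms(2) restrict_UNIV)
qed

lemma reindex_measurable:
  assumes "\<And>j. q j = p (f j)"
  shows "(\<lambda>\<omega> j. \<omega> (f j)) \<in> measurable (prodM p) (prodM q)"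
proof (rule measurable_PiM_single')
  fix j
  show "(\<lambda>\<omega>. \<omega> (f j)) \<in> measurable (prodM p) (measure_pmf (q j))"
    unfolding assms by (rule measurable_component_singleton) simp
qed simp

lemma prodM_prob_reindex:
  fixes f :: "'j \<Rightarrow> 'i"
  assumes "inj f" "\<And>j. q j = p (f j)" and [measurable]: "Measurable.pred (prodM q) E"
  shows "measure (prodM p) {\<omega>. E (\<lambda>j. \<omega> (f j))} = measure (prodM q) {\<omega>. E \<omega>}"
proof -
  have [measurable]: "(\<lambda>\<omega> j. \<omega> (f j)) \<in> measurable (prodM p) (prodM q)"
    by (rule reindex_measurable) (rule assms)
  have "measure (prodM q) {\<omega>. E \<omega>} = measure (distr (prodM p) (prodM q) (\<lambda>\<omega> j. \<omega> (f j))) {\<omega> \<in> space (prodM q). E \<omega>}"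
    by (simp add: prodM_reindex[where p=p and f=f, OF assms(1,2)])
  also have "\<dots> = measure (prodM p) {\<omega>. E (\<lambda>j. \<omega> (f j))}"
    by (subst measure_distr) (use assms(3) in \<open>auto simp: vimage_def pred_def\<close>)
  finally show ?thesis by simp
qed

lemma prodM_prob_coord:
  "measure (prodM p) {\<omega>. \<omega> i \<in> S} = measure_pmf.prob (p i) S"
proof -
  have [measurable]: "(\<lambda>\<omega>. \<omega> i) \<in> measurable (prodM p) (measure_pmf (p i))"
    by (rule measurable_component_singleton) simp
  have "distr (prodM p) (measure_pmf (p i)) (\<lambda>\<omega>. \<omega> i) = measure_pmf (p i)"
    by (rule distr_PiM_component) (rule measure_pmf.prob_space_axioms, simp)
  then have "measure (measure_pmf (p i)) S = measure (distr (prodM p) (measure_pmf (p i)) (\<lambda>\<omega>. \<omega> i)) S"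
    by simp
  also have "\<dots> = measure (prodM p) {\<omega>. \<omega> i \<in> S}"
    by (subst measure_distr) (simp_all add: vimage_def)
  finally show ?thesis by simp
qed

section \<open>The minimal label of a labelled Galton--Watson tree\<close>

lemma measurable_add_count_space [measurable (raw)]:
  fixes f g :: "'a \<Rightarrow> int"
  assumes [measurable]: "f \<in> measurable M (count_space UNIV)" "g \<in> measurable M (count_space UNIV)"
  shows "(\<lambda>x. f x + g x) \<in> measurable M (count_space UNIV)"
proof (rule measurable_compose_countable[where f="\<lambda>i x. i + g x"])
  show "(\<lambda>x. i + g x) \<in> measurable M (count_space UNIV)" for i
    by (rule measurable_compose[OF assms(2)]) simp
qed (rule assms(1))

lemma measurable_sum_count_space [measurable (raw)]:
  fixes f :: "'b \<Rightarrow> 'a \<Rightarrow> int"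
  assumes "\<And>i. f i \<in> measurable M (count_space UNIV)"
  shows "(\<lambda>x. \<Sum>i\<in>I. f i x) \<in> measurable M (count_space UNIV)"
proof (induction I rule: infinite_finite_induct)
  case (insert i I)
  then show ?case by (simp add: measurable_add_count_space[OF assms])
qed simp_all

lemma pred_count_space:
  assumes "f \<in> measurable M (count_space UNIV)"
  shows "Measurable.pred M (\<lambda>x. P (f x))"
  by (rule measurable_compose[OF assms]) simp

lemma Collect_in_sets: "Measurable.pred (prodM p) Q \<Longrightarrow> {\<omega>. Q \<omega>} \<in> sets (prodM p)"
  by (simp add: pred_def)

text \<open>First-step conditioning on a coordinate with finite support; in each summand the
  parameter of \<open>B\<close> is a constant.\<close>

lemma prodM_split_coord:
  fixes p :: "'i \<Rightarrow> int pmf"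
  assumes "finite A" "set_pmf (p c) \<subseteq> A"
    and B: "\<And>i. Measurable.pred (prodM p) (B i)"
  shows "measure (prodM p) {\<omega>. B (\<omega> c) \<omega>} = (\<Sum>i\<in>A. measure (prodM p) {\<omega>. \<omega> c = i \<and> B i \<omega>})"
proof -
  interpret prob_space "prodM p" by (rule prob_space_prodM)
  note [measurable] = B
  have [measurable]: "Measurable.pred (prodM p) (\<lambda>\<omega>. B (\<omega> c) \<omega>)"
    by (rule measurable_compose_countable[where g="\<lambda>\<omega>. \<omega> c"]) measurable
  note m = Collect_in_sets
  have "measure (prodM p) {\<omega>. \<omega> c \<in> A} = 1"
    unfolding prodM_prob_coord using assms(2)
    by (subst measure_pmf.prob_eq_1) (auto simp: AE_measure_pmf_iff)
  then have ae: "AE \<omega> in prodM p. \<omega> c \<in> A"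
    by (subst (asm) prob_eq_1) (auto intro: m pred_count_space[OF coord_measurable])
  have "prob {\<omega>. B (\<omega> c) \<omega>} = prob (\<Union>i\<in>A. {\<omega>. \<omega> c = i \<and> B i \<omega>})"
  proof (rule measure_eq_AE)
    show "AE \<omega> in prodM p. \<omega> \<in> {\<omega>. B (\<omega> c) \<omega>} \<longleftrightarrow> \<omega> \<in> (\<Union>i\<in>A. {\<omega>. \<omega> c = i \<and> B i \<omega>})"
      using ae by eventually_elim auto
    show "(\<Union>i\<in>A. {\<omega>. \<omega> c = i \<and> B i \<omega>}) \<in> events"
      using assms(1) by (intro sets.finite_UN m) measurable
  qed (rule m, measurable)
  also have "\<dots> = (\<Sum>i\<in>A. prob {\<omega>. \<omega> c = i \<and> B i \<omega>})"
    by (rule finite_measure_finite_Union) (auto simp: assms disjoint_family_on_def intro!: m)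
  finally show ?thesis .
qed

section \<open>Labelled trees as families indexed by words\<close>

type_synonym tree_data = "nat list \<times> bool \<Rightarrow> int"

text \<open>Entry \<open>(v, True)\<close> is the number of children of \<open>v\<close>, entry
  \<open>(v, False)\<close> the label increment from the parent of \<open>v\<close>.\<close>

definition tree_pmf :: "nat list \<times> bool \<Rightarrow> int pmf" where
  "tree_pmf i = (if snd i then map_pmf int (geometric_pmf (1/2)) else pmf_of_set {-1, 0, 1})"

abbreviation "TM \<equiv> prodM tree_pmf"

definition root_kids :: "tree_data \<Rightarrow> nat" where
  "root_kids g = nat (g ([], True))"

definition subtree :: "tree_data \<Rightarrow> nat \<Rightarrow> tree_data" where
  "subtree g h = (\<lambda>(v, b). g (h # v, b))"

definition node :: "tree_data \<Rightarrow> nat list \<Rightarrow> bool" where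
  "node g v \<longleftrightarrow> (\<forall>j < length v. v ! j < nat (g (take j v, True)))"

definition rel_label :: "tree_data \<Rightarrow> nat list \<Rightarrow> int" where
  "rel_label g v = (\<Sum>j\<in>{1..length v}. g (take j v, False))"

text \<open>The depth, that is minus the least relative label, is less than \<open>x\<close>. The
  root has relative label 0, so no tree avoids \<open>x <= 0\<close>.\<close>

definition avoids :: "int \<Rightarrow> tree_data \<Rightarrow> bool" where
  "avoids x g \<longleftrightarrow> (\<forall>v. node g v \<longrightarrow> - x < rel_label g v)"

definition finite_tree :: "tree_data \<Rightarrow> bool" where
  "finite_tree g \<longleftrightarrow> finite {v. node g v}"

lemma node_Nil [simp]: "node g []"
  by (simp add: node_def)

lemma node_Cons: "node g (h # v) \<longleftrightarrow> h < root_kids g \<and> node (subtree g h) v"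
  unfolding node_def root_kids_def subtree_def by (auto simp: less_Suc_eq_0_disj nth_Cons' split: if_splits)

lemma rel_label_Nil [simp]: "rel_label g [] = 0"
  by (simp add: rel_label_def)

lemma rel_label_Cons: "rel_label g (h # v) = g ([h], False) + rel_label (subtree g h) v"
proof -
  have "rel_label g (h # v) = g (take 1 (h # v), False) + (\<Sum>j\<in>{Suc 1..Suc (length v)}. g (take j (h # v), False))"
    unfolding rel_label_def length_Cons by (rule sum.atLeast_Suc_atMost) simp
  also have "(\<Sum>j\<in>{Suc 1..Suc (length v)}. g (take j (h # v), False)) = (\<Sum>j\<in>{1..length v}. g (take (Suc j) (h # v), False))"
    by (rule sum.shift_bounds_cl_Suc_ivl)
  finally show ?thesis by (simp add: rel_label_def subtree_def)
qed

text \<open>Decomposition at the first generation: the root accounts for \<open>0 < x\<close>, and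
  the threshold of a child is shifted by its increment.\<close>

lemma avoids_rec:
  "avoids x g \<longleftrightarrow> 0 < x \<and> (\<forall>h < root_kids g. avoids (x + g ([h], False)) (subtree g h))"
proof
  assume *: "avoids x g"
  have "0 < x" using * unfolding avoids_def by (metis node_Nil rel_label_Nil neg_less_0_iff_less)
  moreover have "avoids (x + g ([h], False)) (subtree g h)" if "h < root_kids g" for h
    unfolding avoids_def
  proof (intro allI impI)
    fix v assume "node (subtree g h) v"
    then have "- x < rel_label g (h # v)" using * that unfolding avoids_def by (metis node_Cons)
    then show "- (x + g ([h], False)) < rel_label (subtree g h) v" by (simp add: rel_label_Cons)
  qed
  ultimately show "0 < x \<and> (\<forall>h < root_kids g. avoids (x + g ([h], False)) (subtree g h))" by blast
next
  assume *: "0 < x \<and> (\<forall>h < root_kids g. avoids (x + g ([h], False)) (subtree g h))"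
  show "avoids x g" unfolding avoids_def
  proof (intro allI impI)
    fix v assume v: "node g v"
    show "- x < rel_label g v"
    proof (cases v)
      case (Cons h v')
      with v * have "- (x + g ([h], False)) < rel_label (subtree g h) v'"
        unfolding avoids_def by (auto simp: node_Cons)
      then show ?thesis by (simp add: Cons rel_label_Cons)
    qed (use * in simp)
  qed
qed

lemma finite_tree_rec: "finite_tree g \<longleftrightarrow> (\<forall>h < root_kids g. finite_tree (subtree g h))"
proof -
  have eq: "{v. node g v} = insert [] (\<Union>h\<in>{..<root_kids g}. (#) h ` {v. node (subtree g h) v})"
  proof (rule set_eqI)
    fix v show "v \<in> {v. node g v} \<longleftrightarrow> v \<in> insert [] (\<Union>h\<in>{..<root_kids g}. (#) h ` {v. node (subtree g h) v})"
      by (cases v) (auto simp: node_Cons)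
  qed
  show ?thesis unfolding finite_tree_def eq by (auto simp: finite_image_iff)
qed

lemma avoids_mono: "avoids x g \<Longrightarrow> x \<le> y \<Longrightarrow> avoids y g"
  unfolding avoids_def by force

lemma measurable_tree_coord [measurable]: "(\<lambda>g. g i) \<in> measurable TM (count_space UNIV)"
  by (rule coord_measurable)

lemma root_kids_measurable [measurable]: "root_kids \<in> measurable TM (count_space UNIV)"
  unfolding root_kids_def by (rule measurable_compose[OF measurable_tree_coord]) simp

lemma node_measurable [measurable]: "Measurable.pred TM (\<lambda>g. node g v)"
proof -
  have [measurable]: "Measurable.pred TM (\<lambda>g. v ! j < nat (g i))" for j i
    by (rule pred_count_space[OF measurable_tree_coord])
  show ?thesis unfolding node_def by measurable
qed

lemma rel_label_measurable [measurable]: "(\<lambda>g. rel_label g v) \<in> measurable TM (count_space UNIV)"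
  unfolding rel_label_def by measurable

lemma avoids_measurable [measurable]: "Measurable.pred TM (avoids x)"
proof -
  have [measurable]: "Measurable.pred TM (\<lambda>g. - x < rel_label g v)" for v
    by (rule pred_count_space[OF rel_label_measurable])
  show ?thesis unfolding avoids_def by measurable
qed

lemma finite_tree_measurable [measurable]: "Measurable.pred TM finite_tree"
proof -
  \<comment> \<open>Finiteness becomes an existential over lists of words, of which there are
    countably many, so only countable operations remain.\<close>
  have "finite_tree g \<longleftrightarrow> (\<exists>vs. \<forall>v. node g v \<longrightarrow> v \<in> set vs)" for g
    unfolding finite_tree_def
    by (metis (mono_tags, lifting) finite_list finite_set finite_subset mem_Collect_eq subsetI)
  then have "finite_tree = (\<lambda>g. \<exists>vs. \<forall>v. node g v \<longrightarrow> v \<in> set vs)" by (rule ext)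
  moreover have "Measurable.pred TM (\<lambda>g. \<exists>vs. \<forall>v. node g v \<longrightarrow> v \<in> set vs)" by measurable
  ultimately show ?thesis by simp
qed

lemma subtree_reindex: "subtree g h = (\<lambda>i. g (case i of (v, b) \<Rightarrow> (h # v, b)))"
  by (auto simp: subtree_def fun_eq_iff)

lemma subtree_measurable [measurable]: "(\<lambda>g. subtree g h) \<in> measurable TM TM"
  unfolding subtree_reindex by (rule reindex_measurable) (auto simp: tree_pmf_def)

lemma prob_subtree:
  assumes "Measurable.pred TM E"
  shows "measure TM {g. E (subtree g h)} = measure TM {g. E g}"
  unfolding subtree_reindex
proof (rule prodM_prob_reindex)
  show "inj (\<lambda>i. case i of (v, b) \<Rightarrow> (h # v, b))" by (auto simp: inj_def)
  show "tree_pmf i = tree_pmf (case i of (v, b) \<Rightarrow> (h # v, b))" for i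
    by (auto simp: tree_pmf_def split: prod.split)
qed (rule assms)

lemma subtree_depends: "depends_on (\<lambda>g. E (subtree g h)) {(h # v, b) | v b. True}"
proof (rule depends_onI)
  fix x y :: tree_data assume "\<And>i. i \<in> {(h # v, b) | v b. True} \<Longrightarrow> x i = y i"
  then have "subtree x h = subtree y h" by (auto simp: subtree_def fun_eq_iff)
  then show "E (subtree x h) = E (subtree y h)" by simp
qed

lemma prob_root_kids: "measure TM {g. root_kids g = n} = (1/2) ^ Suc n"
proof -
  have "measure TM {g. root_kids g = n} = measure TM {g. g ([], True) \<in> {z. nat z = n}}"
    by (simp add: root_kids_def)
  also have "\<dots> = measure_pmf.prob (tree_pmf ([], True)) {z. nat z = n}" by (rule prodM_prob_coord)
  also have "\<dots> = measure_pmf.prob (geometric_pmf (1/2)) {n}"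
    by (simp add: tree_pmf_def vimage_def)
  also have "\<dots> = (1/2) ^ Suc n" by (simp add: measure_pmf_single)
  finally show ?thesis .
qed

text \<open>Memorylessness: given that there are at least \<open>j\<close> children, the number of further children
  is again geometric, and the law of the remaining part does not depend on \<open>j\<close>.\<close>

lemma prob_remaining_children:
  assumes C: "\<And>h. Measurable.pred TM (C h)"
    and dep: "\<And>h. depends_on (C h) {(h # v, b) | v b. True}"
    and \<beta>: "\<And>h. measure TM {g. C h g} = \<beta>"
  shows "measure TM {g. j \<le> root_kids g \<and> (\<forall>h. j \<le> h \<and> h < root_kids g \<longrightarrow> C h g)} = (1/2) ^ j / (2 - \<beta>)"
proof -
  interpret prob_space TM by (rule prob_space_prodM)
  note [measurable] = C
  \<comment> \<open>\<open>E m\<close> fixes the number of children to \<open>j + m\<close>; the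
    children from \<open>j\<close> on contribute \<open>\<beta> ^ m\<close> independently of that
    number, and the sum over \<open>m\<close> is a geometric series.\<close>
  define E where "E m g \<longleftrightarrow> root_kids g = j + m \<and> (\<forall>h\<in>{j..<j+m}. C h g)" for m g
  have [measurable]: "Measurable.pred TM (E m)" for m unfolding E_def by measurable
  have Em: "{g. E m g} \<in> events" for m by (rule Collect_in_sets) measurable
  have b: "0 \<le> \<beta>" "\<beta> \<le> 1" using \<beta>[of 0] by auto
  have Pm: "prob {g. E m g} = (1/2) ^ Suc (j + m) * \<beta> ^ m" for m
  proof -
    have "prob {g. root_kids g = j + m \<and> (\<forall>h\<in>{j..<j+m}. C h g)}
        = prob {g. root_kids g = j + m} * prob {g. \<forall>h\<in>{j..<j+m}. C h g}"
    proof (rule prodM_prob_conj[where K="{([], True)}" and L="{(h # v, b) | h v b. True}"])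
      show "depends_on (\<lambda>g. root_kids g = j + m) {([], True)}"
        by (auto simp: depends_on_def root_kids_def)
      show "depends_on (\<lambda>g. \<forall>h\<in>{j..<j+m}. C h g) {(h # v, b) | h v b. True}"
      proof (rule depends_onI)
        fix x y :: tree_data assume *: "\<And>i. i \<in> {(h # v, b) | h v b. True} \<Longrightarrow> x i = y i"
        have "C h x = C h y" for h by (rule depends_onD[OF dep]) (use * in blast)
        then show "(\<forall>h\<in>{j..<j+m}. C h x) = (\<forall>h\<in>{j..<j+m}. C h y)" by simp
      qed
    qed auto
    also have "prob {g. \<forall>h\<in>{j..<j+m}. C h g} = (\<Prod>h\<in>{j..<j+m}. prob {g. C h g})"
      by (rule prodM_prob_All[OF _ C dep]) (auto simp: disjoint_family_on_def)
    finally show ?thesis by (simp add: E_def \<beta> prob_root_kids)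
  qed
  have S1: "(\<lambda>m. prob {g. E m g}) sums prob (\<Union>m. {g. E m g})"
    by (rule finite_measure_UNION) (use Em in \<open>auto simp: disjoint_family_on_def E_def\<close>)
  have S2: "(\<lambda>m. (1/2) ^ Suc (j + m) * \<beta> ^ m) sums ((1/2) ^ j / (2 - \<beta>))"
  proof -
    have "(\<lambda>m. (1/2) ^ Suc j * (\<beta> / 2) ^ m) sums ((1/2) ^ Suc j * (1 / (1 - \<beta> / 2)))"
      by (intro sums_mult geometric_sums) (use b in auto)
    moreover have "(1/2) ^ Suc j * (\<beta> / 2) ^ m = (1/2) ^ Suc (j + m) * \<beta> ^ m" for m
      by (simp add: power_add power_divide power_mult_distrib field_simps)
    moreover have "(1/2) ^ Suc j * (1 / (1 - \<beta> / 2)) = (1/2) ^ j / (2 - \<beta>)"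
      using b by (simp add: field_simps)
    ultimately show ?thesis by simp
  qed
  have "prob (\<Union>m. {g. E m g}) = (1/2) ^ j / (2 - \<beta>)"
    by (rule sums_unique2[OF S1[unfolded Pm] S2])
  moreover have "(\<Union>m. {g. E m g}) = {g. j \<le> root_kids g \<and> (\<forall>h. j \<le> h \<and> h < root_kids g \<longrightarrow> C h g)}"
  proof (intro equalityI subsetI)
    fix g assume g: "g \<in> {g. j \<le> root_kids g \<and> (\<forall>h. j \<le> h \<and> h < root_kids g \<longrightarrow> C h g)}"
    then have "E (root_kids g - j) g" by (auto simp: E_def)
    then show "g \<in> (\<Union>m. {g. E m g})" by blast
  qed (auto simp: E_def)
  ultimately show ?thesis by simp
qed

text \<open>With \<open>j = 0\<close> the recursion gives \<open>e * (2 - e) = 1\<close> for the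
  probability \<open>e\<close> of finiteness; criticality shows as the double root 1.\<close>

lemma AE_finite_tree: "AE g in TM. finite_tree g"
proof -
  interpret prob_space TM by (rule prob_space_prodM)
  define e where "e = prob {g. finite_tree g}"
  have "e = prob {g. 0 \<le> root_kids g \<and> (\<forall>h. 0 \<le> h \<and> h < root_kids g \<longrightarrow> finite_tree (subtree g h))}"
    unfolding e_def by (rule arg_cong[where f=prob], rule Collect_cong, subst finite_tree_rec) simp
  also have "\<dots> = (1/2) ^ 0 / (2 - e)"
  proof (rule prob_remaining_children)
    show "depends_on (\<lambda>g. finite_tree (subtree g h)) {(h # v, b) | v b. True}" for h
      by (rule subtree_depends)
    show "prob {g. finite_tree (subtree g h)} = e" for h unfolding e_def by (rule prob_subtree) simp
  qed measurable
  finally have "e * (2 - e) = 1" using prob_le_1[of "{g. finite_tree g}"] by (auto simp: e_def field_simps)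
  then have "(e - 1)^2 = 0" by (simp add: power2_eq_square algebra_simps)
  then have "prob {g. finite_tree g} = 1" by (simp add: e_def)
  moreover have "{g. finite_tree g} \<in> events" by (rule Collect_in_sets) measurable
  ultimately show ?thesis by (simp add: prob_eq_1)
qed

section \<open>The exact law of the depth\<close>

definition avoid_prob :: "int \<Rightarrow> real" where
  "avoid_prob x = measure TM {g. avoids x g}"

definition avoid_mean :: "int \<Rightarrow> real" where
  "avoid_mean x = (avoid_prob (x - 1) + avoid_prob x + avoid_prob (x + 1)) / 3"

lemma prob_child_avoids:
  "measure TM {g. avoids (x + g ([h], False)) (subtree g h)} = avoid_mean x"
proof -
  interpret prob_space TM by (rule prob_space_prodM)
  have "prob {g. avoids (x + g ([h], False)) (subtree g h)}
      = (\<Sum>i\<in>{-1,0,1}. prob {g. g ([h], False) = i \<and> avoids (x + i) (subtree g h)})"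
    by (rule prodM_split_coord) (simp_all add: tree_pmf_def)
  also have "\<dots> = (\<Sum>i\<in>{-1,0,1}. 1/3 * avoid_prob (x + i))"
  proof (rule sum.cong[OF refl])
    fix i :: int assume i: "i \<in> {-1,0,1}"
    have "prob {g. g ([h], False) = i \<and> avoids (x + i) (subtree g h)}
        = prob {g. g ([h], False) = i} * prob {g. avoids (x + i) (subtree g h)}"
    proof (rule prodM_prob_conj[where K="{([h], False)}" and L="- {([h], False)}"])
      show "depends_on (\<lambda>g. g ([h], False) = i) {([h], False)}" by (auto simp: depends_on_def)
      \<comment> \<open>The increment of child \<open>h\<close> sits at the root entry of
        \<open>subtree g h\<close>, while relative labels only sum increments below the root; so the
        two events use disjoint coordinates.\<close>
      show "depends_on (\<lambda>g. avoids (x + i) (subtree g h)) (- {([h], False)})"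
      proof (rule depends_onI)
        fix g g' :: tree_data assume *: "\<And>i. i \<in> - {([h], False)} \<Longrightarrow> g i = g' i"
        have "node (subtree g h) v = node (subtree g' h) v" for v
          unfolding node_def subtree_def using * by simp
        moreover have "rel_label (subtree g h) v = rel_label (subtree g' h) v" for v
          unfolding rel_label_def subtree_def
        proof (rule sum.cong[OF refl])
          fix j assume "j \<in> {1..length v}"
          then have "take j v \<noteq> []" by auto
          then show "(case (take j v, False) of (v, b) \<Rightarrow> g (h # v, b)) = (case (take j v, False) of (v, b) \<Rightarrow> g' (h # v, b))"
            using * by simp
        qed
        ultimately show "avoids (x + i) (subtree g h) = avoids (x + i) (subtree g' h)"
          by (simp add: avoids_def)
      qed
      show "Measurable.pred TM (\<lambda>g. g ([h], False) = i)"
        by (rule pred_count_space[OF measurable_tree_coord])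
    qed auto
    also have "prob {g. g ([h], False) = i} = 1/3"
      using prodM_prob_coord[of tree_pmf "([h], False)" "{i}"] i
      by (auto simp: tree_pmf_def measure_pmf_single)
    also have "prob {g. avoids (x + i) (subtree g h)} = avoid_prob (x + i)"
      unfolding avoid_prob_def by (rule prob_subtree) simp
    finally show "prob {g. g ([h], False) = i \<and> avoids (x + i) (subtree g h)} = 1/3 * avoid_prob (x + i)" .
  qed
  finally show ?thesis by (simp add: avoid_mean_def)
qed

lemma prob_remaining_avoids:
  "measure TM {g. j \<le> root_kids g \<and>
      (\<forall>h. j \<le> h \<and> h < root_kids g \<longrightarrow> avoids (x + g ([h], False)) (subtree g h))}
    = (1/2) ^ j / (2 - avoid_mean x)"
proof (rule prob_remaining_children)
  show "Measurable.pred TM (\<lambda>g. avoids (x + g ([h], False)) (subtree g h))" for h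
    by (rule measurable_compose_countable[where g="\<lambda>g. g ([h], False)"]) measurable
  show "depends_on (\<lambda>g. avoids (x + g ([h], False)) (subtree g h)) {(h # v, b) | v b. True}" for h
  proof (rule depends_onI)
    fix g g' :: tree_data assume *: "\<And>i. i \<in> {(h # v, b) | v b. True} \<Longrightarrow> g i = g' i"
    then have "subtree g h = subtree g' h" by (auto simp: subtree_def fun_eq_iff)
    moreover have "g ([h], False) = g' ([h], False)" using * by blast
    ultimately show "avoids (x + g ([h], False)) (subtree g h) = avoids (x + g' ([h], False)) (subtree g' h)"
      by simp
  qed
qed (rule prob_child_avoids)

lemma avoid_prob_nonpos: "x \<le> 0 \<Longrightarrow> avoid_prob x = 0"
proof -
  assume "x \<le> 0"
  then have "{g. avoids x g} = {}" using avoids_rec[of x] by auto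
  then show ?thesis by (simp add: avoid_prob_def)
qed

text \<open>Every child must succeed, each with probability \<open>avoid_mean x\<close>;
  \<open>1 / (2 - z)\<close> is the generating function of the offspring law.\<close>

lemma avoid_prob_fixpoint:
  assumes "0 < x"
  shows "avoid_prob x = 1 / (2 - avoid_mean x)"
proof -
  have "{g. avoids x g} = {g. 0 \<le> root_kids g \<and>
      (\<forall>h. 0 \<le> h \<and> h < root_kids g \<longrightarrow> avoids (x + g ([h], False)) (subtree g h))}"
    by (rule Collect_cong, subst avoids_rec) (simp add: assms)
  then show ?thesis unfolding avoid_prob_def using prob_remaining_avoids[of 0 x] by simp
qed

lemma avoid_prob_le_1: "avoid_prob x \<le> 1"
  unfolding avoid_prob_def by (rule prob_space.prob_le_1[OF prob_space_prodM])

lemma avoid_prob_mono: "x \<le> y \<Longrightarrow> avoid_prob x \<le> avoid_prob y"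
proof -
  interpret prob_space TM by (rule prob_space_prodM)
  show "x \<le> y \<Longrightarrow> avoid_prob x \<le> avoid_prob y"
    unfolding avoid_prob_def
    by (rule finite_measure_mono) (use avoids_mono in \<open>blast intro: Collect_in_sets avoids_measurable\<close>)+
qed

lemma avoid_mean_le_1: "avoid_mean x \<le> 1"
  using avoid_prob_le_1[of x] avoid_prob_le_1[of "x-1"] avoid_prob_le_1[of "x+1"]
  by (simp add: avoid_mean_def)

text \<open>The recursion \<open>w (2 - avg w) = 1\<close> is integrable: with \<open>r = 2 w\<close> the quantity
  \<open>r r' (1 - (r + r') / 12) - r - r'\<close> of two consecutive values is conserved. Since \<open>w\<close> is monotone
  and its limit satisfies \<open>w (2 - w) = 1\<close>, this determines \<open>w\<close> at \<open>1\<close>, hence everywhere.\<close>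

lemma avoid_prob_nat: "avoid_prob (int n) = real n * (real n + 3) / ((real n + 1) * (real n + 2))"
proof -
  define u where "u n = avoid_prob (int n)" for n
  have rec: "u (Suc n) * (6 - (u n + u (Suc n) + u (Suc (Suc n)))) = 3" for n
    using avoid_prob_fixpoint[of "int (Suc n)"] avoid_mean_le_1[of "int (Suc n)"]
    unfolding u_def avoid_mean_def by (simp add: field_simps)
  have u0: "u 0 = 0" by (simp add: u_def avoid_prob_nonpos)
  \<comment> \<open>Three times the conserved quantity, written in terms of
    \<open>u\<close>.\<close>
  define f where "f n = 2 * u n * u (Suc n) * (6 - (u n + u (Suc n))) - 6 * u n - 6 * u (Suc n)" for n
  have step: "f (Suc n) = f n" for n
  proof -
    define X where "X = u (Suc n) * (6 - (u n + u (Suc n) + u (Suc (Suc n))))"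
    have "f (Suc n) - f n = 2 * u (Suc (Suc n)) * X - 2 * u n * X - 6 * u (Suc (Suc n)) + 6 * u n"
      unfolding f_def X_def by (simp add: algebra_simps)
    then show ?thesis using rec[of n] by (simp add: X_def)
  qed
  have fc: "f n = - 6 * u 1" for n
  proof (induction n)
    case 0
    then show ?case by (simp add: f_def u0)
  next
    case (Suc n)
    then show ?case by (simp add: step)
  qed
  have "incseq u" by (auto simp: incseq_def u_def intro: avoid_prob_mono)
  moreover have "\<forall>n. u n \<le> 1" by (auto simp: u_def avoid_prob_le_1)
  ultimately obtain L where L: "u \<longlonglongrightarrow> L" using incseq_convergent by blast
  then have L1: "(\<lambda>n. u (Suc n)) \<longlonglongrightarrow> L" and L2: "(\<lambda>n. u (Suc (Suc n))) \<longlonglongrightarrow> L"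
    by (rule LIMSEQ_Suc, intro LIMSEQ_Suc)
  have "(\<lambda>n. u (Suc n) * (6 - (u n + u (Suc n) + u (Suc (Suc n))))) \<longlonglongrightarrow> L * (6 - (L + L + L))"
    by (intro tendsto_intros L L1 L2)
  then have "L * (6 - (L + L + L)) = 3" unfolding rec using LIMSEQ_unique tendsto_const by metis
  then have "(L - 1)^2 = 0" by (simp add: power2_eq_square algebra_simps)
  then have [simp]: "L = 1" by simp
  \<comment> \<open>The conserved quantity is \<open>- 6 * u 1\<close> at index 0 and tends to -4,
    which yields the unknown initial value.\<close>
  have "f \<longlonglongrightarrow> 2 * L * L * (6 - (L + L)) - 6 * L - 6 * L"
    unfolding f_def by (intro tendsto_intros L L1)
  then have "- 6 * u 1 = 2 * L * L * (6 - (L + L)) - 6 * L - 6 * L"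
    unfolding fc using LIMSEQ_unique tendsto_const by metis
  then have u1: "u 1 = 2 / 3" by simp
  have "u n = real n * (real n + 3) / ((real n + 1) * (real n + 2)) \<and>
      u (Suc n) = (real n + 1) * (real n + 4) / ((real n + 2) * (real n + 3))"
  proof (induction n)
    case 0
    then show ?case using u0 u1 by simp
  next
    case (Suc n)
    then have a: "u n = real n * (real n + 3) / ((real n + 1) * (real n + 2))"
      and b: "u (Suc n) = (real n + 1) * (real n + 4) / ((real n + 2) * (real n + 3))" by auto
    define y where "y = real n"
    have y: "y \<ge> 0" by (simp add: y_def)
    have pos: "u (Suc n) > 0" unfolding b by (simp add: add_pos_nonneg)
    have "u (Suc (Suc n)) = 6 - 3 / u (Suc n) - u n - u (Suc n)"
      using rec[of n] pos by (simp add: field_simps)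
    also have "\<dots> = 6 - 3 * ((y + 2) * (y + 3)) / ((y + 1) * (y + 4)) - y * (y + 3) / ((y + 1) * (y + 2))
        - (y + 1) * (y + 4) / ((y + 2) * (y + 3))"
      unfolding a b y_def by simp
    also have "\<dots> = (y + 2) * (y + 5) / ((y + 3) * (y + 4))"
    proof -
      have nz: "y + 1 \<noteq> 0" "y + 2 \<noteq> 0" "y + 3 \<noteq> 0" "y + 4 \<noteq> 0" using y by auto
      show ?thesis using nz by (simp add: divide_simps) (simp add: algebra_simps)
    qed
    finally show ?case using b by (simp add: y_def add_ac)
  qed
  then show ?thesis by (simp add: u_def)
qed

lemma avoid_prob_nat': "1 - avoid_prob (int n) = 2 / ((real n + 1) * (real n + 2))"
  unfolding avoid_prob_nat by (simp add: divide_simps) (simp add: algebra_simps add_pos_nonneg)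

section \<open>The contour of the left forest\<close>

text \<open>Downward steps of at most one skip no value on the way down; upward jumps may be
  arbitrary.\<close>

lemma int_ivt:
  fixes f :: "nat \<Rightarrow> int"
  assumes "s \<le> t" "\<And>q. f (Suc q) \<ge> f q - 1" "x \<le> f s" "f t \<le> x"
  shows "\<exists>q. s \<le> q \<and> q \<le> t \<and> f q = x"
  using assms(1,4)
proof (induction t rule: dec_induct)
  case base
  then show ?case using assms(3) by force
next
  case (step t)
  show ?case
  proof (cases "f t \<le> x")
    case True
    then show ?thesis using step by force
  next
    case False
    then have "f (Suc t) = x" using assms(2)[of t] step by simp
    then show ?thesis using step by (intro exI[of _ "Suc t"]) auto
  qed
qed

lemma in_tree_snoc: "in_tree \<omega> n s (u @ [j]) \<longleftrightarrow> in_tree \<omega> n s u \<and> j < kids \<omega> n s u"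
  unfolding in_tree_def by (auto simp: less_Suc_eq nth_append)

lemma in_tree_append: "in_tree \<omega> n s (u @ v) \<Longrightarrow> in_tree \<omega> n s u"
  unfolding in_tree_def
proof (intro allI impI)
  fix j assume *: "\<forall>j<length (u @ v). (u @ v) ! j < kids \<omega> n s (take j (u @ v))" "j < length u"
  then show "u ! j < kids \<omega> n s (take j u)" using *(1)[rule_format, of j] by (simp add: nth_append)
qed

lemma in_tree_Nil [simp]: "in_tree \<omega> n s []"
  by (simp add: in_tree_def)

lemma in_tree_child: "in_tree \<omega> n s (u @ h # v) \<Longrightarrow> h < kids \<omega> n s u"
  using in_tree_append[of \<omega> n s "u @ [h]" v] by (simp add: in_tree_snoc)

lemma vlabel_vert:
  "vlabel \<omega> (vert n s u) = spine_label \<omega> n + (\<Sum>j\<in>{1..length u}. \<omega> (Incr n s (take j u)))"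
  by (simp add: vert_def)

lemma vlabel_snoc:
  "vlabel \<omega> (vert n s (u @ [j])) = vlabel \<omega> (vert n s u) + \<omega> (Incr n s (u @ [j]))"
proof -
  have "(\<Sum>i\<in>{1..length u}. \<omega> (Incr n s (take i (u @ [j])))) = (\<Sum>i\<in>{1..length u}. \<omega> (Incr n s (take i u)))"
    by (rule sum.cong) auto
  then show ?thesis unfolding vlabel_vert by simp
qed

text \<open>A left corner is a triple \<open>(n, u, j)\<close>: the \<open>j\<close>-th corner of the vertex \<open>u\<close> of \<open>L_n\<close>.\<close>

type_synonym lcorner = "nat \<times> nat list \<times> nat"

definition lc_word :: "lcorner \<Rightarrow> nat list" where
  "lc_word c = fst (snd c) @ [snd (snd c)]"

definition lc_less :: "lcorner \<Rightarrow> lcorner \<Rightarrow> bool" where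
  "lc_less c c' \<longleftrightarrow> fst c < fst c' \<or> fst c = fst c' \<and> (lc_word c, lc_word c') \<in> lexord less_than"

definition lc_valid :: "(idx \<Rightarrow> int) \<Rightarrow> lcorner \<Rightarrow> bool" where
  "lc_valid \<omega> c = (case c of (n, u, j) \<Rightarrow> in_tree \<omega> n True u \<and> j \<le> kids \<omega> n True u)"

definition lc_vertex :: "lcorner \<Rightarrow> vtx" where
  "lc_vertex c = (case c of (n, u, j) \<Rightarrow> vert n True u)"

definition next_lc :: "(idx \<Rightarrow> int) \<Rightarrow> lcorner \<Rightarrow> lcorner" where
  "next_lc \<omega> c = (case c of (n, u, j) \<Rightarrow>
     if j < kids \<omega> n True u then (n, u @ [j], 0)
     else if u = [] then (Suc n, [], 0) else (n, butlast u, Suc (last u)))"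

text \<open>Time \<open>t\<close> is the index of the corner in the contour order: the abstract
  order becomes an explicit sequence that respects it (\<open>contour_less_iff\<close>) and, when
  the trees are finite, exhausts the left corners (\<open>contour_surj\<close>).\<close>

primrec contour :: "(idx \<Rightarrow> int) \<Rightarrow> nat \<Rightarrow> lcorner" where
  "contour \<omega> 0 = (0, [], 0)"
| "contour \<omega> (Suc t) = next_lc \<omega> (contour \<omega> t)"

definition lab :: "(idx \<Rightarrow> int) \<Rightarrow> nat \<Rightarrow> int" where
  "lab \<omega> t = vlabel \<omega> (lc_vertex (contour \<omega> t))"

lemma lc_less_irrefl [simp]: "\<not> lc_less c c"
  by (simp add: lc_less_def lexord_irreflexive)

lemma lc_less_trans: "lc_less a b \<Longrightarrow> lc_less b c \<Longrightarrow> lc_less a c"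
  unfolding lc_less_def by (auto intro: lexord_trans)

lemma lc_less_linear: "lc_less a b \<or> a = b \<or> lc_less b a"
proof -
  have "(lc_word a, lc_word b) \<in> lexord less_than \<or> lc_word a = lc_word b \<or> (lc_word b, lc_word a) \<in> lexord less_than"
    by (rule lexord_linear) auto
  then show ?thesis
    unfolding lc_less_def by (cases a; cases b) (auto simp: lc_word_def)
qed

lemma next_lc_valid: "lc_valid \<omega> c \<Longrightarrow> lc_valid \<omega> (next_lc \<omega> c)"
proof (cases c)
  case (fields n u j)
  assume c: "lc_valid \<omega> c"
  show ?thesis
  proof (cases "j < kids \<omega> n True u \<or> u = []")
    case True
    then show ?thesis using c by (auto simp: fields lc_valid_def next_lc_def in_tree_snoc)
  next
    case False
    then obtain v i where u: "u = v @ [i]" by (metis rev_exhaust)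
    then show ?thesis using c False by (auto simp: fields lc_valid_def next_lc_def in_tree_snoc)
  qed
qed

lemma lc_less_next: "lc_valid \<omega> c \<Longrightarrow> lc_less c (next_lc \<omega> c)"
proof (cases c)
  case (fields n u j)
  show ?thesis
  proof (cases "j < kids \<omega> n True u \<or> u = []")
    case True
    then show ?thesis by (auto simp: fields next_lc_def lc_less_def lc_word_def lexord_def)
  next
    case False
    then obtain v i where u: "u = v @ [i]" by (metis rev_exhaust)
    then show ?thesis using False
      by (auto simp: fields next_lc_def lc_less_def lc_word_def lexord_same_pref_iff)
  qed
qed

text \<open>Among words of naturals, \<open>x @ [0]\<close> is the immediate lexicographic successor
  of \<open>x\<close>.\<close>

lemma lexord_snoc_0:
  fixes x z :: "nat list"
  assumes "(x, z) \<in> lexord less_than" "z \<noteq> x @ [0]"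
  shows "(x @ [0], z) \<in> lexord less_than"
  using assms
proof (induction x arbitrary: z)
  case Nil
  then obtain b w where "z = b # w" by (cases z) auto
  then show ?case using Nil by (cases b; cases w) auto
next
  case (Cons a x)
  then obtain b w where "z = b # w" by (cases z) auto
  then show ?case using Cons by auto
qed

text \<open>When descending, the next word is the immediate lexicographic successor. When going up
  or along the spine, the words in between continue \<open>u\<close> with an index of at least the
  number of its children, which validity forbids.\<close>

lemma next_lc_least:
  assumes "lc_valid \<omega> c" "lc_valid \<omega> c'" "lc_less c c'" "c' \<noteq> next_lc \<omega> c"
  shows "lc_less (next_lc \<omega> c) c'"
proof -
  obtain n u j where c: "c = (n, u, j)" by (cases c)
  obtain n' u' j' where c': "c' = (n', u', j')" by (cases c')
  have t': "in_tree \<omega> n' True u'" "j' \<le> kids \<omega> n' True u'" using assms(2) by (auto simp: c' lc_valid_def)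
  have jk: "j \<le> kids \<omega> n True u" using assms(1) by (auto simp: c lc_valid_def)
  consider (child) "j < kids \<omega> n True u" | (up) v i where "j = kids \<omega> n True u" "u = v @ [i]"
    | (root) "j = kids \<omega> n True u" "u = []"
    using jk by (metis le_neq_implies_less rev_exhaust)
  then show ?thesis
  proof cases
    case child
    then have nx: "next_lc \<omega> c = (n, u @ [j], 0)" by (simp add: c next_lc_def)
    show ?thesis
    proof (cases "n' = n")
      case True
      then have "(u @ [j], u' @ [j']) \<in> lexord less_than"
        using assms(3) by (auto simp: c c' lc_less_def lc_word_def)
      moreover have "u' @ [j'] \<noteq> (u @ [j]) @ [0]"
        using assms(4) True by (auto simp: nx c')
      ultimately have "((u @ [j]) @ [0], u' @ [j']) \<in> lexord less_than" by (rule lexord_snoc_0)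
      then show ?thesis by (simp add: nx c' True lc_less_def lc_word_def)
    next
      case False
      then have "n < n'" using assms(3) by (auto simp: c c' lc_less_def)
      then show ?thesis by (auto simp: nx c' lc_less_def)
    qed
  next
    case root
    then have nx: "next_lc \<omega> c = (Suc n, [], 0)" by (simp add: c next_lc_def)
    have "n < n'"
    proof (rule ccontr)
      assume "\<not> n < n'"
      then have *: "n' = n" "([j], u' @ [j']) \<in> lexord less_than"
        using assms(3) root by (auto simp: c c' lc_less_def lc_word_def)
      show False
      proof (cases u')
        case Nil
        then show False using * t' root by simp
      next
        case (Cons h w)
        then have "h < kids \<omega> n True []" using in_tree_child[of \<omega> n' True "[]" h w] t' * by simp
        then show False using * Cons root by simp
      qed
    qed
    moreover have "([0], u' @ [j']) \<in> lexord less_than" if "n' = Suc n"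
    proof -
      have "u' @ [j'] \<noteq> [] @ [0]" using assms(4) that by (auto simp: nx c')
      then show ?thesis using lexord_snoc_0[of "[]" "u' @ [j']"] by (cases u') auto
    qed
    ultimately show ?thesis by (auto simp: nx c' lc_less_def lc_word_def)
  next
    case up
    then have nx: "next_lc \<omega> c = (n, v, Suc i)" by (simp add: c next_lc_def)
    show ?thesis
    proof (cases "n' = n")
      case True
      have lt: "(v @ [i, j], u' @ [j']) \<in> lexord less_than"
        using assms(3) up by (simp add: c c' True lc_less_def lc_word_def)
      have ne: "u' @ [j'] \<noteq> v @ [Suc i]" using assms(4) by (auto simp: nx c' True)
      have t: "in_tree \<omega> n True u'" "j' \<le> kids \<omega> n True u'" using t' True by auto
      \<comment> \<open>A word above \<open>v @ [i, j]\<close> either continues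
        \<open>v @ [i]\<close> or is at least \<open>v @ [Suc i]\<close>.\<close>
      have key: "(v @ [Suc i], w) \<in> lexord less_than"
        if "(v @ [i, j], w) \<in> lexord less_than" "w \<noteq> v @ [Suc i]"
          "\<not> (\<exists>z. w = v @ i # z \<and> ([j], z) \<in> lexord less_than)" for w :: "nat list"
        using that
      proof (induction v arbitrary: w)
        case Nil
        then obtain b z where w: "w = b # z" by (cases w) auto
        have "i \<le> b" "b \<noteq> i" "b = Suc i \<Longrightarrow> z \<noteq> []" using Nil by (auto simp: w)
        then have "b = Suc i \<and> z \<noteq> [] \<or> Suc i < b" by linarith
        then show ?case by (cases z) (auto simp: w)
      next
        case (Cons a v)
        then show ?case by (cases w) auto
      qed
      have "\<not> (\<exists>z. u' @ [j'] = v @ i # z \<and> ([j], z) \<in> lexord less_than)"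
      proof
        assume "\<exists>z. u' @ [j'] = v @ i # z \<and> ([j], z) \<in> lexord less_than"
        then obtain z where z: "u' @ [j'] = u @ z" "([j], z) \<in> lexord less_than" by (auto simp: up)
        show False
        proof (cases z rule: rev_cases)
          case Nil
          then show False using z by simp
        next
          case (snoc w b)
          then have u': "u' = u @ w" "b = j'" using z by auto
          show False
          proof (cases w)
            case Nil
            then show False using z t up snoc u' by simp
          next
            case (Cons h w')
            then have "h < kids \<omega> n True u" using in_tree_child[of \<omega> n True u h w'] t u' by simp
            then show False using z snoc Cons up by simp
          qed
        qed
      qed
      then have "(v @ [Suc i], u' @ [j']) \<in> lexord less_than" by (intro key lt ne)
      then show ?thesis by (simp add: nx c' True lc_less_def lc_word_def)
    next
      case False
      then have "n < n'" using assms(3) by (auto simp: c c' lc_less_def)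
      then show ?thesis by (auto simp: nx c' lc_less_def)
    qed
  qed
qed

lemma contour_valid: "lc_valid \<omega> (contour \<omega> t)"
  by (induction t) (auto simp: next_lc_valid, simp add: lc_valid_def)

lemma contour_less: "s < t \<Longrightarrow> lc_less (contour \<omega> s) (contour \<omega> t)"
proof (induction t)
  case (Suc t)
  have "lc_less (contour \<omega> t) (contour \<omega> (Suc t))"
    using lc_less_next[OF contour_valid] by simp
  then show ?case using Suc by (cases "s = t") (auto intro: lc_less_trans)
qed simp

lemma contour_less_iff: "lc_less (contour \<omega> s) (contour \<omega> t) \<longleftrightarrow> s < t"
  using contour_less[of s t \<omega>] contour_less[of t s \<omega>] lc_less_trans lc_less_irrefl
  by (metis linorder_neqE_nat)

lemma contour_inj: "contour \<omega> s = contour \<omega> t \<Longrightarrow> s = t"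
  using contour_less[of s t \<omega>] contour_less[of t s \<omega>] by (metis lc_less_irrefl linorder_neqE_nat)

text \<open>A corner that is never reached would stay ahead of the whole contour, confining an
  injective sequence to the finitely many corners of \<open>L_0, ..., L_n\<close> with
  \<open>n = fst c\<close>.\<close>

lemma contour_surj:
  assumes fin: "\<And>n. finite {u. in_tree \<omega> n True u}" and c: "lc_valid \<omega> c"
  shows "\<exists>t. contour \<omega> t = c"
proof (rule ccontr)
  assume neq: "\<not> (\<exists>t. contour \<omega> t = c)"
  have less: "lc_less (contour \<omega> t) c" for t
  proof (induction t)
    case 0
    have "\<not> lc_less c (0, [], 0)"
    proof -
      have "(x, [0]) \<in> lexord less_than \<longleftrightarrow> x = []" for x :: "nat list" by (cases x) auto
      then show ?thesis by (simp add: lc_less_def lc_word_def)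
    qed
    moreover have "c \<noteq> (0, [], 0)" using neq contour.simps(1) by metis
    ultimately show ?case using lc_less_linear[of c "contour \<omega> 0"] by auto
  next
    case (Suc t)
    then show ?case using neq next_lc_least[OF contour_valid c Suc] by (metis contour.simps(2))
  qed
  let ?S = "\<Union>n\<in>{..fst c}. \<Union>u\<in>{u. in_tree \<omega> n True u}. (\<lambda>j. (n, u, j)) ` {..kids \<omega> n True u}"
  have "contour \<omega> t \<in> ?S" for t
  proof -
    obtain n u j where t: "contour \<omega> t = (n, u, j)" by (cases "contour \<omega> t")
    have "n \<le> fst c" using less[of t] by (auto simp: t lc_less_def)
    then show ?thesis using contour_valid[of \<omega> t] by (auto simp: t lc_valid_def)
  qed
  then have "range (contour \<omega>) \<subseteq> ?S" by blast
  moreover have "finite ?S" using fin by auto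
  ultimately have "finite (range (contour \<omega>))" by (rule finite_subset)
  moreover have "inj (contour \<omega>)" by (auto intro: injI contour_inj)
  ultimately show False using finite_imageD[of "contour \<omega>" UNIV] by simp
qed

section \<open>The contour inside a subtree\<close>

lemma lexord_between:
  fixes w :: "nat list"
  assumes "(w, u @ [i]) \<notin> lexord less_than" "(u @ [k], w) \<notin> lexord less_than"
  shows "\<exists>h z. w = u @ h # z \<and> i \<le> h \<and> (h < k \<or> h = k \<and> z = [])"
  using assms
proof (induction u arbitrary: w)
  case Nil
  then obtain h z where w: "w = h # z" by (cases w) auto
  then show ?case using Nil by (cases z) (auto simp: not_less_iff_gr_or_eq)
next
  case (Cons a u)
  then obtain b w' where w: "w = b # w'" by (cases w) auto
  then have "b = a" using Cons.prems by (auto simp: not_less_iff_gr_or_eq)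
  then show ?case using Cons w by auto
qed

lemma lc_between:
  assumes "lc_valid \<omega> (n', u', j')" "\<not> lc_less (n', u', j') (n, u, i)"
    and "\<not> lc_less (n, u, kids \<omega> n True u) (n', u', j')"
  shows "n' = n \<and> (u' = u \<and> i \<le> j' \<or> (\<exists>h z. u' = u @ h # z \<and> i \<le> h \<and> h < kids \<omega> n True u))"
proof -
  have n: "n' = n" using assms(2,3) by (auto simp: lc_less_def)
  have "\<exists>h z. u' @ [j'] = u @ h # z \<and> i \<le> h \<and> (h < kids \<omega> n True u \<or> h = kids \<omega> n True u \<and> z = [])"
    by (rule lexord_between) (use assms(2,3) in \<open>auto simp: lc_less_def lc_word_def n\<close>)
  then obtain h z where hz: "u' @ [j'] = u @ h # z" "i \<le> h"
    "h < kids \<omega> n True u \<or> h = kids \<omega> n True u \<and> z = []" by blast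
  show ?thesis
  proof (cases z rule: rev_cases)
    case Nil
    then show ?thesis using hz n by auto
  next
    case (snoc y b)
    then have "u' @ [j'] = (u @ h # y) @ [b]" using hz by simp
    then show ?thesis using hz n snoc by auto
  qed
qed

lemma contour_between:
  assumes "contour \<omega> s = (n, u, i)" "contour \<omega> r = (n, u, kids \<omega> n True u)"
    and "s \<le> t" "t \<le> r" "contour \<omega> t = (n', u', j')"
  shows "n' = n \<and> (u' = u \<and> i \<le> j' \<or> (\<exists>h z. u' = u @ h # z \<and> i \<le> h \<and> h < kids \<omega> n True u))"
proof (rule lc_between)
  show "lc_valid \<omega> (n', u', j')" using contour_valid[of \<omega> t] assms by simp
  show "\<not> lc_less (n', u', j') (n, u, i)"
    using contour_less_iff[of \<omega> t s] assms by simp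
  show "\<not> lc_less (n, u, kids \<omega> n True u) (n', u', j')"
    using contour_less_iff[of \<omega> r t] assms by simp
qed

definition last_visit :: "(idx \<Rightarrow> int) \<Rightarrow> nat \<Rightarrow> nat \<Rightarrow> bool" where
  "last_visit \<omega> s r \<longleftrightarrow> (case contour \<omega> s of (n, u, j) \<Rightarrow> contour \<omega> r = (n, u, kids \<omega> n True u))"

lemma last_visit_unique: "last_visit \<omega> s r \<Longrightarrow> last_visit \<omega> s r' \<Longrightarrow> r = r'"
  by (auto simp: last_visit_def split: prod.splits intro: contour_inj[of \<omega>])

lemma last_visit_lab: "last_visit \<omega> s r \<Longrightarrow> lab \<omega> r = lab \<omega> s"
  by (auto simp: last_visit_def lab_def lc_vertex_def split: prod.splits)

lemma last_visit_ge:
  assumes "last_visit \<omega> s r"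
  shows "s \<le> r"
proof -
  obtain n u j where s: "contour \<omega> s = (n, u, j)" by (cases "contour \<omega> s")
  have r: "contour \<omega> r = (n, u, kids \<omega> n True u)" using assms s by (simp add: last_visit_def)
  have "j \<le> kids \<omega> n True u" using contour_valid[of \<omega> s] s by (simp add: lc_valid_def)
  then have "\<not> lc_less (contour \<omega> r) (contour \<omega> s)"
    by (simp add: s r lc_less_def lc_word_def lexord_same_pref_iff)
  then show ?thesis by (simp add: contour_less_iff)
qed

text \<open>Subtrees are nested: a vertex met between \<open>s\<close> and \<open>r\<close> is the
  visited vertex itself or a descendant of it, hence is left for the last time by
  \<open>r\<close>.\<close>

lemma last_visit_nested:
  assumes "last_visit \<omega> s r" "s \<le> t" "t \<le> r" "last_visit \<omega> t t'"
  shows "t' \<le> r"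
proof -
  obtain n u i where s: "contour \<omega> s = (n, u, i)" by (cases "contour \<omega> s")
  have r: "contour \<omega> r = (n, u, kids \<omega> n True u)" using assms s by (simp add: last_visit_def)
  obtain n' u' j' where t: "contour \<omega> t = (n', u', j')" by (cases "contour \<omega> t")
  have t': "contour \<omega> t' = (n', u', kids \<omega> n' True u')" using assms t by (simp add: last_visit_def)
  have "\<not> lc_less (contour \<omega> r) (contour \<omega> t')"
    using contour_between[OF s r assms(2,3) t]
    by (auto simp: r t' lc_less_def lc_word_def lexord_same_pref_iff)
  then show ?thesis by (simp add: contour_less_iff)
qed

text \<open>\<open>arrival \<omega> k\<close> is the time at which the rightmost left ray reaches level \<open>k\<close>: it always
  leaves a vertex from its last left corner.\<close>

primrec arrival :: "(idx \<Rightarrow> int) \<Rightarrow> nat \<Rightarrow> nat \<Rightarrow> bool" where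
  "arrival \<omega> 0 t \<longleftrightarrow> t = 0"
| "arrival \<omega> (Suc k) t \<longleftrightarrow> (\<exists>s r. arrival \<omega> k s \<and> last_visit \<omega> s r \<and> r < t \<and>
     lab \<omega> t = - int (Suc k) \<and> (\<forall>q. r < q \<and> q < t \<longrightarrow> lab \<omega> q \<noteq> - int (Suc k)))"

text \<open>This is \<open>y_k >= x\<close> in contour times. For \<open>x > 0\<close> the witness
  \<open>q\<close> lies in a child subtree, since the corners of the vertex itself have label
  \<open>- int k\<close>.\<close>

definition overshoot :: "(idx \<Rightarrow> int) \<Rightarrow> nat \<Rightarrow> int \<Rightarrow> bool" where
  "overshoot \<omega> k x \<longleftrightarrow> (\<exists>s r q. arrival \<omega> k s \<and> last_visit \<omega> s r \<and> s < q \<and> q \<le> r \<and> lab \<omega> q \<le> - int k - x)"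

text \<open>The offset 1 makes the forbidden label the same for all \<open>j\<close>:
  \<open>- j - (k - j + 1) = - (k + 1)\<close>.\<close>

definition merged :: "(idx \<Rightarrow> int) \<Rightarrow> nat \<Rightarrow> bool" where
  "merged \<omega> k \<longleftrightarrow> (\<forall>j\<le>k. \<not> overshoot \<omega> j (int (k - j) + 1))"

lemma lab_0 [simp]: "lab \<omega> 0 = 0"
  by (simp add: lab_def lc_vertex_def vert_def spine_label_def)

lemma arrival_lab: "arrival \<omega> k s \<Longrightarrow> lab \<omega> s = - int k"
  by (cases k) auto

lemma arrival_unique: "arrival \<omega> k s \<Longrightarrow> arrival \<omega> k s' \<Longrightarrow> s = s'"
proof (induction k arbitrary: s s')
  case (Suc k)
  then obtain a r a' r' where
    1: "arrival \<omega> k a" "last_visit \<omega> a r" "r < s" "lab \<omega> s = - int (Suc k)"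
      "\<forall>q. r < q \<and> q < s \<longrightarrow> lab \<omega> q \<noteq> - int (Suc k)" and
    2: "arrival \<omega> k a'" "last_visit \<omega> a' r'" "r' < s'" "lab \<omega> s' = - int (Suc k)"
      "\<forall>q. r' < q \<and> q < s' \<longrightarrow> lab \<omega> q \<noteq> - int (Suc k)"
    by auto
  have "a = a'" by (rule Suc.IH[OF 1(1) 2(1)])
  then have "r = r'" using last_visit_unique 1(2) 2(2) by blast
  then show ?case using 1 2 by (metis linorder_neqE_nat)
qed simp

definition unit_steps :: "(idx \<Rightarrow> int) \<Rightarrow> bool" where
  "unit_steps \<omega> \<longleftrightarrow> (\<forall>n. \<bar>\<omega> (Step n)\<bar> \<le> 1) \<and> (\<forall>n s u. \<bar>\<omega> (Incr n s u)\<bar> \<le> 1)"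

lemma lab_step:
  assumes "unit_steps \<omega>"
  shows "lab \<omega> (Suc t) \<ge> lab \<omega> t - 1"
proof -
  obtain n u j where t: "contour \<omega> t = (n, u, j)" by (cases "contour \<omega> t")
  have b: "\<bar>\<omega> (Step m)\<bar> \<le> 1" "\<bar>\<omega> (Incr m s v)\<bar> \<le> 1" for m s v
    using assms by (auto simp: unit_steps_def)
  show ?thesis
  proof (cases "j < kids \<omega> n True u")
    case True
    then show ?thesis using b(2)[of n True "u @ [j]"]
      by (simp add: lab_def t next_lc_def lc_vertex_def vlabel_snoc)
  next
    case False
    show ?thesis
    proof (cases u rule: rev_cases)
      case Nil
      then show ?thesis using False b(1)[of n]
        by (simp add: lab_def t next_lc_def lc_vertex_def vert_def spine_label_def)
    next
      case (snoc v i)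
      then show ?thesis using False b(2)[of n True "v @ [i]"]
        by (simp add: lab_def t next_lc_def lc_vertex_def vlabel_snoc)
    qed
  qed
qed

text \<open>Between the last visit at one level and the arrival at the next, labels cannot fall
  below the level being left, because the descent would meet the next level earlier. So a low label
  must occur in one of the stretches that the ray leaves behind.\<close>

lemma below_level_covered:
  assumes "unit_steps \<omega>"
  shows "arrival \<omega> k s \<Longrightarrow> last_visit \<omega> s r \<Longrightarrow> t \<le> r \<Longrightarrow> lab \<omega> t < - int k \<Longrightarrow>
    \<exists>j s' r'. j \<le> k \<and> arrival \<omega> j s' \<and> last_visit \<omega> s' r' \<and> s' < t \<and> t \<le> r' \<and> r' \<le> r"
proof (induction k arbitrary: s r)
  case 0
  then have "t \<noteq> 0" by (metis lab_0 of_nat_0 neg_0_equal_iff_equal less_irrefl)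
  then show ?case using 0 by (intro exI[of _ 0] exI[of _ s] exI[of _ r]) auto
next
  case (Suc k)
  then obtain s0 r0 where *: "arrival \<omega> k s0" "last_visit \<omega> s0 r0" "r0 < s"
      "lab \<omega> s = - int (Suc k)" "\<forall>q. r0 < q \<and> q < s \<longrightarrow> lab \<omega> q \<noteq> - int (Suc k)"
    by auto
  have sr: "s \<le> r" using last_visit_ge Suc.prems(2) by blast
  consider "t \<le> r0" | "r0 < t" "t \<le> s" | "s < t" by linarith
  then show ?case
  proof cases
    case 1
    obtain j s' r' where "j \<le> k" "arrival \<omega> j s'" "last_visit \<omega> s' r'" "s' < t" "t \<le> r'" "r' \<le> r0"
      using Suc.IH[OF *(1,2) 1] Suc.prems by auto
    then show ?thesis using sr * by (intro exI[of _ j] exI[of _ s'] exI[of _ r']) auto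
  next
    case 2
    have "lab \<omega> r0 = - int k" using last_visit_lab[OF *(2)] arrival_lab[OF *(1)] by simp
    then obtain q where q: "r0 \<le> q" "q \<le> t" "lab \<omega> q = - int (Suc k)"
      using int_ivt[of r0 t "lab \<omega>" "- int (Suc k)"] lab_step[OF assms] 2 Suc.prems by auto
    moreover have "q \<noteq> r0" "q \<noteq> t" using q \<open>lab \<omega> r0 = - int k\<close> Suc.prems(4) by auto
    ultimately show ?thesis using *(5) 2 by auto
  next
    case 3
    then show ?thesis using Suc.prems by (intro exI[of _ "Suc k"] exI[of _ s] exI[of _ r]) auto
  qed
qed

text \<open>Under \<open>merged\<close> no stretch left behind reaches below \<open>- int k\<close>;
  consequently the first left time at the next level comes after \<open>r\<close>.\<close>

lemma merged_lab_ge: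
  assumes "unit_steps \<omega>" "merged \<omega> k" "arrival \<omega> k s" "last_visit \<omega> s r" "t \<le> r"
  shows "lab \<omega> t \<ge> - int k"
proof (rule ccontr)
  assume *: "\<not> lab \<omega> t \<ge> - int k"
  then obtain j s' r' where "j \<le> k" "arrival \<omega> j s'" "last_visit \<omega> s' r'" "s' < t" "t \<le> r'"
    using below_level_covered[OF assms(1,3,4,5)] by auto
  moreover have "lab \<omega> t \<le> - int j - (int (k - j) + 1)" using * \<open>j \<le> k\<close> by auto
  ultimately have "overshoot \<omega> j (int (k - j) + 1)" unfolding overshoot_def by blast
  then show False using assms(2) \<open>j \<le> k\<close> by (auto simp: merged_def)
qed

lemma below_level_last_visit:
  assumes "unit_steps \<omega>" "arrival \<omega> k s" "last_visit \<omega> s r" "t \<le> r" "lab \<omega> t < - int k"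
    and "last_visit \<omega> t t'"
  shows "t' \<le> r"
  using below_level_covered[OF assms(1-5)] last_visit_nested assms(6)
  by (metis le_trans less_imp_le)

section \<open>Proper rays and cut points\<close>

text \<open>Labels unbounded below make every arrival exist. This property is later read off from
  the cut levels themselves instead of from recurrence of the spine walk.\<close>

definition good_forest :: "(idx \<Rightarrow> int) \<Rightarrow> bool" where
  "good_forest \<omega> \<longleftrightarrow> unit_steps \<omega> \<and> (\<forall>n. finite {u. in_tree \<omega> n True u}) \<and> (\<forall>x. \<exists>t. lab \<omega> t < x)"

lemma good_contour_surj: "good_forest \<omega> \<Longrightarrow> lc_valid \<omega> c \<Longrightarrow> \<exists>t. contour \<omega> t = c"
  by (rule contour_surj) (simp_all add: good_forest_def)

lemma last_visit_exists:
  assumes "good_forest \<omega>"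
  shows "\<exists>r. last_visit \<omega> s r"
proof -
  obtain n u j where s: "contour \<omega> s = (n, u, j)" by (cases "contour \<omega> s")
  have "lc_valid \<omega> (n, u, kids \<omega> n True u)"
    using contour_valid[of \<omega> s] s by (simp add: lc_valid_def)
  then show ?thesis using good_contour_surj[OF assms] s by (simp add: last_visit_def)
qed

lemma arrival_exists:
  assumes "good_forest \<omega>"
  shows "\<exists>s. arrival \<omega> k s"
proof (induction k)
  case (Suc k)
  have st: "lab \<omega> (Suc q) \<ge> lab \<omega> q - 1" for q
    using assms lab_step by (auto simp: good_forest_def)
  obtain s where s: "arrival \<omega> k s" using Suc by blast
  obtain r where r: "last_visit \<omega> s r" using last_visit_exists[OF assms] by blast
  have lr: "lab \<omega> r = - int k" using last_visit_lab[OF r] arrival_lab[OF s] by simp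
  have "\<exists>t>r. lab \<omega> t = - int (Suc k)"
  proof -
    \<comment> \<open>A label below the minimum up to \<open>r\<close> can only occur after
      \<open>r\<close>, which yields a later visit to the next level.\<close>
    define m where "m = Min (lab \<omega> ` {..r})"
    have m: "m \<le> lab \<omega> t" if "t \<le> r" for t unfolding m_def using that by (intro Min_le) auto
    have "\<forall>x. \<exists>t. lab \<omega> t < x" using assms by (simp add: good_forest_def)
    then obtain t where t: "lab \<omega> t < min m (- int (Suc k))" by blast
    then have "r < t" using m[of t] by (cases "t \<le> r") auto
    then obtain q where "r \<le> q" "q \<le> t" "lab \<omega> q = - int (Suc k)"
      using int_ivt[of r t "lab \<omega>" "- int (Suc k)"] st t lr by auto
    then show ?thesis using lr by (intro exI[of _ q]) (auto simp: le_less)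
  qed
  then have ex: "\<exists>t. r < t \<and> lab \<omega> t = - int (Suc k)" by blast
  define t where "t = (LEAST t. r < t \<and> lab \<omega> t = - int (Suc k))"
  have "r < t \<and> lab \<omega> t = - int (Suc k)" unfolding t_def by (rule LeastI_ex[OF ex])
  moreover have "\<forall>q. r < q \<and> q < t \<longrightarrow> lab \<omega> q \<noteq> - int (Suc k)"
    unfolding t_def using not_less_Least by blast
  ultimately have "arrival \<omega> (Suc k) t" using s r by auto
  then show ?case by blast
qed simp

section \<open>Successor arcs in contour time\<close>

lemma lc_cornerE:
  assumes "good_forest \<omega>" "valid_corner \<omega> (Corner True n u j)"
  obtains t where "contour \<omega> t = (n, u, j)"
proof -
  have "lc_valid \<omega> (n, u, j)" using assms(2) by (simp add: lc_valid_def)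
  then show ?thesis using good_contour_surj[OF assms(1)] that by blast
qed

lemma corner_label_contour:
  "contour \<omega> t = (n, u, j) \<Longrightarrow> corner_label \<omega> (Corner True n u j) = lab \<omega> t"
  by (simp add: corner_label_def lab_def lc_vertex_def)

lemma contour_corner_valid:
  "contour \<omega> t = (n, u, j) \<Longrightarrow> valid_corner \<omega> (Corner True n u j)"
  using contour_valid[of \<omega> t] by (simp add: lc_valid_def)

lemma contour_corner_less:
  "contour \<omega> s = (n, u, j) \<Longrightarrow> contour \<omega> t = (n', u', j') \<Longrightarrow>
    corner_less (Corner True n u j) (Corner True n' u' j') \<longleftrightarrow> s < t"
  using contour_less_iff[of \<omega> s t] by (simp add: lc_less_def lc_word_def)

lemma successor_contour_left:
  assumes "is_successor \<omega> (Corner True m v i) (Corner True n u j)"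
    and "contour \<omega> s = (m, v, i)" "contour \<omega> t = (n, u, j)"
  shows "s < t" "lab \<omega> t = lab \<omega> s - 1" "\<And>q. s < q \<Longrightarrow> q < t \<Longrightarrow> lab \<omega> q \<noteq> lab \<omega> s - 1"
proof -
  show "s < t" using assms contour_corner_less[OF assms(2,3)] by (simp only: is_successor_def)
  show "lab \<omega> t = lab \<omega> s - 1"
    using assms corner_label_contour[OF assms(2)] corner_label_contour[OF assms(3)]
    by (simp only: is_successor_def)
  fix q assume q: "s < q" "q < t"
  obtain n' u' j' where c: "contour \<omega> q = (n', u', j')" by (cases "contour \<omega> q")
  have "corner_label \<omega> (Corner True n' u' j') \<noteq> corner_label \<omega> (Corner True m v i) - 1"
    using assms(1) contour_corner_valid[OF c] contour_corner_less[OF assms(2) c]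
      contour_corner_less[OF c assms(3)] q unfolding is_successor_def by blast
  then show "lab \<omega> q \<noteq> lab \<omega> s - 1"
    using corner_label_contour[OF assms(2)] corner_label_contour[OF c] by simp
qed

text \<open>All left corners come after all right corners, so an arc from right to left ends at the
  first of all left times with its label.\<close>

lemma successor_contour_right:
  assumes "is_successor \<omega> (Corner False m v i) (Corner True n u j)" "contour \<omega> t = (n, u, j)"
  shows "lab \<omega> t = corner_label \<omega> (Corner False m v i) - 1"
    "\<And>q. q < t \<Longrightarrow> lab \<omega> q \<noteq> corner_label \<omega> (Corner False m v i) - 1"
proof -
  show "lab \<omega> t = corner_label \<omega> (Corner False m v i) - 1"
    using assms corner_label_contour[OF assms(2)] by (simp only: is_successor_def)
  fix q assume q: "q < t"
  obtain n' u' j' where c: "contour \<omega> q = (n', u', j')" by (cases "contour \<omega> q")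
  have "corner_less (Corner False m v i) (Corner True n' u' j')" by simp
  then have "corner_label \<omega> (Corner True n' u' j') \<noteq> corner_label \<omega> (Corner False m v i) - 1"
    using assms(1) contour_corner_valid[OF c] contour_corner_less[OF c assms(2)] q
    unfolding is_successor_def by blast
  then show "lab \<omega> q \<noteq> corner_label \<omega> (Corner False m v i) - 1"
    using corner_label_contour[OF c] by simp
qed

text \<open>Labels decrease along a proper ray, which forces every edge to be traversed from a
  corner to its successor.\<close>

lemma proper_ray_corners:
  assumes "proper_geodesic_ray \<omega> p"
  obtains e f where "\<And>i. is_successor \<omega> (e i) (f i)" "\<And>i. corner_vertex (e i) = p i"
    "\<And>i. corner_vertex (f i) = p (Suc i)"
proof -
  have "\<exists>c c'. is_successor \<omega> c c' \<and> corner_vertex c = p i \<and> corner_vertex c' = p (Suc i)" for i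
  proof -
    have "Q_adj \<omega> (p i) (p (Suc i))" using assms by (simp add: proper_geodesic_ray_def)
    then obtain c c' where c: "is_successor \<omega> c c'" "{corner_vertex c, corner_vertex c'} = {p i, p (Suc i)}"
      unfolding Q_adj_def by blast
    have "vlabel \<omega> (corner_vertex c') = vlabel \<omega> (corner_vertex c) - 1"
      using c(1) by (simp add: is_successor_def corner_label_def)
    moreover have "vlabel \<omega> (p (Suc i)) = vlabel \<omega> (p i) - 1"
      using assms by (simp add: proper_geodesic_ray_def)
    ultimately show ?thesis using c by (auto simp: doubleton_eq_iff)
  qed
  then show ?thesis using that by metis
qed

text \<open>The vertex of the left forest below which a vertex is located: a vertex of the tree \<open>R_n\<close>
  is located below the spine vertex \<open>S(n)\<close>.\<close>

fun anchor :: "vtx \<Rightarrow> nat \<times> nat list" where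
  "anchor (Spine n) = (n, [])"
| "anchor (Node n True u) = (n, u)"
| "anchor (Node n False u) = (n, [])"

lemma anchor_vert: "anchor (vert n s u) = (n, if s then u else [])"
  by (cases s) (auto simp: vert_def)

definition anchor_end :: "(idx \<Rightarrow> int) \<Rightarrow> vtx \<Rightarrow> nat \<Rightarrow> bool" where
  "anchor_end \<omega> v t \<longleftrightarrow> contour \<omega> t = (fst (anchor v), snd (anchor v), kids \<omega> (fst (anchor v)) True (snd (anchor v)))"

lemma anchor_end_contour:
  "contour \<omega> s = (n, u, j) \<Longrightarrow> anchor_end \<omega> (vert n True u) t \<longleftrightarrow> last_visit \<omega> s t"
  by (simp add: anchor_end_def anchor_vert last_visit_def)

lemma anchor_end_spine_mono:
  assumes "contour \<omega> t = (m, [], kids \<omega> m True [])" "contour \<omega> t' = (m', [], kids \<omega> m' True [])" "m' \<le> m"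
  shows "t' \<le> t"
  using contour_less_iff[of \<omega> t t'] assms by (auto simp: lc_less_def lc_word_def)

text \<open>A proper ray that enters the right-hand side returns below the spine vertex it came from,
  so it never overtakes the ray which always leaves from the last left corner.\<close>

lemma ray_bound:
  assumes "good_forest \<omega>" "proper_geodesic_ray \<omega> p"
  shows "arrival \<omega> i s \<Longrightarrow> last_visit \<omega> s r \<Longrightarrow> anchor_end \<omega> (p i) t \<Longrightarrow> t \<le> r"
proof (induction i arbitrary: s r t)
  case 0
  have "p 0 = Spine 0" using assms(2) by (simp add: proper_geodesic_ray_def)
  then have "contour \<omega> t = contour \<omega> r" using 0 by (simp add: anchor_end_def last_visit_def)
  then show ?case using contour_inj[of \<omega> t r] by simp
next
  case (Suc i)
  have us: "unit_steps \<omega>" using assms(1) by (simp add: good_forest_def)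
  obtain e f where ef: "\<And>i. is_successor \<omega> (e i) (f i)" "\<And>i. corner_vertex (e i) = p i"
    "\<And>i. corner_vertex (f i) = p (Suc i)" using proper_ray_corners[OF assms(2)] by blast
  have plab: "corner_label \<omega> (e i) = - int i"
    using assms(2) ef(2)[of i] by (simp add: corner_label_def proper_geodesic_ray_def)
  obtain s0 r0 where *: "arrival \<omega> i s0" "last_visit \<omega> s0 r0" "r0 < s"
      "lab \<omega> s = - int (Suc i)" "\<forall>q. r0 < q \<and> q < s \<longrightarrow> lab \<omega> q \<noteq> - int (Suc i)"
    using Suc.prems(1) by auto
  have sr: "s \<le> r" by (rule last_visit_ge[OF Suc.prems(2)])
  have IH: "t0 \<le> r0" if "anchor_end \<omega> (p i) t0" for t0 using Suc.IH[OF *(1,2) that] .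
  \<comment> \<open>A landing at a left time \<open>tf <= s\<close> suffices: either
    \<open>tf = s\<close>, or \<open>tf <= r0\<close> because \<open>s\<close> is the first hit of
    its level after \<open>r0\<close>; in the latter case the label lies below level
    \<open>i\<close>, so the last visit to that vertex is also at most \<open>r0\<close>.\<close>
  have concl: "t \<le> r" if tf: "contour \<omega> tf = (n, u, j)" "p (Suc i) = vert n True u" "lab \<omega> tf = - int (Suc i)" "tf \<le> s"
    for tf n u j
  proof -
    have lv: "last_visit \<omega> tf t" using Suc.prems(3) anchor_end_contour[OF tf(1)] tf(2) by simp
    show ?thesis
    proof (cases "tf = s")
      case True
      then show ?thesis using lv Suc.prems(2) last_visit_unique by auto
    next
      case False
      then have "tf \<le> r0" using *(5) tf(3,4) by (metis le_neq_implies_less not_le_imp_less)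
      then have "t \<le> r0" using below_level_last_visit[OF us *(1,2)] tf(3) lv by simp
      then show ?thesis using *(3) sr by simp
    qed
  qed
  obtain sd m v i' where e: "e i = Corner sd m v i'" by (cases "e i")
  obtain sd' n u j where f: "f i = Corner sd' n u j" by (cases "f i")
  have sc: "is_successor \<omega> (Corner sd m v i') (Corner sd' n u j)" using ef(1)[of i] e f by simp
  have pv: "p i = vert m sd v" "p (Suc i) = vert n sd' u" using ef(2,3)[of i] e f by simp_all
  have vf: "valid_corner \<omega> (Corner sd' n u j)" "valid_corner \<omega> (Corner sd m v i')"
    using sc by (simp_all add: is_successor_def)
  obtain te where te: "anchor_end \<omega> (p i) te"
  proof -
    have "lc_valid \<omega> (m, if sd then v else [], kids \<omega> m True (if sd then v else []))"
      using vf(2) by (auto simp: lc_valid_def)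
    then obtain te where "contour \<omega> te = (m, if sd then v else [], kids \<omega> m True (if sd then v else []))"
      using good_contour_surj[OF assms(1)] by blast
    then show ?thesis using that by (auto simp: anchor_end_def pv anchor_vert)
  qed
  have ter: "te \<le> r0" by (rule IH[OF te])
  show ?case
  proof (cases sd')
    case True
    obtain tf where tf: "contour \<omega> tf = (n, u, j)"
      using lc_cornerE[OF assms(1)] vf(1) True by metis
    have "lab \<omega> tf = - int (Suc i) \<and> tf \<le> s"
    proof (cases sd)
      case True
      obtain t0 where t0: "contour \<omega> t0 = (m, v, i')" using lc_cornerE[OF assms(1)] vf(2) True by metis
      have "last_visit \<omega> t0 te" using te anchor_end_contour[OF t0] pv True by simp
      then have t0r: "t0 \<le> r0" using last_visit_ge ter by (meson le_trans)
      have l0: "lab \<omega> t0 = - int i" using corner_label_contour[OF t0] plab e True by simp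
      have "is_successor \<omega> (Corner True m v i') (Corner True n u j)" using sc True \<open>sd'\<close> by simp
      note suc = successor_contour_left[OF this t0 tf]
      \<comment> \<open>\<open>s\<close> comes after \<open>t0\<close> and carries the target label,
        so the successor cannot lie beyond it.\<close>
      have "\<not> s < tf" using suc(3)[of s] l0 *(3,4) t0r by auto
      then show ?thesis using suc(2) l0 by simp
    next
      case False
      have "is_successor \<omega> (Corner False m v i') (Corner True n u j)" using sc False \<open>sd'\<close> by simp
      note suc = successor_contour_right[OF this tf]
      have "\<not> s < tf" using suc(2)[of s] plab e False *(4) by auto
      then show ?thesis using suc(1) plab e False by simp
    qed
    then show ?thesis using concl[OF tf] pv True by simp
  next
    case False
    \<comment> \<open>On the right-hand side the corner order runs towards the root: an arc between
      right corners never raises the spine index, so the anchor does not move forward.\<close>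
    have ndl: "\<not> sd" "n \<le> m" using sc False by (auto simp: is_successor_def)
    have "contour \<omega> te = (m, [], kids \<omega> m True [])" using te ndl pv by (simp add: anchor_end_def anchor_vert)
    moreover have "contour \<omega> t = (n, [], kids \<omega> n True [])"
      using Suc.prems(3) False pv by (simp add: anchor_end_def anchor_vert)
    ultimately have "t \<le> te" using anchor_end_spine_mono ndl by blast
    then show ?thesis using ter *(3) sr by simp
  qed
qed

text \<open>\<open>merged\<close> puts \<open>r\<close> before \<open>T\<close>, and
  \<open>ray_bound\<close> keeps every proper ray at level \<open>k\<close> before it. An arc that
  ends on the left can then end only at \<open>T\<close>, the first time at its level; an arc that
  ends on the right would end in some \<open>R_m\<close> with \<open>m < n\<close>, root
  \<open>S(m)\<close> included, where that label does not occur.\<close>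

lemma ray_through_cut:
  assumes "good_forest \<omega>" "proper_geodesic_ray \<omega> p" "merged \<omega> k"
    and T: "contour \<omega> T = (n, u, j)" "lab \<omega> T = - int (Suc k)" "\<And>t. t < T \<Longrightarrow> lab \<omega> t \<noteq> - int (Suc k)"
    and right: "\<And>m v. m < n \<Longrightarrow> in_tree \<omega> m False v \<Longrightarrow> vlabel \<omega> (vert m False v) \<noteq> - int (Suc k)"
  shows "p (Suc k) = vert n True u"
proof -
  have us: "unit_steps \<omega>" using assms(1) by (simp add: good_forest_def)
  obtain e f where ef: "\<And>i. is_successor \<omega> (e i) (f i)" "\<And>i. corner_vertex (e i) = p i"
    "\<And>i. corner_vertex (f i) = p (Suc i)" using proper_ray_corners[OF assms(2)] by blast
  have plab: "corner_label \<omega> (e k) = - int k"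
    using assms(2) ef(2)[of k] by (simp add: corner_label_def proper_geodesic_ray_def)
  have flab: "vlabel \<omega> (p (Suc k)) = - int (Suc k)" using assms(2) by (simp only: proper_geodesic_ray_def)
  obtain s r where sr: "arrival \<omega> k s" "last_visit \<omega> s r"
    using arrival_exists[OF assms(1)] last_visit_exists[OF assms(1)] by blast
  have rT: "r < T"
    using merged_lab_ge[OF us assms(3) sr, of T] T(2) by (cases "T \<le> r") auto
  obtain sd m v i' where e: "e k = Corner sd m v i'" by (cases "e k")
  obtain sd' n' u' j' where f: "f k = Corner sd' n' u' j'" by (cases "f k")
  have sc: "is_successor \<omega> (Corner sd m v i') (Corner sd' n' u' j')" using ef(1)[of k] e f by simp
  have pv: "p k = vert m sd v" "p (Suc k) = vert n' sd' u'" using ef(2,3)[of k] e f by simp_all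
  have vf: "valid_corner \<omega> (Corner sd' n' u' j')" "valid_corner \<omega> (Corner sd m v i')"
    using sc by (simp_all add: is_successor_def)
  show ?thesis
  proof (cases sd)
    case True
    have "sd'" using sc True by (simp add: is_successor_def)
    obtain t0 where t0: "contour \<omega> t0 = (m, v, i')" using lc_cornerE[OF assms(1)] vf(2) True by metis
    obtain tf where tf: "contour \<omega> tf = (n', u', j')" using lc_cornerE[OF assms(1)] vf(1) \<open>sd'\<close> by metis
    obtain te where te: "last_visit \<omega> t0 te" using last_visit_exists[OF assms(1)] by blast
    then have "anchor_end \<omega> (p k) te" using anchor_end_contour[OF t0] pv True by simp
    then have "te \<le> r" by (rule ray_bound[OF assms(1,2) sr])
    then have t0T: "t0 < T" using last_visit_ge[OF te] rT by simp
    have l0: "lab \<omega> t0 = - int k" using corner_label_contour[OF t0] plab e True by simp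
    have "is_successor \<omega> (Corner True m v i') (Corner True n' u' j')" using sc True \<open>sd'\<close> by simp
    note suc = successor_contour_left[OF this t0 tf]
    have "tf = T" using suc(2) suc(3)[of T] T(2) T(3)[of tf] t0T l0 by (cases tf T rule: linorder_cases) auto
    then show ?thesis using tf T(1) pv \<open>sd'\<close> by simp
  next
    case False
    obtain te where te: "contour \<omega> te = (m, [], kids \<omega> m True [])"
      using lc_cornerE[OF assms(1), of m "[]" "kids \<omega> m True []"] by auto
    then have "anchor_end \<omega> (p k) te" using pv False by (simp add: anchor_end_def anchor_vert)
    then have "te \<le> r" by (rule ray_bound[OF assms(1,2) sr])
    then have "te < T" using rT by simp
    \<comment> \<open>The last left corner of \<open>S(m)\<close> precedes \<open>T\<close>, which
      lies in \<open>L_n\<close>; hence \<open>m < n\<close>.\<close>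
    then have "lc_less (m, [], kids \<omega> m True []) (n, u, j)" using contour_less_iff[of \<omega> te T] te T(1) by simp
    moreover have "\<not> lc_less (n, [], kids \<omega> n True []) (n, u, j)"
    proof -
      have val: "in_tree \<omega> n True u" "j \<le> kids \<omega> n True u"
        using contour_valid[of \<omega> T] T(1) by (auto simp: lc_valid_def)
      show ?thesis
      proof (cases u)
        case Nil
        then show ?thesis using val by (simp add: lc_less_def lc_word_def)
      next
        case (Cons h w)
        then have "h < kids \<omega> n True []" using in_tree_child[of \<omega> n True "[]" h w] val by simp
        then show ?thesis by (simp add: Cons lc_less_def lc_word_def)
      qed
    qed
    ultimately have mn: "m < n" by (auto simp: lc_less_def)
    show ?thesis
    proof (cases sd')
      case True
      obtain tf where tf: "contour \<omega> tf = (n', u', j')" using lc_cornerE[OF assms(1)] vf(1) True by metis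
      have "is_successor \<omega> (Corner False m v i') (Corner True n' u' j')" using sc True \<open>\<not> sd\<close> by simp
      note suc = successor_contour_right[OF this tf]
      have "tf = T" using suc(1) suc(2)[of T] T(2) T(3)[of tf] plab e False
        by (cases tf T rule: linorder_cases) auto
      then show ?thesis using tf T(1) pv True by simp
    next
      case False
      have "n' \<le> m" using sc False \<open>\<not> sd\<close> by (auto simp: is_successor_def)
      then have "vlabel \<omega> (vert n' False u') \<noteq> - int (Suc k)"
        using right[of n' u'] mn vf(1) False by auto
      then show ?thesis using flab pv False by simp
    qed
  qed
qed

definition cut_level :: "(idx \<Rightarrow> int) \<Rightarrow> nat \<Rightarrow> bool" where
  "cut_level \<omega> k \<longleftrightarrow> merged \<omega> k \<and> (\<exists>T n u j. contour \<omega> T = (n, u, j) \<and> lab \<omega> T = - int (Suc k) \<and>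
     (\<forall>t<T. lab \<omega> t \<noteq> - int (Suc k)) \<and>
     (\<forall>m<n. \<forall>v. in_tree \<omega> m False v \<longrightarrow> vlabel \<omega> (vert m False v) \<noteq> - int (Suc k)))"

lemma cut_levels_suffice:
  assumes us: "unit_steps \<omega>" and fin: "\<And>n. finite {u. in_tree \<omega> n True u}"
    and inf: "infinite {k. cut_level \<omega> k}"
  shows "\<exists>q :: nat \<Rightarrow> vtx. inj q \<and> (\<forall>i. q i \<in> vertices \<omega>) \<and>
    (\<forall>p. proper_geodesic_ray \<omega> p \<longrightarrow> (\<forall>i. q i \<in> range p))"
proof -
  have good: "good_forest \<omega>"
    unfolding good_forest_def
  proof (intro conjI allI us fin)
    fix x :: int
    obtain k where "k > nat (- x)" "cut_level \<omega> k" using inf by (auto simp: infinite_nat_iff_unbounded)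
    then obtain T where "lab \<omega> T = - int (Suc k)" by (auto simp: cut_level_def)
    then show "\<exists>t. lab \<omega> t < x" using \<open>k > nat (- x)\<close> by (intro exI[of _ T]) auto
  qed
  have "\<exists>w. vlabel \<omega> w = - int (Suc k) \<and> w \<in> vertices \<omega> \<and>
      (\<forall>p. proper_geodesic_ray \<omega> p \<longrightarrow> p (Suc k) = w)" if k: "cut_level \<omega> k" for k
  proof -
    from k obtain T n u j where T: "merged \<omega> k" "contour \<omega> T = (n, u, j)" "lab \<omega> T = - int (Suc k)"
      "\<forall>t<T. lab \<omega> t \<noteq> - int (Suc k)"
      "\<forall>m<n. \<forall>v. in_tree \<omega> m False v \<longrightarrow> vlabel \<omega> (vert m False v) \<noteq> - int (Suc k)"
      unfolding cut_level_def by blast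
    have "vlabel \<omega> (vert n True u) = - int (Suc k)" using T by (simp add: lab_def lc_vertex_def)
    moreover have "vert n True u \<in> vertices \<omega>"
      using contour_valid[of \<omega> T] T(2) by (auto simp: vertices_def lc_valid_def)
    moreover have "\<forall>p. proper_geodesic_ray \<omega> p \<longrightarrow> p (Suc k) = vert n True u"
      using ray_through_cut[OF good _ T(1,2,3)] T(4,5) by blast
    ultimately show ?thesis by blast
  qed
  then obtain w where w: "\<And>k. cut_level \<omega> k \<Longrightarrow> vlabel \<omega> (w k) = - int (Suc k) \<and> w k \<in> vertices \<omega> \<and>
      (\<forall>p. proper_geodesic_ray \<omega> p \<longrightarrow> p (Suc k) = w k)" by metis
  define en where "en = enumerate {k. cut_level \<omega> k}"
  have en: "cut_level \<omega> (en i)" for i using enumerate_in_set[OF inf, of i] by (simp add: en_def)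
  have "inj (\<lambda>i. w (en i))"
  proof (rule injI)
    fix i i' assume eq: "w (en i) = w (en i')"
    have "vlabel \<omega> (w (en i)) = - int (Suc (en i))" "vlabel \<omega> (w (en i')) = - int (Suc (en i'))"
      by (rule w[OF en, THEN conjunct1])+
    then have "en i = en i'" unfolding eq by linarith
    then show "i = i'" unfolding en_def by (rule strict_mono_eq[OF strict_mono_enumerate[OF inf], THEN iffD1])
  qed
  moreover have "w (en i) \<in> range p" if "proper_geodesic_ray \<omega> p" for i p
    using w[OF en[of i], THEN conjunct2, THEN conjunct2, rule_format, OF that] by (metis rangeI)
  moreover have "w (en i) \<in> vertices \<omega>" for i by (rule w[OF en, THEN conjunct2, THEN conjunct1])
  ultimately show ?thesis by (intro exI[of _ "\<lambda>i. w (en i)"]) blast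
qed

section \<open>The past of an arrival\<close>

lemma input_space_prodM: "input_space = prodM input_pmf"
  by (simp add: input_space_def)

text \<open>The subtree above \<open>u\<close> as a tree of its own: an injective reindexing of the
  input, hence with the law of a fresh tree (\<open>prob_tree_at\<close>).\<close>

definition tree_at :: "nat \<Rightarrow> bool \<Rightarrow> nat list \<Rightarrow> (idx \<Rightarrow> int) \<Rightarrow> tree_data" where
  "tree_at n s u \<omega> = (\<lambda>i. \<omega> (case i of (v, b) \<Rightarrow> if b then Kids n s (u @ v) else Incr n s (u @ v)))"

lemma tree_at_measurable [measurable]: "tree_at n s u \<in> measurable (prodM input_pmf) TM"
  unfolding tree_at_def
  by (rule reindex_measurable) (auto simp: tree_pmf_def input_pmf_def split: prod.split)

lemma prob_tree_at:
  assumes "Measurable.pred TM E"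
  shows "measure (prodM input_pmf) {\<omega>. E (tree_at n s u \<omega>)} = measure TM {g. E g}"
  unfolding tree_at_def
proof (rule prodM_prob_reindex)
  show "inj (\<lambda>i. case i of (v, b) \<Rightarrow> if b then Kids n s (u @ v) else Incr n s (u @ v))"
    by (auto simp: inj_def split: if_splits)
  show "tree_pmf i = input_pmf (case i of (v, b) \<Rightarrow> if b then Kids n s (u @ v) else Incr n s (u @ v))" for i
    by (auto simp: tree_pmf_def input_pmf_def split: prod.split)
qed (rule assms)

lemma subtree_tree_at: "subtree (tree_at n s u \<omega>) h = tree_at n s (u @ [h]) \<omega>"
  by (auto simp: subtree_def tree_at_def fun_eq_iff)

lemma root_kids_tree_at: "root_kids (tree_at n s u \<omega>) = kids \<omega> n s u"
  by (simp add: root_kids_def tree_at_def kids_def)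

lemma in_tree_node: "in_tree \<omega> n s (u @ v) \<Longrightarrow> node (tree_at n s u \<omega>) v"
proof (induction v arbitrary: u)
  case (Cons h v)
  then show ?case
    using in_tree_child[of \<omega> n s u h v] Cons.IH[of "u @ [h]"]
    by (simp add: node_Cons subtree_tree_at root_kids_tree_at)
qed simp

lemma node_in_tree: "node (tree_at n s [] \<omega>) v \<longleftrightarrow> in_tree \<omega> n s v"
  by (simp add: node_def in_tree_def tree_at_def kids_def)

lemma vlabel_append: "vlabel \<omega> (vert n s (u @ v)) = vlabel \<omega> (vert n s u) + rel_label (tree_at n s u \<omega>) v"
proof (induction v arbitrary: u)
  case (Cons h v)
  have "vlabel \<omega> (vert n s (u @ h # v)) = vlabel \<omega> (vert n s (u @ [h])) + rel_label (tree_at n s (u @ [h]) \<omega>) v"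
    using Cons[of "u @ [h]"] by simp
  moreover have "tree_at n s u \<omega> ([h], False) = \<omega> (Incr n s (u @ [h]))" by (simp add: tree_at_def)
  ultimately show ?case by (simp add: rel_label_Cons subtree_tree_at vlabel_snoc)
qed simp

section \<open>Measurability of contour and ray events\<close>

lemma idx_coord_measurable [measurable]: "(\<lambda>\<omega>. \<omega> i) \<in> measurable (prodM input_pmf) (count_space UNIV)"
  by (rule coord_measurable)

lemma vlabel_measurable [measurable]: "(\<lambda>\<omega>. vlabel \<omega> v) \<in> measurable (prodM input_pmf) (count_space UNIV)"
  by (cases v) (simp_all add: spine_label_def)

lemma kids_pred [measurable]: "Measurable.pred (prodM input_pmf) (\<lambda>\<omega>. j < kids \<omega> n s u)"
  unfolding kids_def by (rule pred_count_space[OF idx_coord_measurable])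

lemma kids_measurable [measurable]: "(\<lambda>\<omega>. kids \<omega> n s u) \<in> measurable (prodM input_pmf) (count_space UNIV)"
  unfolding kids_def by (rule measurable_compose[OF idx_coord_measurable]) simp

lemma contour_measurable [measurable]: "(\<lambda>\<omega>. contour \<omega> t) \<in> measurable (prodM input_pmf) (count_space UNIV)"
proof (induction t)
  case (Suc t)
  have "(\<lambda>\<omega>. next_lc \<omega> c) \<in> measurable (prodM input_pmf) (count_space UNIV)" for c
    by (cases c) (simp add: next_lc_def)
  then have "(\<lambda>\<omega>. next_lc \<omega> (contour \<omega> t)) \<in> measurable (prodM input_pmf) (count_space UNIV)"
    by (rule measurable_compose_countable[OF _ Suc])
  then show ?case by simp
qed simp

lemma lab_measurable [measurable]: "(\<lambda>\<omega>. lab \<omega> t) \<in> measurable (prodM input_pmf) (count_space UNIV)"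
  unfolding lab_def
  by (rule measurable_compose_countable[where g="\<lambda>\<omega>. contour \<omega> t"]) measurable

lemma contour_eq_pred [measurable]: "Measurable.pred (prodM input_pmf) (\<lambda>\<omega>. contour \<omega> t = c)"
  by (rule pred_count_space[OF contour_measurable])

lemma lab_pred [measurable]:
  "Measurable.pred (prodM input_pmf) (\<lambda>\<omega>. lab \<omega> t = x)"
  "Measurable.pred (prodM input_pmf) (\<lambda>\<omega>. lab \<omega> t \<noteq> x)"
  "Measurable.pred (prodM input_pmf) (\<lambda>\<omega>. lab \<omega> t \<le> x)"
  by (rule pred_count_space[OF lab_measurable])+

lemma last_visit_pred [measurable]: "Measurable.pred (prodM input_pmf) (\<lambda>\<omega>. last_visit \<omega> s r)"
proof -
  have "Measurable.pred (prodM input_pmf) (\<lambda>\<omega>. case c of (n, u, j) \<Rightarrow> contour \<omega> r = (n, u, kids \<omega> n True u))" for c :: lcorner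
  proof (cases c)
    case (fields n u j)
    have "Measurable.pred (prodM input_pmf) (\<lambda>\<omega>. contour \<omega> r = (n, u, kids \<omega> n True u))"
      by (rule measurable_compose_countable[where g="\<lambda>\<omega>. kids \<omega> n True u"]) measurable
    then show ?thesis by (simp add: fields)
  qed
  then show ?thesis unfolding last_visit_def
    by (rule measurable_compose_countable[OF _ contour_measurable])
qed

lemma arrival_pred [measurable]: "Measurable.pred (prodM input_pmf) (\<lambda>\<omega>. arrival \<omega> k t)"
proof (induction k arbitrary: t)
  case (Suc k)
  note [measurable] = Suc
  show ?case by simp
qed simp

lemma overshoot_pred [measurable]: "Measurable.pred (prodM input_pmf) (\<lambda>\<omega>. overshoot \<omega> k x)"
  unfolding overshoot_def by measurable

lemma merged_pred [measurable]: "Measurable.pred (prodM input_pmf) (\<lambda>\<omega>. merged \<omega> k)"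
  unfolding merged_def by measurable

text \<open>The coordinates describing what remains of the subtree of \<open>u\<close> in \<open>L_n\<close>
  after the corner \<open>(n, u, j)\<close>.\<close>

definition remaining :: "nat \<Rightarrow> nat list \<Rightarrow> nat \<Rightarrow> idx set" where
  "remaining n u j = {Kids n True u} \<union> {Kids n True (u @ h # z) | h z. j \<le> h} \<union> {Incr n True (u @ h # z) | h z. j \<le> h}"

text \<open>Of the coordinate \<open>Kids n True u\<close>, the history at time \<open>t\<close>
  reveals only that it is at least \<open>j\<close>; asking no more of \<open>\<omega>'\<close> is
  what lets memorylessness act.\<close>

definition same_past :: "(idx \<Rightarrow> int) \<Rightarrow> (idx \<Rightarrow> int) \<Rightarrow> nat \<Rightarrow> nat \<Rightarrow> nat list \<Rightarrow> nat \<Rightarrow> bool" where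
  "same_past \<omega> \<omega>' t n u j \<longleftrightarrow> contour \<omega> t = (n, u, j) \<and> j \<le> kids \<omega>' n True u \<and>
     (\<forall>i. i \<notin> remaining n u j \<longrightarrow> \<omega> i = \<omega>' i)"

lemma lc_less_not_remaining:
  assumes "lc_less (n', u', j') (n, u, j)" "(n', u') \<noteq> (n, u)"
  shows "Kids n' True u' \<notin> remaining n u j"
proof
  assume "Kids n' True u' \<in> remaining n u j"
  then obtain h z where "n' = n" "u' = u @ h # z" "j \<le> h" using assms(2) by (auto simp: remaining_def)
  then show False using assms(1) by (cases z) (auto simp: lc_less_def lc_word_def lexord_same_pref_iff)
qed

text \<open>The contour consults only child counts. Those of other vertices met before
  \<open>t\<close> agree, and at \<open>u\<close> itself only tests with \<open>j' < j\<close>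
  occur, which both inputs pass.\<close>

lemma same_past_contour:
  assumes "same_past \<omega> \<omega>' t n u j"
  shows "s \<le> t \<Longrightarrow> contour \<omega>' s = contour \<omega> s"
proof (induction s)
  case (Suc s)
  obtain n' u' j' where c: "contour \<omega> s = (n', u', j')" by (cases "contour \<omega> s")
  have t: "contour \<omega> t = (n, u, j)" using assms by (simp add: same_past_def)
  have less: "lc_less (n', u', j') (n, u, j)" using contour_less[of s t \<omega>] Suc.prems c t by simp
  have jk: "j \<le> kids \<omega> n True u" using contour_valid[of \<omega> t] t by (simp add: lc_valid_def)
  have "(j' < kids \<omega>' n' True u') = (j' < kids \<omega> n' True u')"
  proof (cases "(n', u') = (n, u)")
    case True
    then have "j' < j" using less by (simp add: lc_less_def lc_word_def lexord_same_pref_iff)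
    then show ?thesis using jk assms True by (auto simp: same_past_def)
  next
    case False
    then have "\<omega> (Kids n' True u') = \<omega>' (Kids n' True u')"
      using lc_less_not_remaining[OF less] assms by (simp add: same_past_def)
    then show ?thesis by (simp add: kids_def)
  qed
  then show ?case using Suc by (simp add: c next_lc_def)
qed simp

lemma same_past_sym:
  assumes "same_past \<omega> \<omega>' t n u j"
  shows "same_past \<omega>' \<omega> t n u j"
  using same_past_contour[OF assms, of t] assms contour_valid[of \<omega> t]
  by (auto simp: same_past_def lc_valid_def)

lemma same_past_lab:
  assumes "same_past \<omega> \<omega>' t n u j" "s \<le> t"
  shows "lab \<omega>' s = lab \<omega> s"
proof -
  obtain n' u' j' where c: "contour \<omega> s = (n', u', j')" by (cases "contour \<omega> s")
  have t: "contour \<omega> t = (n, u, j)" using assms by (simp add: same_past_def)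
  have less: "\<not> lc_less (n, u, j) (n', u', j')" using contour_less_iff[of \<omega> t s] assms(2) c t by simp
  have "spine_label \<omega>' n' = spine_label \<omega> n'"
    unfolding spine_label_def
    by (rule sum.cong) (use assms(1) in \<open>auto simp: same_past_def remaining_def\<close>)
  moreover have "\<omega>' (Incr n' True (take i u')) = \<omega> (Incr n' True (take i u'))" for i
  proof -
    \<comment> \<open>A coordinate in \<open>remaining n u j\<close> would place the corner visited
      at time \<open>s\<close> after \<open>(n, u, j)\<close>.\<close>
    have "Incr n' True (take i u') \<notin> remaining n u j"
    proof
      assume "Incr n' True (take i u') \<in> remaining n u j"
      then obtain h z where *: "n' = n" "take i u' = u @ h # z" "j \<le> h" by (auto simp: remaining_def)
      then have "u' = u @ h # z @ drop i u'" by (metis append.assoc append_Cons append_take_drop_id)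
      then obtain w where w: "u' = u @ h # w" by blast
      have "([j], h # w @ [j']) \<in> lexord less_than"
        using *(3) by (cases w) (auto simp: le_less)
      then have "(u @ [j], u' @ [j']) \<in> lexord less_than" by (simp add: w lexord_same_pref_iff)
      then show False using less *(1) by (simp add: lc_less_def lc_word_def)
    qed
    then show ?thesis using assms(1) by (simp add: same_past_def)
  qed
  ultimately show ?thesis
    using same_past_contour[OF assms] by (simp add: lab_def c lc_vertex_def vlabel_vert)
qed

text \<open>Strictly before \<open>t\<close> the last corner of \<open>u\<close> has not been
  passed, so the vertex in question is not \<open>u\<close> and its number of children belongs to
  the history.\<close>

lemma same_past_last_visit:
  assumes "same_past \<omega> \<omega>' t n u j" "r < t" "last_visit \<omega> s r"
  shows "last_visit \<omega>' s r"
proof -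
  obtain n' u' j' where c: "contour \<omega> s = (n', u', j')" by (cases "contour \<omega> s")
  have r: "contour \<omega> r = (n', u', kids \<omega> n' True u')" using assms(3) c by (simp add: last_visit_def)
  have t: "contour \<omega> t = (n, u, j)" using assms by (simp add: same_past_def)
  have less: "lc_less (n', u', kids \<omega> n' True u') (n, u, j)" using contour_less[OF assms(2), of \<omega>] r t by simp
  have "(n', u') \<noteq> (n, u)"
  proof
    assume "(n', u') = (n, u)"
    then have "kids \<omega> n True u < j" using less by (simp add: lc_less_def lc_word_def lexord_same_pref_iff)
    then show False using contour_valid[of \<omega> t] t by (simp add: lc_valid_def)
  qed
  then have "\<omega> (Kids n' True u') = \<omega>' (Kids n' True u')"
    using lc_less_not_remaining[OF less] assms(1) by (simp add: same_past_def)
  moreover have "contour \<omega>' s = contour \<omega> s" "contour \<omega>' r = contour \<omega> r"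
    using same_past_contour[OF assms(1)] last_visit_ge[OF assms(3)] assms(2) by auto
  ultimately show ?thesis by (simp add: last_visit_def c r kids_def)
qed

lemma same_past_arrival:
  assumes "same_past \<omega> \<omega>' t n u j"
  shows "s \<le> t \<Longrightarrow> arrival \<omega> k s \<Longrightarrow> arrival \<omega>' k s"
proof (induction k arbitrary: s)
  case (Suc k)
  then obtain s0 r0 where *: "arrival \<omega> k s0" "last_visit \<omega> s0 r0" "r0 < s" "lab \<omega> s = - int (Suc k)"
    "\<forall>q. r0 < q \<and> q < s \<longrightarrow> lab \<omega> q \<noteq> - int (Suc k)" by auto
  have "arrival \<omega>' k s0" using Suc.IH[OF _ *(1)] last_visit_ge[OF *(2)] *(3) Suc.prems(1) by simp
  moreover have "last_visit \<omega>' s0 r0" using same_past_last_visit[OF assms _ *(2)] *(3) Suc.prems(1) by simp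
  moreover have "lab \<omega>' q = lab \<omega> q" if "q \<le> s" for q
    using same_past_lab[OF assms] that Suc.prems(1) by simp
  ultimately show ?case unfolding arrival.simps
    by (intro exI[of _ s0] exI[of _ r0]) (use * in auto)
qed simp

lemma arrival_after_last_visit:
  "arrival \<omega> k t \<Longrightarrow> i < k \<Longrightarrow> arrival \<omega> i s \<Longrightarrow> last_visit \<omega> s r \<Longrightarrow> r < t"
proof (induction k arbitrary: t)
  case (Suc k)
  then obtain s0 r0 where *: "arrival \<omega> k s0" "last_visit \<omega> s0 r0" "r0 < t" by auto
  show ?case
  proof (cases "i = k")
    case True
    then have "s = s0" using arrival_unique Suc.prems(3) *(1) by blast
    then show ?thesis using last_visit_unique[OF Suc.prems(4)] *(2,3) by simp
  next
    case False
    then have "r < s0" using Suc.IH[OF *(1)] Suc.prems by simp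
    then show ?thesis using last_visit_ge[OF *(2)] *(3) by simp
  qed
qed simp

lemma same_past_overshoot:
  assumes "same_past \<omega> \<omega>' t n u j" "arrival \<omega> k t" "i < k" "overshoot \<omega> i x"
  shows "overshoot \<omega>' i x"
proof -
  obtain s r q where *: "arrival \<omega> i s" "last_visit \<omega> s r" "s < q" "q \<le> r" "lab \<omega> q \<le> - int i - x"
    using assms(4) unfolding overshoot_def by blast
  have rt: "r < t" by (rule arrival_after_last_visit[OF assms(2,3) *(1,2)])
  have "arrival \<omega>' i s" using same_past_arrival[OF assms(1) _ *(1)] *(3,4) rt by simp
  moreover have "last_visit \<omega>' s r" by (rule same_past_last_visit[OF assms(1) rt *(2)])
  moreover have "lab \<omega>' q = lab \<omega> q" using same_past_lab[OF assms(1)] *(4) rt by simp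
  ultimately show ?thesis using * unfolding overshoot_def by metis
qed

text \<open>Events that are decided when the ray arrives at level \<open>k\<close>, for every \<open>k \<ge> k0\<close>.\<close>

definition past_event :: "nat \<Rightarrow> ((idx \<Rightarrow> int) \<Rightarrow> bool) \<Rightarrow> bool" where
  "past_event k0 A \<longleftrightarrow> Measurable.pred (prodM input_pmf) A \<and>
     (\<forall>k\<ge>k0. \<forall>\<omega> \<omega>' t n u j. same_past \<omega> \<omega>' t n u j \<longrightarrow> arrival \<omega> k t \<longrightarrow> A \<omega> \<longrightarrow> A \<omega>')"

lemma past_event_mono: "past_event k A \<Longrightarrow> k \<le> k' \<Longrightarrow> past_event k' A"
  unfolding past_event_def by (meson le_trans)

lemma past_event_True: "past_event k (\<lambda>_. True)"
  by (simp add: past_event_def)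

lemma past_event_conj: "past_event k A \<Longrightarrow> past_event k B \<Longrightarrow> past_event k (\<lambda>\<omega>. A \<omega> \<and> B \<omega>)"
  unfolding past_event_def by (intro conjI pred_intros_logic) blast+

lemma past_event_overshoot:
  assumes "i < k"
  shows "past_event k (\<lambda>\<omega>. overshoot \<omega> i x)"
  unfolding past_event_def
proof (intro conjI allI impI)
  fix k' \<omega> \<omega>' t n u j
  assume *: "k \<le> k'" "same_past \<omega> \<omega>' t n u j" "arrival \<omega> k' t" "overshoot \<omega> i x"
  show "overshoot \<omega>' i x"
    by (rule same_past_overshoot[OF *(2,3) _ *(4)]) (use *(1) assms in simp)
qed measurable

lemma past_event_not_overshoot:
  assumes "i < k"
  shows "past_event k (\<lambda>\<omega>. \<not> overshoot \<omega> i x)"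
  unfolding past_event_def
proof (intro conjI allI impI)
  fix k' \<omega> \<omega>' t n u j
  assume *: "k \<le> k'" "same_past \<omega> \<omega>' t n u j" "arrival \<omega> k' t" "\<not> overshoot \<omega> i x"
  show "\<not> overshoot \<omega>' i x"
    using same_past_overshoot[OF same_past_sym[OF *(2)] same_past_arrival[OF *(2) _ *(3)]] *(1,4) assms by auto
qed measurable

lemma past_event_Bex:
  fixes I :: "nat set"
  assumes "\<And>i. i \<in> I \<Longrightarrow> past_event k (A i)"
  shows "past_event k (\<lambda>\<omega>. \<exists>i\<in>I. A i \<omega>)"
  unfolding past_event_def
proof (intro conjI allI impI)
  show "Measurable.pred (prodM input_pmf) (\<lambda>\<omega>. \<exists>i\<in>I. A i \<omega>)"
    using assms by (intro pred_intros_countable_bounded) (auto simp: past_event_def)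
qed (use assms in \<open>unfold past_event_def, blast\<close>)

lemma past_event_Ball:
  fixes I :: "nat set"
  assumes "\<And>i. i \<in> I \<Longrightarrow> past_event k (A i)"
  shows "past_event k (\<lambda>\<omega>. \<forall>i\<in>I. A i \<omega>)"
  unfolding past_event_def
proof (intro conjI allI impI)
  show "Measurable.pred (prodM input_pmf) (\<lambda>\<omega>. \<forall>i\<in>I. A i \<omega>)"
    using assms by (intro pred_intros_countable_bounded) (auto simp: past_event_def)
qed (use assms in \<open>unfold past_event_def, blast\<close>)

section \<open>Merging of the extremal rays\<close>

text \<open>Conditioning over a countable partition: a ratio valid on each cell holds on the
  union.\<close>

lemma (in finite_measure) measure_UN_scaled:
  fixes E F :: "'c::countable \<Rightarrow> 'a set"
  assumes E: "\<And>i. E i \<in> sets M" and F: "\<And>i. F i \<in> sets M" "\<And>i. F i \<subseteq> E i"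
    and disj: "disjoint_family E" and scale: "\<And>i. measure M (F i) = c * measure M (E i)"
  shows "measure M (\<Union>i. F i) = c * measure M (\<Union>i. E i)"
proof -
  \<comment> \<open>The countable index set is moved to \<open>nat\<close>, with the empty set at
    numbers that encode nothing.\<close>
  define ext where "ext G m = (if m \<in> range (to_nat :: 'c \<Rightarrow> nat) then G (from_nat m :: 'c) else {})"
    for G :: "'c \<Rightarrow> 'a set" and m
  have un: "(\<Union>m. ext G m) = (\<Union>i. G i)" for G
    by (auto simp: ext_def split: if_splits)
  have ms: "(\<lambda>m. measure M (ext G m)) sums measure M (\<Union>i. G i)"
    if "\<And>i. G i \<in> sets M" "disjoint_family G" for G
    unfolding un[symmetric]
  proof (rule finite_measure_UNION)
    show "range (ext G) \<subseteq> sets M" using that by (auto simp: ext_def)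
    show "disjoint_family (ext G)" using that(2)
      by (fastforce simp: disjoint_family_on_def ext_def)
  qed
  have dF: "disjoint_family F" using disj F(2) unfolding disjoint_family_on_def by blast
  have "measure M (ext F m) = c * measure M (ext E m)" for m by (simp add: ext_def scale)
  then have "(\<lambda>m. c * measure M (ext E m)) sums measure M (\<Union>i. F i)" using ms[OF F(1) dF] by simp
  moreover have "(\<lambda>m. c * measure M (ext E m)) sums (c * measure M (\<Union>i. E i))"
    by (intro sums_mult ms E disj)
  ultimately show ?thesis by (rule sums_unique2)
qed

text \<open>The children from \<open>j\<close> on do not descend by \<open>x\<close>. The conjunct
  on \<open>root_kids\<close> makes \<open>stays\<close> a subevent of the one that is conditioned
  on.\<close>

definition stays :: "int \<Rightarrow> nat \<Rightarrow> tree_data \<Rightarrow> bool" where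
  "stays x j g \<longleftrightarrow> j \<le> root_kids g \<and>
     (\<forall>h. j \<le> h \<and> h < root_kids g \<longrightarrow> avoids (x + g ([h], False)) (subtree g h))"

lemma stays_measurable [measurable]: "Measurable.pred TM (stays x j)"
proof -
  have [measurable]: "Measurable.pred TM (\<lambda>g. avoids (x + g ([h], False)) (subtree g h))" for h
    by (rule measurable_compose_countable[where g="\<lambda>g. g ([h], False)"]) measurable
  have "Measurable.pred TM (\<lambda>g. j \<le> root_kids g \<and>
     (\<forall>h. j \<le> h \<and> h < root_kids g \<longrightarrow> avoids (x + g ([h], False)) (subtree g h)))" by measurable
  then show ?thesis unfolding stays_def .
qed

text \<open>Since \<open>(1/2) ^ j\<close> is the probability of at least \<open>j\<close> children,
  the conditional probability is that of a fresh tree.\<close>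

lemma prob_stays: "0 < x \<Longrightarrow> measure TM {g. stays x j g} = (1/2) ^ j * avoid_prob x"
  unfolding stays_def prob_remaining_avoids using avoid_prob_fixpoint[of x] by simp

lemma prob_root_kids_ge: "measure TM {g. j \<le> root_kids g} = (1/2) ^ j"
  using prob_remaining_children[of "\<lambda>_ _. True" 1 j]
  by (simp add: depends_on_def prob_space.prob_space[OF prob_space_prodM, simplified])

lemma overshoot_not_stays:
  assumes "arrival \<omega> k s" "contour \<omega> s = (n, u, j)" "overshoot \<omega> k x" "0 < x"
  shows "\<not> stays x j (tree_at n True u \<omega>)"
proof
  assume st: "stays x j (tree_at n True u \<omega>)"
  obtain s' r q where *: "arrival \<omega> k s'" "last_visit \<omega> s' r" "s' < q" "q \<le> r" "lab \<omega> q \<le> - int k - x"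
    using assms(3) unfolding overshoot_def by blast
  have "s' = s" using arrival_unique *(1) assms(1) by blast
  obtain n' u' j' where q: "contour \<omega> q = (n', u', j')" by (cases "contour \<omega> q")
  have r: "contour \<omega> r = (n, u, kids \<omega> n True u)" using *(2) assms(2) \<open>s' = s\<close> by (simp add: last_visit_def)
  have ls: "vlabel \<omega> (vert n True u) = - int k"
    using arrival_lab[OF assms(1)] assms(2) by (simp add: lab_def lc_vertex_def)
  have lq: "vlabel \<omega> (vert n' True u') \<le> - int k - x" using *(5) q by (simp add: lab_def lc_vertex_def)
  have bt: "n' = n \<and> (u' = u \<and> j \<le> j' \<or> (\<exists>h z. u' = u @ h # z \<and> j \<le> h \<and> h < kids \<omega> n True u))"
    by (rule contour_between[OF assms(2) r _ *(4) q]) (use *(3) \<open>s' = s\<close> in simp)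
  then have "u' \<noteq> u" using ls lq assms(4) by auto
  then obtain h z where hz: "n' = n" "u' = u @ h # z" "j \<le> h" "h < kids \<omega> n True u" using bt by blast
  let ?g = "tree_at n True u \<omega>"
  have "in_tree \<omega> n True (u @ h # z)" using contour_valid[of \<omega> q] q hz by (simp add: lc_valid_def)
  then have "node ?g (h # z)" by (rule in_tree_node)
  then have "node (subtree ?g h) z" by (simp add: node_Cons)
  moreover have "avoids (x + ?g ([h], False)) (subtree ?g h)"
    using st hz by (auto simp: stays_def root_kids_tree_at)
  ultimately have "- (x + ?g ([h], False)) < rel_label (subtree ?g h) z" by (auto simp: avoids_def)
  then have "- x < rel_label ?g (h # z)" by (simp add: rel_label_Cons)
  then show False using lq ls vlabel_append[of \<omega> n True u "h # z"] hz by simp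
qed

text \<open>A strong Markov property at the arrival. For a fixed arrival time and corner
  \<open>(n, u, j)\<close>, the past is an event outside \<open>remaining n u j\<close> intersected
  with \<open>j <= kids\<close>; by independence the conditional probability of \<open>stays\<close>
  is \<open>avoid_prob x\<close>, whatever the corner is.\<close>

lemma past_event_conditional:
  assumes past: "past_event k A" and x: "0 < x"
  shows "measure (prodM input_pmf) {\<omega>. A \<omega> \<and> overshoot \<omega> k x}
    \<le> (1 - avoid_prob x) * measure (prodM input_pmf) {\<omega>. A \<omega>}"
proof -
  interpret prob_space "prodM input_pmf" by (rule prob_space_prodM)
  have [measurable]: "Measurable.pred (prodM input_pmf) A" using past by (simp add: past_event_def)
  define E where "E i \<omega> \<longleftrightarrow> (case i of (t, n, u, j) \<Rightarrow> A \<omega> \<and> arrival \<omega> k t \<and> contour \<omega> t = (n, u, j))"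
    for i :: "nat \<times> lcorner" and \<omega>
  define B where "B i \<omega> \<longleftrightarrow> (case i of (t, n, u, j) \<Rightarrow> stays x j (tree_at n True u \<omega>))"
    for i :: "nat \<times> lcorner" and \<omega>
  have Em [measurable]: "Measurable.pred (prodM input_pmf) (E i)" for i
    by (cases i) (simp add: E_def[abs_def])
  have Bm [measurable]: "Measurable.pred (prodM input_pmf) (B i)" for i
    by (cases i) (simp add: B_def[abs_def])
  have EB: "prob {\<omega>. E i \<omega> \<and> B i \<omega>} = avoid_prob x * prob {\<omega>. E i \<omega>}" for i
  proof -
    obtain t n u j where i: "i = (t, n, u, j)" by (cases i)
    define W where "W = remaining n u j"
    \<comment> \<open>Replaces the future by a fixed one compatible with the past, exactly
      \<open>j\<close> children at \<open>u\<close> and 0 elsewhere, so that \<open>C\<close> does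
      not look at \<open>W\<close>.\<close>
    define freeze where "freeze \<omega> = (\<lambda>l. if l = Kids n True u then int j else if l \<in> W then 0 else \<omega> l)"
      for \<omega> :: "idx \<Rightarrow> int"
    have [measurable]: "freeze \<in> measurable (prodM input_pmf) (prodM input_pmf)"
    proof (rule measurable_PiM_single')
      fix l
      have "(\<lambda>\<omega>. \<omega> l) \<in> measurable (prodM input_pmf) (measure_pmf (input_pmf l))"
        by (rule measurable_component_singleton) simp
      then show "(\<lambda>\<omega>. freeze \<omega> l) \<in> measurable (prodM input_pmf) (measure_pmf (input_pmf l))"
        by (simp add: freeze_def)
    qed simp
    define C where "C \<omega> \<longleftrightarrow> E i (freeze \<omega>)" for \<omega>
    have Cm [measurable]: "Measurable.pred (prodM input_pmf) C" unfolding C_def by measurable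
    have kW: "Kids n True u \<in> W" by (simp add: W_def remaining_def)
    have agree: "\<omega> l = freeze \<omega> l" if "l \<notin> W" for \<omega> l using that kW by (auto simp: freeze_def)
    have kf: "kids (freeze \<omega>) n True u = j" for \<omega> by (simp add: kids_def freeze_def)
    have trans: "E i \<omega>'" if "E i \<omega>" "j \<le> kids \<omega>' n True u" "\<And>l. l \<notin> W \<Longrightarrow> \<omega> l = \<omega>' l" for \<omega> \<omega>'
    proof -
      have sp: "same_past \<omega> \<omega>' t n u j" using that by (simp add: same_past_def E_def i W_def)
      have "arrival \<omega> k t" "A \<omega>" "contour \<omega> t = (n, u, j)" using that(1) by (auto simp: E_def i)
      moreover from this have "A \<omega>'" using past sp unfolding past_event_def by blast
      ultimately show ?thesis
        using same_past_arrival[OF sp] same_past_contour[OF sp, of t] by (simp add: E_def i)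
    qed
    \<comment> \<open>\<open>same_past\<close> links each input and its frozen version in both
      directions, given at least \<open>j\<close> children.\<close>
    have EC: "E i \<omega> \<longleftrightarrow> C \<omega> \<and> j \<le> root_kids (tree_at n True u \<omega>)" for \<omega>
    proof
      assume e: "E i \<omega>"
      then have "j \<le> kids \<omega> n True u" using contour_valid[of \<omega> t] by (auto simp: E_def i lc_valid_def)
      moreover have "E i (freeze \<omega>)" by (rule trans[OF e]) (simp add: kf, rule agree)
      ultimately show "C \<omega> \<and> j \<le> root_kids (tree_at n True u \<omega>)" by (simp add: C_def root_kids_tree_at)
    next
      assume *: "C \<omega> \<and> j \<le> root_kids (tree_at n True u \<omega>)"
      show "E i \<omega>"
      proof (rule trans)
        show "E i (freeze \<omega>)" "j \<le> kids \<omega> n True u" using * by (simp_all add: C_def root_kids_tree_at)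
      qed (rule agree[symmetric])
    qed
    have Cdep: "depends_on C (- W)"
    proof (rule depends_onI)
      fix a b :: "idx \<Rightarrow> int" assume "\<And>l. l \<in> - W \<Longrightarrow> a l = b l"
      then have "freeze a = freeze b" by (auto simp: freeze_def fun_eq_iff)
      then show "C a = C b" by (simp add: C_def)
    qed
    have Tdep: "depends_on (\<lambda>\<omega>. P (tree_at n True u \<omega>)) W"
      if P: "\<And>g g'. root_kids g = root_kids g' \<Longrightarrow>
        (\<And>h. j \<le> h \<Longrightarrow> subtree g h = subtree g' h \<and> g ([h], False) = g' ([h], False)) \<Longrightarrow> P g = P g'" for P
    proof (rule depends_onI)
      fix a b :: "idx \<Rightarrow> int" assume ab: "\<And>l. l \<in> W \<Longrightarrow> a l = b l"
      show "P (tree_at n True u a) = P (tree_at n True u b)"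
      proof (rule P)
        show "root_kids (tree_at n True u a) = root_kids (tree_at n True u b)"
          using ab[OF kW] by (simp add: root_kids_tree_at kids_def)
        fix h assume h: "j \<le> h"
        have "a (Kids n True (u @ h # z)) = b (Kids n True (u @ h # z))"
          "a (Incr n True (u @ h # z)) = b (Incr n True (u @ h # z))" for z
          using h by (auto intro!: ab simp: W_def remaining_def)
        then show "subtree (tree_at n True u a) h = subtree (tree_at n True u b) h \<and>
            tree_at n True u a ([h], False) = tree_at n True u b ([h], False)"
          by (auto simp: subtree_def tree_at_def fun_eq_iff)
      qed
    qed
    have Sdep: "depends_on (\<lambda>\<omega>. stays x j (tree_at n True u \<omega>)) W"
      by (rule Tdep) (auto simp: stays_def)
    have Kdep: "depends_on (\<lambda>\<omega>. j \<le> root_kids (tree_at n True u \<omega>)) W"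
      by (rule Tdep) auto
    have "{\<omega>. E i \<omega> \<and> B i \<omega>} = {\<omega>. C \<omega> \<and> stays x j (tree_at n True u \<omega>)}"
    proof -
      have "B i \<omega> \<longleftrightarrow> stays x j (tree_at n True u \<omega>)" for \<omega> by (simp add: B_def i)
      then show ?thesis unfolding EC stays_def by blast
    qed
    then have "prob {\<omega>. E i \<omega> \<and> B i \<omega>} = prob {\<omega>. C \<omega>} * prob {\<omega>. stays x j (tree_at n True u \<omega>)}"
      using prodM_prob_conj[OF Cm _ Cdep Sdep] by simp
    moreover have "prob {\<omega>. E i \<omega>} = prob {\<omega>. C \<omega>} * prob {\<omega>. j \<le> root_kids (tree_at n True u \<omega>)}"
      unfolding EC using prodM_prob_conj[OF Cm _ Cdep Kdep] by simp
    moreover have "prob {\<omega>. stays x j (tree_at n True u \<omega>)} = (1/2) ^ j * avoid_prob x"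
      using prob_tree_at[of "stays x j" n True u] prob_stays[OF x] by simp
    moreover have "prob {\<omega>. j \<le> root_kids (tree_at n True u \<omega>)} = (1/2) ^ j"
      using prob_tree_at[of "\<lambda>g. j \<le> root_kids g" n True u] prob_root_kids_ge by simp
    ultimately show ?thesis by simp
  qed
  have setE: "{\<omega>. E i \<omega>} \<in> events" for i by (rule Collect_in_sets) measurable
  have setF: "{\<omega>. E i \<omega> \<and> \<not> B i \<omega>} \<in> events" for i by (rule Collect_in_sets) measurable
  have setG: "{\<omega>. E i \<omega> \<and> B i \<omega>} \<in> events" for i by (rule Collect_in_sets) measurable
  \<comment> \<open>The arrival time is unique, so the cells indexed by time and corner are
    disjoint.\<close>
  have disj: "disjoint_family (\<lambda>i. {\<omega>. E i \<omega>})"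
  proof -
    have "i = i'" if "E i \<omega>" "E i' \<omega>" for i i' \<omega>
    proof -
      obtain t c t' c' where i: "i = (t, c)" "i' = (t', c')" by (cases i; cases i')
      have "arrival \<omega> k t" "contour \<omega> t = c" "arrival \<omega> k t'" "contour \<omega> t' = c'"
        using that by (auto simp: E_def i split: prod.splits)
      then show ?thesis using arrival_unique[of \<omega> k t t'] i by auto
    qed
    then show ?thesis unfolding disjoint_family_on_def by blast
  qed
  have scale: "prob {\<omega>. E i \<omega> \<and> \<not> B i \<omega>} = (1 - avoid_prob x) * prob {\<omega>. E i \<omega>}" for i
  proof -
    have "prob {\<omega>. E i \<omega>} = prob ({\<omega>. E i \<omega> \<and> \<not> B i \<omega>} \<union> {\<omega>. E i \<omega> \<and> B i \<omega>})"
      by (rule arg_cong[where f=prob]) auto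
    also have "\<dots> = prob {\<omega>. E i \<omega> \<and> \<not> B i \<omega>} + prob {\<omega>. E i \<omega> \<and> B i \<omega>}"
      by (rule finite_measure_Union[OF setF setG]) auto
    finally show ?thesis unfolding EB left_diff_distrib mult_1_left by linarith
  qed
  have "prob {\<omega>. A \<omega> \<and> overshoot \<omega> k x} \<le> prob (\<Union>i. {\<omega>. E i \<omega> \<and> \<not> B i \<omega>})"
  proof (rule finite_measure_mono)
    show "{\<omega>. A \<omega> \<and> overshoot \<omega> k x} \<subseteq> (\<Union>i. {\<omega>. E i \<omega> \<and> \<not> B i \<omega>})"
    proof
      fix \<omega> assume "\<omega> \<in> {\<omega>. A \<omega> \<and> overshoot \<omega> k x}"
      then have a: "A \<omega>" "overshoot \<omega> k x" by auto
      then obtain s where s: "arrival \<omega> k s" unfolding overshoot_def by blast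
      obtain n u j where c: "contour \<omega> s = (n, u, j)" by (cases "contour \<omega> s")
      have "E (s, n, u, j) \<omega> \<and> \<not> B (s, n, u, j) \<omega>"
        using overshoot_not_stays[OF s c a(2) x] a s c by (simp add: E_def B_def)
      then show "\<omega> \<in> (\<Union>i. {\<omega>. E i \<omega> \<and> \<not> B i \<omega>})" by blast
    qed
    show "(\<Union>i. {\<omega>. E i \<omega> \<and> \<not> B i \<omega>}) \<in> events"
      by (rule sets.countable_UN''[OF countableI_type setF])
  qed
  also have "\<dots> = (1 - avoid_prob x) * prob (\<Union>i. {\<omega>. E i \<omega>})"
    by (rule measure_UN_scaled[OF setE setF _ disj scale]) auto
  also have "\<dots> \<le> (1 - avoid_prob x) * prob {\<omega>. A \<omega>}"
    by (intro mult_left_mono finite_measure_mono)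
       (auto simp: E_def avoid_prob_le_1 intro: Collect_in_sets)
  finally show ?thesis .
qed

lemma prob_overshoot: "0 < x \<Longrightarrow> measure (prodM input_pmf) {\<omega>. overshoot \<omega> k x} \<le> 1 - avoid_prob x"
  using past_event_conditional[OF past_event_True, of x k]
  by (simp add: prob_space.prob_space[OF prob_space_prodM, simplified])

text \<open>The factors \<open>i (i + 3) / ((i + 1) (i + 2))\<close> telescope to
  \<open>(d + 3) / (3 (d + 1))\<close>, which decreases to 1/3.\<close>

lemma prod_avoid_prob: "(\<Prod>i<d. avoid_prob (int (d - i))) \<ge> 1 / 3"
proof -
  have "(\<Prod>i<d. avoid_prob (int (Suc i))) = (real d + 3) / (3 * (real d + 1))"
  proof (induction d)
    case (Suc d)
    have nz: "real d + 1 \<noteq> 0" "real d + 2 \<noteq> 0" "real d + 3 \<noteq> 0" by (auto simp: add_eq_0_iff)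
    have eq: "avoid_prob (int (Suc d)) = (real d + 1) * (real d + 4) / ((real d + 2) * (real d + 3))"
      unfolding avoid_prob_nat by (simp add: add_ac)
    have "(real d + 3) / (3 * (real d + 1)) * ((real d + 1) * (real d + 4) / ((real d + 2) * (real d + 3)))
        = (real d + 4) / (3 * (real d + 2))"
      using nz by (simp add: divide_simps) (simp add: algebra_simps)
    then show ?case unfolding prod.lessThan_Suc Suc.IH eq by (simp add: add_ac)
  qed simp
  moreover have "(\<Prod>i<d. avoid_prob (int (d - i))) = (\<Prod>i<d. avoid_prob (int (Suc i)))"
    by (rule prod.reindex_bij_witness[where i="\<lambda>i. d - Suc i" and j="\<lambda>i. d - Suc i"]) auto
  moreover have "(real d + 3) / (3 * (real d + 1)) \<ge> 1 / 3" by (simp add: field_simps)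
  ultimately show ?thesis by (simp only:)
qed

text \<open>Chain rule over the block: level \<open>k + m + 1\<close> must not overshoot by
  \<open>d - m\<close>, which costs a conditional factor \<open>avoid_prob (d - m)\<close>; their
  product is bounded by \<open>prod_avoid_prob\<close>.\<close>

lemma prob_overshoot_block:
  assumes "past_event (Suc k) A"
  shows "measure (prodM input_pmf) {\<omega>. A \<omega> \<and> (\<exists>j\<in>{k<..k+d}. overshoot \<omega> j (int (k + d - j) + 1))}
    \<le> 2/3 * measure (prodM input_pmf) {\<omega>. A \<omega>}"
proof -
  interpret prob_space "prodM input_pmf" by (rule prob_space_prodM)
  have [measurable]: "Measurable.pred (prodM input_pmf) A" using assms by (simp add: past_event_def)
  define N where "N m \<omega> \<longleftrightarrow> (\<forall>j\<in>{k<..k+m}. \<not> overshoot \<omega> j (int (k + d - j) + 1))" for m \<omega>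
  have [measurable]: "Measurable.pred (prodM input_pmf) (N m)" for m unfolding N_def by measurable
  have lower: "prob {\<omega>. A \<omega> \<and> N m \<omega>} \<ge> prob {\<omega>. A \<omega>} * (\<Prod>i<m. avoid_prob (int (d - i)))" if "m \<le> d" for m
    using that
  proof (induction m)
    case 0
    then show ?case by (simp add: N_def)
  next
    case (Suc m)
    define x where "x = int (d - m)"
    have x: "0 < x" "int (k + d - Suc (k + m)) + 1 = x" using Suc.prems by (auto simp: x_def)
    have past: "past_event (Suc (k + m)) (\<lambda>\<omega>. A \<omega> \<and> N m \<omega>)"
      unfolding N_def
      by (intro past_event_conj past_event_Ball past_event_not_overshoot past_event_mono[OF assms]) auto
    have "{k<..k + Suc m} = insert (Suc (k + m)) {k<..k+m}" by auto
    then have NS: "N (Suc m) \<omega> \<longleftrightarrow> N m \<omega> \<and> \<not> overshoot \<omega> (Suc (k + m)) x" for \<omega>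
      unfolding N_def using x(2) by auto
    have "prob {\<omega>. A \<omega> \<and> N m \<omega>} = prob ({\<omega>. A \<omega> \<and> N (Suc m) \<omega>} \<union> {\<omega>. (A \<omega> \<and> N m \<omega>) \<and> overshoot \<omega> (Suc (k + m)) x})"
      by (rule arg_cong[where f=prob]) (auto simp: NS)
    also have "\<dots> = prob {\<omega>. A \<omega> \<and> N (Suc m) \<omega>} + prob {\<omega>. (A \<omega> \<and> N m \<omega>) \<and> overshoot \<omega> (Suc (k + m)) x}"
      by (rule finite_measure_Union) (auto intro: Collect_in_sets simp: NS)
    also have "\<dots> \<le> prob {\<omega>. A \<omega> \<and> N (Suc m) \<omega>} + (1 - avoid_prob x) * prob {\<omega>. A \<omega> \<and> N m \<omega>}"
      using past_event_conditional[OF past x(1)] by simp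
    finally have "avoid_prob x * prob {\<omega>. A \<omega> \<and> N m \<omega>} \<le> prob {\<omega>. A \<omega> \<and> N (Suc m) \<omega>}"
      by (simp add: algebra_simps)
    moreover have "avoid_prob x * (prob {\<omega>. A \<omega>} * (\<Prod>i<m. avoid_prob (int (d - i)))) \<le> avoid_prob x * prob {\<omega>. A \<omega> \<and> N m \<omega>}"
      using Suc by (intro mult_left_mono) (auto simp: avoid_prob_def)
    ultimately show ?case by (simp add: x_def algebra_simps)
  qed
  have "prob {\<omega>. A \<omega>} * (1/3) \<le> prob {\<omega>. A \<omega>} * (\<Prod>i<d. avoid_prob (int (d - i)))"
    by (intro mult_left_mono prod_avoid_prob) auto
  also have "\<dots> \<le> prob {\<omega>. A \<omega> \<and> N d \<omega>}" by (rule lower) simp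
  finally have "prob {\<omega>. A \<omega>} * (1/3) \<le> prob {\<omega>. A \<omega> \<and> N d \<omega>}" .
  moreover have "prob {\<omega>. A \<omega>} = prob ({\<omega>. A \<omega> \<and> N d \<omega>} \<union> {\<omega>. A \<omega> \<and> \<not> N d \<omega>})"
    by (rule arg_cong[where f=prob]) auto
  moreover have "prob ({\<omega>. A \<omega> \<and> N d \<omega>} \<union> {\<omega>. A \<omega> \<and> \<not> N d \<omega>}) = prob {\<omega>. A \<omega> \<and> N d \<omega>} + prob {\<omega>. A \<omega> \<and> \<not> N d \<omega>}"
    by (rule finite_measure_Union) (auto intro: Collect_in_sets)
  ultimately have "prob {\<omega>. A \<omega> \<and> \<not> N d \<omega>} \<le> 2/3 * prob {\<omega>. A \<omega>}" by linarith
  then show ?thesis by (simp add: N_def)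
qed

text \<open>Union bound; the tails \<open>2 / ((x + 1) (x + 2))\<close> telescope, so the result
  does not depend on the number of earlier levels.\<close>

lemma prob_early_overshoot:
  "measure (prodM input_pmf) {\<omega>. \<exists>j\<le>k. overshoot \<omega> j (int (k + d - j) + 1)} \<le> 2 / (real d + 2)"
proof -
  interpret prob_space "prodM input_pmf" by (rule prob_space_prodM)
  have "prob {\<omega>. \<exists>j\<le>k. overshoot \<omega> j (int (k + d - j) + 1)} = prob (\<Union>j\<in>{..k}. {\<omega>. overshoot \<omega> j (int (k + d - j) + 1)})"
    by (rule arg_cong[where f=prob]) auto
  also have "\<dots> \<le> (\<Sum>j\<in>{..k}. prob {\<omega>. overshoot \<omega> j (int (k + d - j) + 1)})"
    by (rule finite_measure_subadditive_finite) (auto intro: Collect_in_sets)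
  also have "\<dots> \<le> (\<Sum>j\<in>{..k}. 1 - avoid_prob (int (Suc (k - j + d))))"
  proof (rule sum_mono)
    fix j assume "j \<in> {..k}"
    then have eq: "int (k + d - j) + 1 = int (Suc (k - j + d))" by auto
    show "prob {\<omega>. overshoot \<omega> j (int (k + d - j) + 1)} \<le> 1 - avoid_prob (int (Suc (k - j + d)))"
      unfolding eq by (rule prob_overshoot) simp
  qed
  also have "\<dots> = (\<Sum>i\<in>{..k}. 1 - avoid_prob (int (Suc (i + d))))"
    by (rule sum.reindex_bij_witness[where i="\<lambda>i. k - i" and j="\<lambda>i. k - i"]) auto
  also have "\<dots> = 2 / (real d + 2) - 2 / (real k + real d + 3)"
  proof (induction k)
    case 0
    show ?case unfolding avoid_prob_nat' atMost_0 sum.insert_remove[OF finite.emptyI]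
      by (simp add: divide_simps) (simp add: algebra_simps)
  next
    case (Suc k)
    have nz: "real k + real d + 3 \<noteq> 0" "real k + real d + 4 \<noteq> 0" by (auto simp: add_eq_0_iff)
    have "1 - avoid_prob (int (Suc (Suc k + d))) = 2 / ((real k + real d + 3) * (real k + real d + 4))"
      unfolding avoid_prob_nat' by (simp add: add_ac)
    also have "\<dots> = 2 / (real k + real d + 3) - 2 / (real k + real d + 4)"
      using nz by (simp add: field_simps)
    finally have eq: "1 - avoid_prob (int (Suc (Suc k + d))) = 2 / (real k + real d + 3) - 2 / (real k + real d + 4)" .
    have "(\<Sum>i\<in>{..Suc k}. 1 - avoid_prob (int (Suc (i + d))))
        = (2 / (real d + 2) - 2 / (real k + real d + 3)) + (2 / (real k + real d + 3) - 2 / (real k + real d + 4))"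
      unfolding sum.atMost_Suc Suc.IH eq ..
    then show ?case by (simp add: add_ac)
  qed
  also have "\<dots> \<le> 2 / (real d + 2)" by simp
  finally show ?thesis .
qed

text \<open>Each block of \<open>d\<close> levels gives, up to overshoots from before the block, a merging
  with conditional probability at least \<open>1/3\<close>.\<close>

lemma merged_window:
  assumes "\<epsilon> > 0"
  shows "\<exists>s. \<forall>k0. measure (prodM input_pmf) {\<omega>. \<forall>k\<in>{k0..k0+s}. \<not> merged \<omega> k} \<le> \<epsilon>"
proof -
  interpret prob_space "prodM input_pmf" by (rule prob_space_prodM)
  \<comment> \<open>\<open>r\<close> blocks make it unlikely that each one overshoots from within;
    the block length \<open>d\<close> then makes the \<open>r\<close> early contributions of at most
    \<open>2 / (d + 2)\<close> small. Neither choice involves \<open>k0\<close>.\<close>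
  obtain r where r: "(2/3 :: real) ^ r < \<epsilon> / 2" using real_arch_pow_inv[of "\<epsilon> / 2" "2/3"] assms by auto
  obtain d :: nat where d: "real d > 4 * real r / \<epsilon>" using reals_Archimedean2 by blast
  have rd: "real r * (2 / (real d + 2)) \<le> \<epsilon> / 2"
  proof -
    have "4 * real r \<le> \<epsilon> * (real d + 2)" using d assms by (simp add: field_simps)
    then show ?thesis using assms by (simp add: field_simps)
  qed
  have "prob {\<omega>. \<forall>k\<in>{k0..k0+r*d}. \<not> merged \<omega> k} \<le> \<epsilon>" for k0
  proof -
    define K where "K i = k0 + i * d" for i
    define early where "early i \<omega> \<longleftrightarrow> (\<exists>j\<le>K i. overshoot \<omega> j (int (K i + d - j) + 1))" for i \<omega>
    define late where "late i \<omega> \<longleftrightarrow> (\<exists>j\<in>{K i<..K i+d}. overshoot \<omega> j (int (K i + d - j) + 1))" for i \<omega>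
    have [measurable]: "Measurable.pred (prodM input_pmf) (early i)" "Measurable.pred (prodM input_pmf) (late i)" for i
      unfolding early_def late_def by measurable
    have lates: "past_event (Suc (K m)) (\<lambda>\<omega>. \<forall>i\<in>{..<m}. late i \<omega>) \<and> prob {\<omega>. \<forall>i\<in>{..<m}. late i \<omega>} \<le> (2/3) ^ m" for m
    proof (induction m)
      case 0
      show ?case by (simp add: past_event_True)
    next
      case (Suc m)
      have "past_event (Suc (K (Suc m))) (\<lambda>\<omega>. \<forall>i\<in>{..<Suc m}. late i \<omega>)"
      proof (rule past_event_Ball)
        fix i assume i: "i \<in> {..<Suc m}"
        \<comment> \<open>Block \<open>i\<close> ends by the start of block \<open>Suc m\<close>, so
          its late overshoots are decided by then.\<close>
        have "K i + d \<le> K (Suc m)"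
          using mult_le_mono1[of "Suc i" "Suc m" d] i by (simp add: K_def)
        then show "past_event (Suc (K (Suc m))) (late i)"
          unfolding late_def by (intro past_event_Bex past_event_overshoot) auto
      qed
      moreover have "prob {\<omega>. \<forall>i\<in>{..<Suc m}. late i \<omega>} = prob {\<omega>. (\<forall>i\<in>{..<m}. late i \<omega>) \<and> late m \<omega>}"
        by (rule arg_cong[where f=prob]) (auto simp: less_Suc_eq)
      moreover have "\<dots> \<le> 2/3 * prob {\<omega>. \<forall>i\<in>{..<m}. late i \<omega>}"
        unfolding late_def[of m] by (rule prob_overshoot_block) (use Suc in blast)
      ultimately show ?case using Suc by simp
    qed
    have "prob {\<omega>. \<forall>k\<in>{k0..k0+r*d}. \<not> merged \<omega> k}
        \<le> prob ({\<omega>. \<forall>i\<in>{..<r}. late i \<omega>} \<union> (\<Union>i\<in>{..<r}. {\<omega>. early i \<omega>}))"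
    proof (rule finite_measure_mono)
      show "{\<omega>. \<forall>k\<in>{k0..k0+r*d}. \<not> merged \<omega> k} \<subseteq> {\<omega>. \<forall>i\<in>{..<r}. late i \<omega>} \<union> (\<Union>i\<in>{..<r}. {\<omega>. early i \<omega>})"
      proof
        fix \<omega> assume "\<omega> \<in> {\<omega>. \<forall>k\<in>{k0..k0+r*d}. \<not> merged \<omega> k}"
        then have nm: "\<not> merged \<omega> k" if "k \<in> {k0..k0+r*d}" for k using that by blast
        \<comment> \<open>If the last level of block \<open>i\<close> is not merged, the offending
          overshoot starts either at a level up to \<open>K i\<close> or inside the block.\<close>
        have "early i \<omega> \<or> late i \<omega>" if "i < r" for i
        proof -
          have "K i + d \<in> {k0..k0+r*d}" using mult_le_mono1[of "Suc i" r d] that by (simp add: K_def)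
          then obtain j where "j \<le> K i + d" "overshoot \<omega> j (int (K i + d - j) + 1)"
            using nm unfolding merged_def by blast
          then show ?thesis unfolding early_def late_def by (cases "j \<le> K i") auto
        qed
        then show "\<omega> \<in> {\<omega>. \<forall>i\<in>{..<r}. late i \<omega>} \<union> (\<Union>i\<in>{..<r}. {\<omega>. early i \<omega>})" by blast
      qed
    qed (intro sets.Un sets.finite_UN Collect_in_sets; measurable)
    also have "\<dots> \<le> prob {\<omega>. \<forall>i\<in>{..<r}. late i \<omega>} + prob (\<Union>i\<in>{..<r}. {\<omega>. early i \<omega>})"
      by (rule measure_Un_le) (intro sets.finite_UN Collect_in_sets; measurable)+
    also have "prob (\<Union>i\<in>{..<r}. {\<omega>. early i \<omega>}) \<le> (\<Sum>i\<in>{..<r}. prob {\<omega>. early i \<omega>})"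
      by (rule finite_measure_subadditive_finite) (auto intro: Collect_in_sets)
    also have "\<dots> \<le> (\<Sum>i\<in>{..<r}. 2 / (real d + 2))"
      unfolding early_def by (intro sum_mono prob_early_overshoot)
    also have "\<dots> \<le> \<epsilon> / 2" using rd by simp
    finally show ?thesis using lates[of r] r by simp
  qed
  then show ?thesis by blast
qed

section \<open>Blocks of the spine\<close>

lemma AE_prodM_coord:
  assumes "set_pmf (p i) \<subseteq> S"
  shows "AE \<omega> in prodM p. \<omega> i \<in> S"
proof -
  interpret prob_space "prodM p" by (rule prob_space_prodM)
  have "prob {\<omega>. \<omega> i \<in> S} = 1"
    unfolding prodM_prob_coord using assms by (subst measure_pmf.prob_eq_1) (auto simp: AE_measure_pmf_iff)
  moreover have "{\<omega>. \<omega> i \<in> S} \<in> events"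
    by (rule Collect_in_sets) (rule pred_count_space[OF coord_measurable])
  ultimately show ?thesis by (simp add: prob_eq_1)
qed

lemma AE_unit_steps: "AE \<omega> in prodM input_pmf. unit_steps \<omega>"
proof -
  have "AE \<omega> in prodM input_pmf. \<forall>n. \<omega> (Step n) \<in> {-1, 0, 1}"
    unfolding AE_all_countable by (intro allI AE_prodM_coord) (simp add: input_pmf_def)
  moreover have "AE \<omega> in prodM input_pmf. \<forall>n s u. \<omega> (Incr n s u) \<in> {-1, 0, 1}"
    unfolding AE_all_countable by (intro allI AE_prodM_coord) (simp add: input_pmf_def)
  ultimately show ?thesis
  proof eventually_elim
    case (elim \<omega>)
    have "\<bar>z\<bar> \<le> 1" if "z \<in> {-1, 0, 1}" for z :: int using that by auto
    then show ?case using elim unfolding unit_steps_def by blast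
  qed
qed

lemma AE_finite_in_tree: "AE \<omega> in prodM input_pmf. \<forall>n. finite {u. in_tree \<omega> n True u}"
proof -
  interpret prob_space "prodM input_pmf" by (rule prob_space_prodM)
  have "AE \<omega> in prodM input_pmf. finite {u. in_tree \<omega> n True u}" for n
  proof -
    have "measure TM {g. finite_tree g} = 1"
      using AE_finite_tree prob_space.prob_eq_1[OF prob_space_prodM Collect_in_sets[OF finite_tree_measurable]] by simp
    then have "prob {\<omega>. finite_tree (tree_at n True [] \<omega>)} = 1"
      using prob_tree_at[OF finite_tree_measurable, of n True "[]"] by simp
    moreover have "{\<omega>. finite_tree (tree_at n True [] \<omega>)} \<in> events"
      by (rule Collect_in_sets) measurable
    ultimately have "AE \<omega> in prodM input_pmf. finite_tree (tree_at n True [] \<omega>)"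
      by (simp add: prob_eq_1)
    then show ?thesis by (simp add: finite_tree_def node_in_tree)
  qed
  then show ?thesis unfolding AE_all_countable by blast
qed

section \<open>Exit of the spine walk from an interval\<close>

definition far :: "int \<Rightarrow> int \<Rightarrow> nat \<Rightarrow> nat \<Rightarrow> (idx \<Rightarrow> int) \<Rightarrow> bool" where
  "far h x P N \<omega> \<longleftrightarrow> (\<exists>j\<le>N. h \<le> \<bar>x + (\<Sum>i<j. \<omega> (Step (P + i)))\<bar>)"

lemma far_0: "far h x P 0 \<omega> \<longleftrightarrow> h \<le> \<bar>x\<bar>"
  by (simp add: far_def)

lemma far_Suc: "far h x P (Suc N) \<omega> \<longleftrightarrow> h \<le> \<bar>x\<bar> \<or> far h (x + \<omega> (Step P)) (Suc P) N \<omega>"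
proof -
  have *: "x + (\<Sum>i<Suc j. \<omega> (Step (P + i))) = (x + \<omega> (Step P)) + (\<Sum>i<j. \<omega> (Step (Suc P + i)))" for j
    by (simp only: sum.lessThan_Suc_shift) simp
  have "far h x P (Suc N) \<omega> \<longleftrightarrow> h \<le> \<bar>x\<bar> \<or> (\<exists>j\<le>N. h \<le> \<bar>x + (\<Sum>i<Suc j. \<omega> (Step (P + i)))\<bar>)"
    unfolding far_def
    by (metis (no_types, lifting) Suc_le_mono add.right_neutral lessThan_0 not0_implies_Suc sum.empty zero_le)
  then show ?thesis unfolding * by (simp add: far_def)
qed

lemma far_measurable [measurable]: "Measurable.pred (prodM input_pmf) (far h x P N)"
proof -
  have "Measurable.pred (prodM input_pmf) (\<lambda>\<omega>. h \<le> \<bar>x + (\<Sum>i<j. \<omega> (Step (P + i)))\<bar>)" for j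
    by (rule pred_count_space[where f="\<lambda>\<omega>. \<Sum>i<j. \<omega> (Step (P + i))"]) measurable
  note [measurable] = this
  show ?thesis unfolding far_def by measurable
qed

lemma far_depends: "depends_on (far h x P N) {Step m | m. P \<le> m \<and> m < P + N}"
proof (rule depends_onI)
  fix a b :: "idx \<Rightarrow> int" assume ab: "\<And>i. i \<in> {Step m | m. P \<le> m \<and> m < P + N} \<Longrightarrow> a i = b i"
  have "(\<Sum>i<j. a (Step (P + i))) = (\<Sum>i<j. b (Step (P + i)))" if "j \<le> N" for j
    by (rule sum.cong[OF refl]) (use that in \<open>auto intro!: ab\<close>)
  then show "far h x P N a = far h x P N b" unfolding far_def by auto
qed

text \<open>A maximal inequality of Kolmogorov type by first-step analysis: the average of
  \<open>(x + i)^2\<close> over the three increments is \<open>x^2 + 2/3\<close>, so the bound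
  reproduces itself; once \<open>h <= |x|\<close> it is at least 1.\<close>

lemma prob_far: "0 < h \<Longrightarrow> measure (prodM input_pmf) {\<omega>. far h x P N \<omega>} \<le> (real_of_int x ^ 2 + 2/3 * real N) / real_of_int h ^ 2"
proof (induction N arbitrary: x P)
  interpret prob_space "prodM input_pmf" by (rule prob_space_prodM)
  {
    fix x :: int and N :: nat and A assume "h \<le> \<bar>x\<bar>" "0 < h"
    then have "real_of_int h ^ 2 \<le> real_of_int x ^ 2"
      by (metis abs_of_pos abs_le_square_iff of_int_abs of_int_le_iff)
    then have "1 \<le> (real_of_int x ^ 2 + 2/3 * real N) / real_of_int h ^ 2" using \<open>0 < h\<close> by simp
    moreover have "prob A \<le> 1" by simp
    ultimately have "prob A \<le> (real_of_int x ^ 2 + 2/3 * real N) / real_of_int h ^ 2" by linarith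
  } note large = this
  {
    case 0
    show ?case
    proof (cases "h \<le> \<bar>x\<bar>")
      case True
      then show ?thesis by (rule large[OF _ 0])
    next
      case False
      then have "{\<omega>. far h x P 0 \<omega>} = {}" by (simp add: far_0)
      then show ?thesis by simp
    qed
  }
  {
    case (Suc N)
    show ?case
    proof (cases "h \<le> \<bar>x\<bar>")
      case True
      then show ?thesis by (rule large[OF _ Suc.prems])
    next
      case False
      have "prob {\<omega>. far h x P (Suc N) \<omega>} = prob {\<omega>. far h (x + \<omega> (Step P)) (Suc P) N \<omega>}"
        using False by (simp add: far_Suc)
      also have "\<dots> = (\<Sum>i\<in>{-1,0,1}. prob {\<omega>. \<omega> (Step P) = i \<and> far h (x + i) (Suc P) N \<omega>})"
        by (rule prodM_split_coord) (simp_all add: input_pmf_def)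
      also have "\<dots> = (\<Sum>i\<in>{-1,0,1}. 1/3 * prob {\<omega>. far h (x + i) (Suc P) N \<omega>})"
      proof (rule sum.cong[OF refl])
        fix i :: int assume i: "i \<in> {-1,0,1}"
        have "prob {\<omega>. \<omega> (Step P) = i \<and> far h (x + i) (Suc P) N \<omega>}
            = prob {\<omega>. \<omega> (Step P) = i} * prob {\<omega>. far h (x + i) (Suc P) N \<omega>}"
        proof (rule prodM_prob_conj[OF _ _ _ far_depends])
          show "depends_on (\<lambda>\<omega>. \<omega> (Step P) = i) {Step P}" by (auto simp: depends_on_def)
          show "Measurable.pred (prodM input_pmf) (\<lambda>\<omega>. \<omega> (Step P) = i)"
            by (rule pred_count_space[OF idx_coord_measurable])
        qed auto
        also have "prob {\<omega>. \<omega> (Step P) = i} = 1/3"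
          using prodM_prob_coord[of input_pmf "Step P" "{i}"] i
          by (auto simp: input_pmf_def measure_pmf_single)
        finally show "prob {\<omega>. \<omega> (Step P) = i \<and> far h (x + i) (Suc P) N \<omega>}
            = 1/3 * prob {\<omega>. far h (x + i) (Suc P) N \<omega>}" .
      qed
      also have "\<dots> \<le> (\<Sum>i\<in>{-1,0,1::int}. 1/3 * ((real_of_int (x + i) ^ 2 + 2/3 * real N) / real_of_int h ^ 2))"
        by (intro sum_mono mult_left_mono Suc) simp
      also have "\<dots> = (real_of_int x ^ 2 + 2/3 * real (Suc N)) / real_of_int h ^ 2"
        using Suc.prems by (simp add: field_simps power2_eq_square)
      finally show ?thesis .
    qed
  }
qed

text \<open>Put \<open>K = 4 * \<kappa>\<close>. If the spine label at \<open>P\<close> is at most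
  \<open>K\<close> in absolute value, right trees of the stretch stay above \<open>-3K\<close> while
  the deep left tree reaches below \<open>-8K\<close>, which leaves the levels from
  \<open>3K\<close> to \<open>8K\<close> open. The length of order \<open>\<kappa>^2\<close> fits
  both the diffusive scale of the spine and the chance of order \<open>1 / \<kappa>^2\<close> of a
  deep tree.\<close>

definition block_event :: "nat \<Rightarrow> nat \<Rightarrow> (idx \<Rightarrow> int) \<Rightarrow> bool" where
  "block_event P \<kappa> \<omega> \<longleftrightarrow> \<not> far (4 * int \<kappa>) 0 P (2 * \<kappa>\<^sup>2) \<omega> \<and>
     (\<exists>n<2 * \<kappa>\<^sup>2. \<not> avoids (40 * int \<kappa>) (tree_at (P + n) True [] \<omega>)) \<and>
     (\<forall>n<2 * \<kappa>\<^sup>2. avoids (4 * int \<kappa>) (tree_at (P + n) False [] \<omega>))"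

lemma tree_at_depends:
  "depends_on (\<lambda>\<omega>. Q (tree_at n s [] \<omega>)) ({Kids n s u | u. True} \<union> {Incr n s u | u. True})"
proof (rule depends_onI)
  fix a b :: "idx \<Rightarrow> int"
  assume "\<And>i. i \<in> {Kids n s u | u. True} \<union> {Incr n s u | u. True} \<Longrightarrow> a i = b i"
  then have "a (Kids n s u) = b (Kids n s u)" "a (Incr n s u) = b (Incr n s u)" for u by blast+
  then have "tree_at n s [] a = tree_at n s [] b" by (auto simp: tree_at_def fun_eq_iff split: prod.split)
  then show "Q (tree_at n s [] a) = Q (tree_at n s [] b)" by simp
qed

lemma prob_all_avoid:
  "measure (prodM input_pmf) {\<omega>. \<forall>n<N. avoids x (tree_at (P + n) s [] \<omega>)} = avoid_prob x ^ N"
proof -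
  have "measure (prodM input_pmf) {\<omega>. \<forall>n\<in>{..<N}. avoids x (tree_at (P + n) s [] \<omega>)}
      = (\<Prod>n\<in>{..<N}. measure (prodM input_pmf) {\<omega>. avoids x (tree_at (P + n) s [] \<omega>)})"
    by (rule prodM_prob_All[OF _ _ tree_at_depends]) (auto simp: disjoint_family_on_def)
  also have "\<dots> = (\<Prod>n\<in>{..<N}. avoid_prob x)"
    unfolding avoid_prob_def by (intro prod.cong refl prob_tree_at) measurable
  finally show ?thesis by (simp add: Ball_def)
qed

lemma all_avoid_depends:
  "depends_on (\<lambda>\<omega>. \<forall>n<N. avoids x (tree_at (P + n) s [] \<omega>))
     ({Kids m s u | m u. P \<le> m \<and> m < P + N} \<union> {Incr m s u | m u. P \<le> m \<and> m < P + N})"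
proof (rule depends_onI)
  fix a b :: "idx \<Rightarrow> int"
  assume ab: "\<And>i. i \<in> {Kids m s u | m u. P \<le> m \<and> m < P + N} \<union> {Incr m s u | m u. P \<le> m \<and> m < P + N} \<Longrightarrow> a i = b i"
  have "avoids x (tree_at (P + n) s [] a) = avoids x (tree_at (P + n) s [] b)" if "n < N" for n
    by (rule depends_onD[OF tree_at_depends]) (use that in \<open>auto intro!: ab\<close>)
  then show "(\<forall>n<N. avoids x (tree_at (P + n) s [] a)) = (\<forall>n<N. avoids x (tree_at (P + n) s [] b))" by blast
qed

lemma all_avoid_measurable [measurable]:
  "Measurable.pred (prodM input_pmf) (\<lambda>\<omega>. \<forall>n<N. avoids x (tree_at (P + n) s [] \<omega>))"
  by measurable

lemma depends_on_Not: "depends_on A K \<Longrightarrow> depends_on (\<lambda>\<omega>. \<not> A \<omega>) K"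
  unfolding depends_on_def by metis

lemma depends_on_mono: "depends_on A K \<Longrightarrow> K \<subseteq> L \<Longrightarrow> depends_on A L"
  unfolding depends_on_def by (meson subsetD)

lemma depends_on_conj: "depends_on A K \<Longrightarrow> depends_on B K \<Longrightarrow> depends_on (\<lambda>\<omega>. A \<omega> \<and> B \<omega>) K"
  unfolding depends_on_def by metis

lemma block_event_alt:
  "block_event P \<kappa> \<omega> \<longleftrightarrow> \<not> far (4 * int \<kappa>) 0 P (2 * \<kappa>\<^sup>2) \<omega> \<and>
     (\<not> (\<forall>n<2 * \<kappa>\<^sup>2. avoids (40 * int \<kappa>) (tree_at (P + n) True [] \<omega>)) \<and>
     (\<forall>n<2 * \<kappa>\<^sup>2. avoids (4 * int \<kappa>) (tree_at (P + n) False [] \<omega>)))"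
  unfolding block_event_def by blast

lemma block_event_measurable [measurable]: "Measurable.pred (prodM input_pmf) (block_event P \<kappa>)"
proof -
  have "Measurable.pred (prodM input_pmf) (\<lambda>\<omega>. \<not> far (4 * int \<kappa>) 0 P (2 * \<kappa>\<^sup>2) \<omega> \<and>
     (\<not> (\<forall>n<2 * \<kappa>\<^sup>2. avoids (40 * int \<kappa>) (tree_at (P + n) True [] \<omega>)) \<and>
     (\<forall>n<2 * \<kappa>\<^sup>2. avoids (4 * int \<kappa>) (tree_at (P + n) False [] \<omega>))))"
    by measurable
  then show ?thesis unfolding block_event_alt .
qed

definition block_coords :: "nat \<Rightarrow> nat \<Rightarrow> idx set" where
  "block_coords P N = {Step m | m. P \<le> m \<and> m < P + N} \<union> {Kids m s u | m s u. P \<le> m \<and> m < P + N} \<union>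
     {Incr m s u | m s u. P \<le> m \<and> m < P + N}"

lemma block_event_depends: "depends_on (block_event P \<kappa>) (block_coords P (2 * \<kappa>\<^sup>2))"
proof -
  have "depends_on (\<lambda>\<omega>. \<not> far (4 * int \<kappa>) 0 P (2 * \<kappa>\<^sup>2) \<omega> \<and>
     (\<not> (\<forall>n<2 * \<kappa>\<^sup>2. avoids (40 * int \<kappa>) (tree_at (P + n) True [] \<omega>)) \<and>
     (\<forall>n<2 * \<kappa>\<^sup>2. avoids (4 * int \<kappa>) (tree_at (P + n) False [] \<omega>)))) (block_coords P (2 * \<kappa>\<^sup>2))"
    by (intro depends_on_conj depends_on_Not depends_on_mono[OF far_depends] depends_on_mono[OF all_avoid_depends])
       (auto simp: block_coords_def)
  then show ?thesis unfolding block_event_alt .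
qed

text \<open>Product of the bounds for the spine walk, a deep left tree and shallow right trees,
  which use disjoint coordinates.\<close>

definition block_const :: real where
  "block_const = 11/12 * ((1 - exp (- 1/441)) * (3/4))"

lemma block_const_pos: "block_const > 0"
  by (simp add: block_const_def)

lemma prob_block_event:
  assumes "0 < \<kappa>"
  shows "measure (prodM input_pmf) {\<omega>. block_event P \<kappa> \<omega>} \<ge> block_const"
proof -
  interpret prob_space "prodM input_pmf" by (rule prob_space_prodM)
  define N where "N = 2 * \<kappa>\<^sup>2"
  define A where "A \<omega> \<longleftrightarrow> \<not> far (4 * int \<kappa>) 0 P N \<omega>" for \<omega>
  define B where "B \<omega> \<longleftrightarrow> \<not> (\<forall>n<N. avoids (40 * int \<kappa>) (tree_at (P + n) True [] \<omega>))" for \<omega>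
  define C where "C \<omega> \<longleftrightarrow> (\<forall>n<N. avoids (4 * int \<kappa>) (tree_at (P + n) False [] \<omega>))" for \<omega>
  have m [measurable]: "Measurable.pred (prodM input_pmf) A" "Measurable.pred (prodM input_pmf) B" "Measurable.pred (prodM input_pmf) C"
    unfolding A_def B_def C_def by measurable
  have compl: "prob {\<omega>. \<not> X \<omega>} = 1 - prob {\<omega>. X \<omega>}" if "Measurable.pred (prodM input_pmf) X" for X
  proof -
    have "{\<omega>. \<not> X \<omega>} = space (prodM input_pmf) - {\<omega>. X \<omega>}" by auto
    then show ?thesis using prob_compl[OF Collect_in_sets[OF that]] by simp
  qed
  have k1: "1 \<le> real \<kappa>" using assms by simp
  have PA: "prob {\<omega>. A \<omega>} \<ge> 11/12"
  proof -
    have "prob {\<omega>. far (4 * int \<kappa>) 0 P N \<omega>} \<le> (0 ^ 2 + 2/3 * real N) / real_of_int (4 * int \<kappa>) ^ 2"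
      using prob_far[of "4 * int \<kappa>" 0 P N] assms by simp
    also have "\<dots> = 1/12" using k1 by (simp add: N_def field_simps power2_eq_square)
    finally show ?thesis using compl[OF far_measurable, of "4 * int \<kappa>" 0 P N] by (simp add: A_def)
  qed
  have PB: "prob {\<omega>. B \<omega>} \<ge> 1 - exp (- 1/441)"
  proof -
    define a where "a = 1 - avoid_prob (int (40 * \<kappa>))"
    have a: "a = 2 / ((40 * real \<kappa> + 1) * (40 * real \<kappa> + 2))" unfolding a_def avoid_prob_nat' by simp
    \<comment> \<open>\<open>40 \<kappa> + 2 <= 42 \<kappa>\<close> gives a bound whose product with
      \<open>N\<close> is free of \<open>\<kappa>\<close>, namely 1/441.\<close>
    have "a \<ge> 2 / ((42 * real \<kappa>) * (42 * real \<kappa>))"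
      unfolding a using k1 by (intro divide_left_mono mult_mono) auto
    then have "real N * a \<ge> real N * (2 / ((42 * real \<kappa>) * (42 * real \<kappa>)))" by (intro mult_left_mono) auto
    also have "real N * (2 / ((42 * real \<kappa>) * (42 * real \<kappa>))) = 1/441"
      using k1 by (simp add: N_def power2_eq_square field_simps)
    finally have Na: "real N * a \<ge> 1/441" .
    have "avoid_prob (int (40 * \<kappa>)) \<le> exp (- a)" using exp_ge_add_one_self[of "- a"] by (simp add: a_def)
    then have "avoid_prob (int (40 * \<kappa>)) ^ N \<le> exp (- a) ^ N"
      by (intro power_mono) (auto simp: avoid_prob_def)
    also have "\<dots> = exp (- (real N * a))" by (simp flip: exp_of_nat_mult)
    also have "\<dots> \<le> exp (- 1/441)" using Na by simp
    finally have "avoid_prob (int (40 * \<kappa>)) ^ N \<le> exp (- 1/441)" .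
    then show ?thesis
      using compl[OF all_avoid_measurable, of N "40 * int \<kappa>" P True] prob_all_avoid[of N "40 * int \<kappa>" P True]
      by (simp add: B_def)
  qed
  have PC: "prob {\<omega>. C \<omega>} \<ge> 3/4"
  proof -
    define a where "a = 1 - avoid_prob (int (4 * \<kappa>))"
    have a: "a = 2 / ((4 * real \<kappa> + 1) * (4 * real \<kappa> + 2))" unfolding a_def avoid_prob_nat' by simp
    have "a \<le> 2 / ((4 * real \<kappa>) * (4 * real \<kappa>))"
      unfolding a using k1 by (intro divide_left_mono mult_mono) auto
    then have "real N * a \<le> real N * (2 / ((4 * real \<kappa>) * (4 * real \<kappa>)))" by (intro mult_left_mono) auto
    also have "\<dots> = 1/4" using k1 by (simp add: N_def power2_eq_square field_simps)
    finally have "3/4 \<le> 1 + real N * (- a)" by simp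
    also have "\<dots> \<le> (1 + (- a)) ^ N"
      by (rule Bernoulli_inequality) (simp add: a_def avoid_prob_def)
    finally show ?thesis unfolding C_def prob_all_avoid by (simp add: a_def)
  qed
  have "prob {\<omega>. B \<omega> \<and> C \<omega>} = prob {\<omega>. B \<omega>} * prob {\<omega>. C \<omega>}"
    unfolding B_def C_def
    by (rule prodM_prob_conj[OF _ _ depends_on_Not[OF all_avoid_depends] all_avoid_depends]) auto
  moreover have "prob {\<omega>. A \<omega> \<and> (B \<omega> \<and> C \<omega>)} = prob {\<omega>. A \<omega>} * prob {\<omega>. B \<omega> \<and> C \<omega>}"
  proof (rule prodM_prob_conj)
    show "depends_on A {Step m | m. P \<le> m \<and> m < P + N}"
      unfolding A_def by (rule depends_on_Not[OF far_depends])
    show "depends_on (\<lambda>\<omega>. B \<omega> \<and> C \<omega>) (- {Step m | m. True})"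
      unfolding B_def C_def
      by (intro depends_on_conj depends_on_Not depends_on_mono[OF all_avoid_depends]) auto
  qed auto
  moreover have "block_const \<le> prob {\<omega>. A \<omega>} * (prob {\<omega>. B \<omega>} * prob {\<omega>. C \<omega>})"
    unfolding block_const_def by (intro mult_mono PA PB PC) auto
  ultimately show ?thesis by (simp add: block_event_alt A_def B_def C_def N_def)
qed

text \<open>All levels of the range are covered, since which of them is merged is not known in
  advance. In \<open>early\<close> the margin \<open>K - P\<close> compensates for spine labels as
  low as \<open>- P\<close> before the stretch.\<close>

lemma cut_level_block:
  assumes us: "unit_steps \<omega>" and fin: "\<And>n. finite {u. in_tree \<omega> n True u}" and mg: "merged \<omega> k"
    and blk: "block_event P \<kappa> \<omega>" and K: "K = 4 * int \<kappa>" "int P \<le> K"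
    and early: "\<And>m. m < P \<Longrightarrow> avoids (K - int P) (tree_at m False [] \<omega>)"
    and k: "3 * K \<le> int k + 1" "int k + 1 \<le> 8 * K"
  shows "cut_level \<omega> k"
proof -
  have st: "\<bar>\<omega> (Step i)\<bar> \<le> 1" for i using us by (simp add: unit_steps_def)
  have spine: "\<bar>spine_label \<omega> m\<bar> \<le> int m" for m
  proof (induction m)
    case (Suc m)
    then show ?case using st[of m] by (simp add: spine_label_def)
  qed (simp add: spine_label_def)
  obtain n where n: "n < 2 * \<kappa>\<^sup>2" "\<not> avoids (40 * int \<kappa>) (tree_at (P + n) True [] \<omega>)"
    using blk by (auto simp: block_event_def)
  have near: "\<bar>spine_label \<omega> (P + j) - spine_label \<omega> P\<bar> < K" if "j < 2 * \<kappa>\<^sup>2" for j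
  proof -
    have "spine_label \<omega> (P + j) = spine_label \<omega> P + (\<Sum>i<j. \<omega> (Step (P + i)))"
      unfolding spine_label_def by (induction j) auto
    moreover have "\<bar>\<Sum>i<j. \<omega> (Step (P + i))\<bar> < K"
    proof (rule ccontr)
      assume "\<not> \<bar>\<Sum>i<j. \<omega> (Step (P + i))\<bar> < K"
      then have "far (4 * int \<kappa>) 0 P (2 * \<kappa>\<^sup>2) \<omega>"
        unfolding far_def using that K(1) by (intro exI[of _ j]) auto
      then show False using blk by (simp add: block_event_def)
    qed
    ultimately show ?thesis by simp
  qed
  have lab_vert: "vlabel \<omega> (vert m s v) = spine_label \<omega> m + rel_label (tree_at m s [] \<omega>) v" for m s v
    using vlabel_append[of \<omega> m s "[]" v] by (simp add: vert_def)
  have right: "vlabel \<omega> (vert m False v) \<noteq> - int (Suc k)" if "m < P + n" "in_tree \<omega> m False v" for m v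
  proof (cases "m < P")
    case True
    then have "- (K - int P) < rel_label (tree_at m False [] \<omega>) v"
      using early[OF True] that(2) by (simp add: avoids_def node_in_tree)
    then show ?thesis using spine[of m] True k K unfolding lab_vert by auto
  next
    case False
    define j where "j = m - P"
    have j: "m = P + j" "j < n" using False that(1) by (auto simp: j_def)
    then have "avoids K (tree_at m False [] \<omega>)" using blk n(1) K(1) by (simp add: block_event_def)
    then have "- K < rel_label (tree_at m False [] \<omega>) v" using that(2) by (simp add: avoids_def node_in_tree)
    \<comment> \<open>Inside the stretch a right label exceeds
      \<open>- P - K - K >= - 3 * K\<close>.\<close>
    then show ?thesis using spine[of P] near[of j] n(1) j k K unfolding lab_vert by auto
  qed
  obtain v where v: "in_tree \<omega> (P + n) True v" "rel_label (tree_at (P + n) True [] \<omega>) v \<le> - (10 * K)"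
    using n(2) K(1) by (auto simp: avoids_def node_in_tree)
  have "lc_valid \<omega> (P + n, v, 0)" using v by (simp add: lc_valid_def)
  then obtain t where t: "contour \<omega> t = (P + n, v, 0)" using contour_surj[OF fin] by blast
  \<comment> \<open>The label at \<open>t\<close> is at most
    \<open>P + K - 10 * K <= - 8 * K\<close>.\<close>
  have "lab \<omega> t \<le> - int (Suc k)"
    using v(2) spine[of P] near[OF n(1)] K(2) k by (simp add: lab_def t lc_vertex_def lab_vert)
  then obtain q where q: "q \<le> t" "lab \<omega> q = - int (Suc k)"
    using int_ivt[of 0 t "lab \<omega>" "- int (Suc k)"] lab_step[OF us] by auto
  define T where "T = (LEAST q. lab \<omega> q = - int (Suc k))"
  have T: "lab \<omega> T = - int (Suc k)" "\<And>q. q < T \<Longrightarrow> lab \<omega> q \<noteq> - int (Suc k)"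
    unfolding T_def using LeastI[of "\<lambda>q. lab \<omega> q = - int (Suc k)" q] q(2) not_less_Least by blast+
  \<comment> \<open>The first visit to the level may occur in an earlier left tree, which only
    shortens the list of right trees to be checked.\<close>
  have "T \<le> t" using q T(2)[of q] by (meson le_trans not_le_imp_less)
  obtain n' u j where c: "contour \<omega> T = (n', u, j)" by (cases "contour \<omega> T")
  have "\<not> lc_less (contour \<omega> t) (contour \<omega> T)" using \<open>T \<le> t\<close> by (simp add: contour_less_iff)
  then have "n' \<le> P + n" by (auto simp: t c lc_less_def)
  then have "\<forall>m<n'. \<forall>v. in_tree \<omega> m False v \<longrightarrow> vlabel \<omega> (vert m False v) \<noteq> - int (Suc k)"
    using right by simp
  then show ?thesis unfolding cut_level_def using mg c T by blast
qed

text \<open>By the zero-one law infinitely many events occur almost surely or almost never; the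
  latter is impossible, as every tail union has probability at least \<open>c\<close> and so has
  their intersection.\<close>

lemma (in prob_space) AE_infinite_of_indep:
  fixes H :: "nat \<Rightarrow> 'a \<Rightarrow> bool"
  assumes ind: "indep_events (\<lambda>i. {\<omega> \<in> space M. H i \<omega>}) UNIV"
    and c: "0 < c" "\<And>i. c \<le> prob {\<omega> \<in> space M. H i \<omega>}"
  shows "AE \<omega> in M. infinite {i. H i \<omega>}"
proof -
  have [measurable]: "{\<omega> \<in> space M. H i \<omega>} \<in> events" for i
    using ind by (auto simp: indep_events_def)
  define U where "U n = (\<Union>i\<in>{n..}. {\<omega> \<in> space M. H i \<omega>})" for n
  have Um [measurable]: "U n \<in> events" for n unfolding U_def by measurable
  have "decseq U" unfolding decseq_def U_def by (auto intro: order_trans)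
  then have lim: "(\<lambda>n. prob (U n)) \<longlonglongrightarrow> prob (\<Inter>n. U n)"
    by (intro finite_Lim_measure_decseq) auto
  have "c \<le> prob (U n)" for n
  proof -
    have "prob {\<omega> \<in> space M. H n \<omega>} \<le> prob (U n)"
      by (rule finite_measure_mono) (auto simp: U_def)
    then show ?thesis using c(2)[of n] by simp
  qed
  then have pos: "c \<le> prob (\<Inter>n. U n)" using LIMSEQ_le_const[OF lim] by blast
  from borel_0_1_law_AE[OF ind] show ?thesis
  proof
    assume fin: "AE \<omega> in M. finite {i. H i \<omega>}"
    have "AE \<omega> in M. \<omega> \<notin> (\<Inter>n. U n)"
      using fin
    proof eventually_elim
      case (elim \<omega>)
      then obtain n where "\<forall>i\<in>{i. H i \<omega>}. i < n" using finite_nat_set_iff_bounded by blast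
      then have "\<omega> \<notin> U n" by (auto simp: U_def not_less[symmetric])
      then show ?case by blast
    qed
    then have "prob (\<Inter>n. U n) = 0" by (subst prob_eq_0) auto
    then show ?thesis using pos c(1) by simp
  qed
qed

lemma (in prob_space) AE_eventually_not:
  fixes B :: "nat \<Rightarrow> 'a \<Rightarrow> bool"
  assumes [measurable]: "\<And>i. Measurable.pred M (B i)"
    and le: "\<And>i. prob {\<omega> \<in> space M. B i \<omega>} \<le> c * (1/2) ^ i"
  shows "AE \<omega> in M. eventually (\<lambda>i. \<not> B i \<omega>) sequentially"
proof -
  have "summable (\<lambda>i. c * (1/2 :: real) ^ i)" by (intro summable_mult summable_geometric) simp
  then have "summable (\<lambda>i. prob {\<omega> \<in> space M. B i \<omega>})"
    by (rule summable_comparison_test[rotated]) (use le in auto)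
  then have "AE \<omega> in M. eventually (\<lambda>i. \<omega> \<in> space M - {\<omega> \<in> space M. B i \<omega>}) sequentially"
    by (intro borel_cantelli_AE1) (auto simp: emeasure_eq_measure)
  then show ?thesis by eventually_elim (auto elim: eventually_mono)
qed

text \<open>The linear tail bound \<open>2 / x\<close> is cruder than the exact one but enough, as
  \<open>x\<close> is taken much larger than \<open>P\<close>.\<close>

lemma prob_right_trees_reach:
  assumes "0 < x"
  shows "measure (prodM input_pmf) {\<omega>. \<exists>m<P. \<not> avoids (int x) (tree_at m False [] \<omega>)} \<le> 2 * real P / real x"
proof -
  interpret prob_space "prodM input_pmf" by (rule prob_space_prodM)
  have "prob {\<omega>. \<exists>m<P. \<not> avoids (int x) (tree_at m False [] \<omega>)}
      = 1 - prob {\<omega>. \<forall>m<P. avoids (int x) (tree_at (0 + m) False [] \<omega>)}"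
  proof -
    have "{\<omega>. \<exists>m<P. \<not> avoids (int x) (tree_at m False [] \<omega>)}
        = space (prodM input_pmf) - {\<omega>. \<forall>m<P. avoids (int x) (tree_at (0 + m) False [] \<omega>)}" by auto
    then show ?thesis
      using prob_compl[OF Collect_in_sets[OF all_avoid_measurable[of P "int x" 0 False]]] by simp
  qed
  also have "\<dots> = 1 - avoid_prob (int x) ^ P" unfolding prob_all_avoid ..
  also have "\<dots> \<le> real P * (1 - avoid_prob (int x))"
    using Bernoulli_inequality[of "avoid_prob (int x) - 1" P] by (simp add: avoid_prob_def algebra_simps)
  also have "\<dots> \<le> real P * (2 / real x)"
  proof (rule mult_left_mono)
    have "real x * 1 \<le> (real x + 1) * (real x + 2)" by (intro mult_mono) auto
    then show "1 - avoid_prob (int x) \<le> 2 / real x"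
      unfolding avoid_prob_nat' using assms by (intro divide_left_mono) auto
  qed simp
  finally show ?thesis by (simp add: mult.commute)
qed

lemma block_coords_disjoint:
  assumes "\<And>i. p (Suc i) = p i + N i"
  shows "disjoint_family (\<lambda>i. block_coords (p i) (N i))"
proof -
  have mono: "p i + N i \<le> p j" if "i < j" for i j :: nat
    using that
  proof (induction j)
    case (Suc j)
    then show ?case using assms[of j] by (cases "i = j") auto
  qed simp
  have "block_coords (p i) (N i) \<inter> block_coords (p j) (N j) = {}" if "i < j" for i j
    using mono[OF that] by (auto simp: block_coords_def)
  then show ?thesis unfolding disjoint_family_on_def by (metis Int_commute linorder_neqE_nat)
qed

theorem theorem5:
  shows "AE \<omega> in input_space.
           \<exists>q :: nat \<Rightarrow> vtx. inj q \<and> (\<forall>i. q i \<in> vertices \<omega>) \<and>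
             (\<forall>p. proper_geodesic_ray \<omega> p \<longrightarrow> (\<forall>i. q i \<in> range p))"
proof -
  interpret prob_space "prodM input_pmf" by (rule prob_space_prodM)
  have "\<forall>i. \<exists>s. \<forall>k0. prob {\<omega>. \<forall>k\<in>{k0..k0+s}. \<not> merged \<omega> k} \<le> (1/2) ^ i"
    by (intro allI merged_window) simp
  from choice[OF this] obtain s
    where s: "\<forall>i. \<forall>k0. prob {\<omega>. \<forall>k\<in>{k0..k0+s i}. \<not> merged \<omega> k} \<le> (1/2) ^ i" ..
  \<comment> \<open>\<open>P * 2 ^ i\<close> makes the right trees before the stretch shallow up to
    probability \<open>2 * (1/2) ^ i\<close>; \<open>P\<close> bounds the spine label at its start
    and absorbs the subtraction in \<open>4 * \<kappa> - P\<close>; \<open>s i\<close> makes room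
    for the merging window; 1 ensures positivity.\<close>
  define kap where "kap i P = P * 2 ^ i + P + s i + 1" for i P :: nat
  \<comment> \<open>Each stretch starts where the previous one ends, so the block coordinates are
    disjoint.\<close>
  define pos where "pos = rec_nat 0 (\<lambda>i P. P + 2 * (kap i P)\<^sup>2)"
  define \<kappa> where "\<kappa> i = kap i (pos i)" for i
  have pos_Suc: "pos (Suc i) = pos i + 2 * (\<kappa> i)\<^sup>2" for i by (simp add: pos_def \<kappa>_def)
  have \<kappa>: "\<kappa> i = pos i * 2 ^ i + pos i + s i + 1" for i by (simp add: \<kappa>_def kap_def)
  have pos_ge: "i \<le> pos i" for i
  proof (induction i)
    case (Suc i)
    have "1 \<le> (\<kappa> i)\<^sup>2" using \<kappa>[of i] by simp
    then show ?case using Suc pos_Suc[of i] by linarith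
  qed simp
  have H: "AE \<omega> in prodM input_pmf. infinite {i. block_event (pos i) (\<kappa> i) \<omega>}"
  proof (rule AE_infinite_of_indep)
    show "indep_events (\<lambda>i. {\<omega> \<in> space (prodM input_pmf). block_event (pos i) (\<kappa> i) \<omega>}) UNIV"
      using prodM_indep[where E="\<lambda>i. block_event (pos i) (\<kappa> i)",
          OF block_event_measurable block_event_depends block_coords_disjoint[where p=pos, OF pos_Suc]] by simp
    show "block_const \<le> prob {\<omega> \<in> space (prodM input_pmf). block_event (pos i) (\<kappa> i) \<omega>}" for i
      using prob_block_event[of "\<kappa> i" "pos i"] by (simp add: \<kappa>)
  qed (rule block_const_pos)
  have R: "AE \<omega> in prodM input_pmf. eventually (\<lambda>i. \<not> (\<exists>m<pos i. \<not> avoids (4 * int (\<kappa> i) - int (pos i)) (tree_at m False [] \<omega>))) sequentially"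
  proof (rule AE_eventually_not)
    fix i
    define x where "x = 4 * \<kappa> i - pos i"
    have x: "pos i * 2 ^ i \<le> x" "0 < x" "4 * int (\<kappa> i) - int (pos i) = int x"
      using \<kappa>[of i] by (auto simp: x_def)
    show "Measurable.pred (prodM input_pmf) (\<lambda>\<omega>. \<exists>m<pos i. \<not> avoids (4 * int (\<kappa> i) - int (pos i)) (tree_at m False [] \<omega>))"
      by measurable
    have "real (pos i) * 2 ^ i \<le> real x"
      using x(1) by (metis of_nat_le_iff of_nat_mult of_nat_numeral of_nat_power)
    then have "2 * real (pos i) / real x \<le> 2 * (1/2) ^ i"
      using x(2) by (simp add: field_simps power_divide)
    then show "prob {\<omega> \<in> space (prodM input_pmf). \<exists>m<pos i. \<not> avoids (4 * int (\<kappa> i) - int (pos i)) (tree_at m False [] \<omega>)} \<le> 2 * (1/2) ^ i"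
      using prob_right_trees_reach[OF x(2), of "pos i"] unfolding x(3) by simp
  qed
  \<comment> \<open>The window starts at \<open>3 * K = 12 * \<kappa> i\<close> and, as
    \<open>s i < \<kappa> i\<close>, ends well before \<open>8 * K\<close>.\<close>
  have M: "AE \<omega> in prodM input_pmf. eventually (\<lambda>i. \<not> (\<forall>k\<in>{12 * \<kappa> i..12 * \<kappa> i + s i}. \<not> merged \<omega> k)) sequentially"
  proof (rule AE_eventually_not)
    show "prob {\<omega> \<in> space (prodM input_pmf). \<forall>k\<in>{12 * \<kappa> i..12 * \<kappa> i + s i}. \<not> merged \<omega> k} \<le> 1 * (1/2) ^ i" for i
      using s[THEN spec, of i, THEN spec, of "12 * \<kappa> i"] by simp
  qed measurable
  show ?thesis
    unfolding input_space_prodM using H R M AE_unit_steps AE_finite_in_tree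
  proof eventually_elim
    case (elim \<omega>)
    have "infinite {k. cut_level \<omega> k}"
      unfolding infinite_nat_iff_unbounded
    proof
      fix b
      obtain i0 where i0: "\<And>i. i0 \<le> i \<Longrightarrow> \<forall>m<pos i. avoids (4 * int (\<kappa> i) - int (pos i)) (tree_at m False [] \<omega>)"
        using elim(2) unfolding eventually_sequentially by blast
      obtain i1 where i1: "\<And>i. i1 \<le> i \<Longrightarrow> \<exists>k\<in>{12 * \<kappa> i..12 * \<kappa> i + s i}. merged \<omega> k"
        using elim(3) unfolding eventually_sequentially by blast
      obtain i where i: "max b (max i0 i1) < i" "block_event (pos i) (\<kappa> i) \<omega>"
        using elim(1) unfolding infinite_nat_iff_unbounded by blast
      obtain k where k: "k \<in> {12 * \<kappa> i..12 * \<kappa> i + s i}" "merged \<omega> k" using i1[of i] i(1) by auto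
      have "cut_level \<omega> k"
      proof (rule cut_level_block[OF elim(4) _ k(2) i(2) refl])
        show "finite {u. in_tree \<omega> n True u}" for n using elim(5) by blast
        show "int (pos i) \<le> 4 * int (\<kappa> i)" using \<kappa>[of i] by simp
        show "avoids (4 * int (\<kappa> i) - int (pos i)) (tree_at m False [] \<omega>)" if "m < pos i" for m
          using i0[of i] i(1) that by simp
        show "3 * (4 * int (\<kappa> i)) \<le> int k + 1" using k(1) by simp
        have "s i < \<kappa> i" using \<kappa>[of i] by simp
        then show "int k + 1 \<le> 8 * (4 * int (\<kappa> i))" using k(1) by simp
      qed
      moreover have "b < k"
      proof -
        have "pos i \<le> \<kappa> i" using \<kappa>[of i] by simp
        then show ?thesis using i(1) pos_ge[of i] k(1) by simp
      qed
      ultimately show "\<exists>k>b. k \<in> {k. cut_level \<omega> k}" by blast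
    qed
    then show ?case using cut_levels_suffice[OF elim(4)] elim(5) by blast
  qed
qed

end
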